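(* Let $N\ge 2$, $s\in(0,1)$ and $p=N/s$. For all $\alpha>0$, all $\beta\in[0,N)$ and all $u\in W^{s,p}(\mathbb R^N)$, $$\int_{\mathbb R^N}\frac{\Phi_\alpha(u)}{|x|^\beta}\,dx<\infty .$$ Furthermore, for all $\beta\in[0,N)$, all $0<\alpha<\big(1-\tfrac{\beta}{N}\big)\alpha_{N,s}$ and all $\tau>0$, $$\sup\Big\{\int_{\mathbb R^N}\frac{\Phi_\alpha(u)}{|x|^\beta}\,dx \;:\; u\in W^{s,p}(\mathbb R^N),\ \|u\|_{s,p,\tau}\le 1\Big\}<\infty ,$$ where $\|u\|_{s,p,\tau}=\big([u]_{s,p}^p+\tau\int_{\mathbb R^N}|u|^p\,dx\big)^{1/p}$.
   Context: For $1<p<\infty$, $0<s<1$: $[u]_{s,p}^p=\int_{\mathbb R^N}\int_{\mathbb R^N}\frac{|u(x)-u(y)|^p}{|x-y|^{N+sp}}\,dx\,dy$, and $W^{s,p}(\mathbb R^N)=\{u\in L^p(\mathbb R^N):[u]_{s,p}<\infty\}$ with norm $\|u\|_{L^p(\mathbb R^N)}+[u]_{s,p}$. For $\alpha>0$ and $t\in\mathbb R$, $$\Phi_\alpha(t)=e^{\alpha|t|^{N/(N-s)}}-\sum_{j\in\mathbb Z,\ 0\le j<N/s-1}\frac{\alpha^j}{j!}|t|^{jN/(N-s)} .$$ The constant $\alpha_{N,s}>0$ comes from the known fractional Moser–Trudinger inequality on bounded domains: it is a fixed positive constant depending only on $N$ and $s$ such that, with $p=N/s$, for every bounded domain $\Omega\subset\mathbb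 R^N$ with Lipschitz boundary and every $\alpha\in[0,\alpha_{N,s})$, $$\sup\Big\{\int_\Omega \exp\big(\alpha|u|^{N/(N-s)}\big)\,dx:\ u\in\widetilde W^{s,p}_0(\Omega),\ [u]_{s,p}\le 1\Big\}<\infty,$$ where $\widetilde W_0^{s,p}(\Omega)$ is the completion of $C_c^\infty(\Omega)$ in the norm of $W^{s,p}(\mathbb R^N)$. (The existence of such a constant is a known result and may be assumed.) *)

theory Defs
  imports "HOL-Analysis.Analysis"
begin

text \<open>The dimension \<open>N\<close> is \<open>CARD('n)\<close>.  Sobolev functions are Lebesgue measurable representatives
  \<open>u :: real ^ 'n \<Rightarrow> real\<close>, not quotiented by equality almost everywhere.\<close>

definition gagliardo_energy :: "real \<Rightarrow> real \<Rightarrow> (real ^ 'n \<Rightarrow> real) \<Rightarrow> ennreal" where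
  "gagliardo_energy s p u =
     (\<integral>\<^sup>+ x. (\<integral>\<^sup>+ y. ennreal (\<bar>u x - u y\<bar> powr p
        / norm (x - y) powr (real CARD('n) + s * p)) \<partial>lebesgue) \<partial>lebesgue)"

definition frac_sobolev :: "real \<Rightarrow> real \<Rightarrow> (real ^ 'n \<Rightarrow> real) set" where
  "frac_sobolev s p =
     {u. u \<in> borel_measurable lebesgue \<and> integrable lebesgue (\<lambda>x. \<bar>u x\<bar> powr p) \<and>
         gagliardo_energy s p u < \<infinity>}"

text \<open>The real-valued quantities below are meaningful only for functions in \<^const>\<open>frac_sobolev\<close>:
  outside it, \<^const>\<open>enn2real\<close> sends an infinite energy to \<open>0\<close>.\<close>

definition gagliardo_seminorm :: "real \<Rightarrow> real \<Rightarrow> (real ^ 'n \<Rightarrow> real) \<Rightarrow> real" where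
  "gagliardo_seminorm s p u = enn2real (gagliardo_energy s p u) powr (1 / p)"

definition Lp_norm :: "real \<Rightarrow> (real ^ 'n \<Rightarrow> real) \<Rightarrow> real" where
  "Lp_norm p u = (\<integral>x. \<bar>u x\<bar> powr p \<partial>lebesgue) powr (1 / p)"

definition frac_sobolev_norm :: "real \<Rightarrow> real \<Rightarrow> (real ^ 'n \<Rightarrow> real) \<Rightarrow> real" where
  "frac_sobolev_norm s p u = Lp_norm p u + gagliardo_seminorm s p u"

definition frac_sobolev_norm_tau :: "real \<Rightarrow> real \<Rightarrow> real \<Rightarrow> (real ^ 'n \<Rightarrow> real) \<Rightarrow> real" where
  "frac_sobolev_norm_tau s p \<tau> u =
     (gagliardo_seminorm s p u powr p + \<tau> * (\<integral>x. \<bar>u x\<bar> powr p \<partial>lebesgue)) powr (1 / p)"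

primrec Ck_function :: "nat \<Rightarrow> (real ^ 'n \<Rightarrow> real) \<Rightarrow> bool" where
  "Ck_function 0 f \<longleftrightarrow> continuous_on UNIV f"
| "Ck_function (Suc k) f \<longleftrightarrow>
     (\<forall>x. f differentiable (at x)) \<and> (\<forall>v. Ck_function k (\<lambda>x. frechet_derivative f (at x) v))"

definition test_functions :: "(real ^ 'n) set \<Rightarrow> (real ^ 'n \<Rightarrow> real) set" where
  "test_functions \<Omega> =
     {f. (\<forall>k. Ck_function k f) \<and> compact (closure {x. f x \<noteq> 0}) \<and> closure {x. f x \<noteq> 0} \<subseteq> \<Omega>}"

text \<open>Since \<open>W\<^sup>s\<^sup>,\<^sup>p\<close> is complete, the completion of the test functions in its norm is realised as their
  closure in \<open>W\<^sup>s\<^sup>,\<^sup>p\<close>.\<close>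

definition frac_sobolev_zero :: "real \<Rightarrow> real \<Rightarrow> (real ^ 'n) set \<Rightarrow> (real ^ 'n \<Rightarrow> real) set" where
  "frac_sobolev_zero s p \<Omega> =
     {u \<in> frac_sobolev s p.
        \<exists>f. (\<forall>k::nat. f k \<in> test_functions \<Omega>) \<and>
            (\<lambda>k. frac_sobolev_norm s p (\<lambda>x. f k x - u x)) \<longlonglongrightarrow> 0}"

text \<open>Near each boundary point \<open>\<Omega>\<close> is the strict epigraph, in some direction \<open>e\<close>, of a Lipschitz
  function \<open>g\<close> on the hyperplane orthogonal to \<open>e\<close>.\<close>

definition lipschitz_boundary :: "(real ^ 'n) set \<Rightarrow> bool" where
  "lipschitz_boundary \<Omega> \<longleftrightarrow>
     (\<forall>z \<in> frontier \<Omega>. \<exists>e r L g. norm e = 1 \<and> r > 0 \<and> L-lipschitz_on {y. y \<bullet> e = 0} g \<and>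
        \<Omega> \<inter> ball z r = {x \<in> ball z r. g (x - (x \<bullet> e) *\<^sub>R e) < x \<bullet> e})"

definition bounded_lipschitz_domain :: "(real ^ 'n) set \<Rightarrow> bool" where
  "bounded_lipschitz_domain \<Omega> \<longleftrightarrow>
     open \<Omega> \<and> connected \<Omega> \<and> \<Omega> \<noteq> {} \<and> bounded \<Omega> \<and> lipschitz_boundary \<Omega>"

text \<open>The power \<open>|t|\<close> to the \<open>jN/(N-s)\<close> is written as a natural power of \<open>|t| powr (N/(N-s))\<close>, because
  \<open>0 powr 0 = 0\<close> would give the wrong value of the term \<open>j = 0\<close> at \<open>t = 0\<close>.\<close>

definition Phi :: "nat \<Rightarrow> real \<Rightarrow> real \<Rightarrow> real \<Rightarrow> real" where
  "Phi N s \<alpha> t =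
     exp (\<alpha> * \<bar>t\<bar> powr (real N / (real N - s)))
     - (\<Sum>j\<in>{j::nat. real j < real N / s - 1}.
          \<alpha> ^ j / fact j * (\<bar>t\<bar> powr (real N / (real N - s))) ^ j)"

text \<open>\<^const>\<open>Phi\<close> is nonnegative for \<open>\<alpha> \<ge> 0\<close>, so \<^const>\<open>ennreal\<close> truncates nothing; the value of the
  integrand at \<open>x = 0\<close> is irrelevant.\<close>

definition weighted_Phi_integral :: "real \<Rightarrow> real \<Rightarrow> real \<Rightarrow> (real ^ 'n \<Rightarrow> real) \<Rightarrow> ennreal" where
  "weighted_Phi_integral s \<alpha> \<beta> u =
     (\<integral>\<^sup>+ x. ennreal (Phi CARD('n) s \<alpha> (u x) / norm x powr \<beta>) \<partial>lebesgue)"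

end

theory Submission
  imports Defs
begin

text \<open>
  No rearrangement is used.  A function \<open>u\<close> is localised to \<open>v\<^sub>a(x) = \<phi>(x) u(x + a)\<close>, where \<open>\<phi>\<close> is a
  Lipschitz cutoff of \<open>ball 0 (2R)\<close> equal to \<open>1\<close> on \<open>ball 0 R\<close>.  As the commutator term is
  \<open>O(R\<^sup>-\<^sup>s\<^sup>p)\<close> times the \<open>L\<^sup>p\<close> norm, for large \<open>R\<close> the energy of every \<open>v\<^sub>a\<close> is at most a constant \<open>M\<close>
  arbitrarily close to \<open>1\<close>, so that subcriticality survives.  Mollification does not increase the energy
  and converges almost everywhere, so by Fatou the bounded-domain inequality on a single ball applies
  to each \<open>v\<^sub>a\<close>.  Since the series of \<open>\<Phi>\<close> starts at a power at least \<open>p = N/s\<close>, scaling improves that bound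
  to \<open>\<integral> \<Phi>(v\<^sub>a) \<le> C [v\<^sub>a]\<^sup>p\<close>, and averaging over all translations \<open>a\<close> with Tonelli bounds \<open>\<integral> \<Phi>(u)\<close> by the
  norm of \<open>u\<close>.  The weight only matters near the origin and is absorbed by Young's inequality.
  For an arbitrary \<open>u\<close> and \<open>\<alpha>\<close>, the part of \<open>u\<close> exceeding a high level has small norm and falls under the
  uniform bound, while the rest is bounded and \<open>\<Phi>\<close> is dominated by \<open>|u|\<^sup>p\<close> there.
\<close>

section \<open>Integrals of powers of the norm\<close>

text \<open>A constant bound for each \<open>v_a\<close> is useless on the whole space, which takes
  infinitely many translates to cover; a bound proportional to the energy can be integrated over
  \<open>a\<close>, because the energies of the \<open>v_a\<close> have a finite total. The
  constants are chosen in a forced order. The gap between \<alpha> and the critical constant fixes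
  \<open>M > 1\<close>, the energy that scaling still tolerates. Splitting an increment of
  \<open>v_a\<close> by convexity with weight \<open>l\<close> multiplies the energy of
  \<open>u\<close> by \<open>l^(1-p)\<close>, set to \<open>(1 + M) / 2\<close>; this fixes a
  possibly huge factor of the commutator, and only then is \<open>R\<close> taken so large that the
  commutator, measured against \<tau> times the L^p part, uses at most the other
  \<open>(M - 1) / 2\<close>. The condition on \<beta> comes from conjugate exponents
  \<open>q\<close>, \<open>q'\<close>: the exponential needs \<open>q * \<alpha>\<close> below the
  critical constant, the weight needs \<open>\<beta> * q'\<close> below \<open>N\<close>, and both
  can be met exactly under the stated bound on \<alpha>. Fatou asks only for almost everywhere
  convergence, so the bounded-domain inequality is applied to test functions alone and the
  completion is never analysed.\<close>

lemma sets_borel_ball [measurable]: "ball c r \<in> sets borel"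
  by simp

lemma dyadic_below_one:
  fixes t :: real
  assumes "0 < t" "t < 1"
  obtains k where "(1/2) ^ Suc k \<le> t" "t < (1/2) ^ k"
proof -
  define n where "n = (LEAST n. (1/2) ^ n \<le> t)"
  have ex: "\<exists>n. (1/2) ^ n \<le> t"
    using real_arch_pow_inv[of t "1/2"] assms by (auto intro: less_imp_le)
  have n: "(1/2) ^ n \<le> t" unfolding n_def by (rule LeastI_ex[OF ex])
  with assms have "n \<noteq> 0" by (intro notI) auto
  then obtain k where k: "n = Suc k" by (cases n) auto
  have "\<not> (1/2) ^ k \<le> t"
    using not_less_Least[of k "\<lambda>n. (1/2) ^ n \<le> t"] k n_def by auto
  with n k that[of k] show ?thesis by auto
qed

lemma dyadic_above_one:
  fixes t :: real
  assumes "1 \<le> t"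
  obtains k where "2 ^ k \<le> t" "t < 2 ^ Suc k"
proof -
  define n where "n = (LEAST n. t < 2 ^ n)"
  have ex: "\<exists>n. t < 2 ^ n"
    using real_arch_pow[of 2 t] by auto
  have n: "t < 2 ^ n" unfolding n_def by (rule LeastI_ex[OF ex])
  with assms have "n \<noteq> 0" by (intro notI) auto
  then obtain k where k: "n = Suc k" by (cases n) auto
  have "\<not> t < 2 ^ k"
    using not_less_Least[of k "\<lambda>n. t < 2 ^ n"] k n_def by auto
  with n k that[of k] show ?thesis by auto
qed

text \<open>At each point one term of the series of \<open>c k\<close> times the indicator of
  \<open>ball 0 (r k)\<close> already dominates \<open>f\<close>, so the series does. Its
  \<open>k\<close>-th integral is the volume of the unit ball times \<open>A * q ^ k\<close>, and
  the geometric series converges. This replaces polar coordinates.\<close>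

lemma nn_integral_dyadic_finite:
  fixes f :: "'a::euclidean_space \<Rightarrow> ennreal"
  assumes c: "\<And>k. c k \<ge> 0" and r: "\<And>k. r k \<ge> 0"
    and geo: "\<And>k. c k * r k ^ DIM('a) = A * q ^ k" and q: "0 \<le> q" "q < 1" and A: "0 \<le> A"
    and f: "\<And>x. f x \<noteq> 0 \<Longrightarrow> x \<noteq> 0 \<Longrightarrow> \<exists>k. f x \<le> ennreal (c k) \<and> x \<in> ball 0 (r k)"
  shows "(\<integral>\<^sup>+ x. f x \<partial>lborel) < \<infinity>"
proof -
  define C where "C = unit_ball_vol (real DIM('a))"
  have C: "C \<ge> 0" by (simp add: C_def)
  have "(\<integral>\<^sup>+ x. f x \<partial>lborel) \<le> (\<integral>\<^sup>+ x. (\<Sum>k. ennreal (c k) * indicator (ball (0::'a) (r k)) x) \<partial>lborel)"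
  proof (intro nn_integral_mono_AE)
    have "AE x in lborel. x \<noteq> (0::'a)" by (rule AE_lborel_singleton)
    then show "AE x in lborel. f x \<le> (\<Sum>k. ennreal (c k) * indicator (ball (0::'a) (r k)) x)"
    proof eventually_elim
      case (elim x)
      show ?case
      proof (cases "f x = 0")
        case False
        then obtain k where k: "f x \<le> ennreal (c k)" "x \<in> ball 0 (r k)" using f elim by blast
        then have "f x \<le> ennreal (c k) * indicator (ball (0::'a) (r k)) x" by (simp add: indicator_def)
        also have "\<dots> \<le> (\<Sum>k. ennreal (c k) * indicator (ball (0::'a) (r k)) x)"
          using sum_le_suminf[of "\<lambda>k. ennreal (c k) * indicator (ball (0::'a) (r k)) x" "{k}"]
          by (simp del: sum_mult_indicator)
        finally show ?thesis .
      qed simp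
    qed
  qed
  also have "\<dots> = (\<Sum>k. \<integral>\<^sup>+ x. ennreal (c k) * indicator (ball (0::'a) (r k)) x \<partial>lborel)"
    by (rule nn_integral_suminf) measurable
  also have "\<dots> = (\<Sum>k. ennreal (C * A * q ^ k))"
  proof (intro suminf_cong)
    fix k
    have "(\<integral>\<^sup>+ x. ennreal (c k) * indicator (ball (0::'a) (r k)) x \<partial>lborel) = ennreal (c k) * ennreal (C * r k ^ DIM('a))"
      by (subst nn_integral_cmult_indicator) (auto simp: emeasure_ball r C_def)
    also have "\<dots> = ennreal (C * (c k * r k ^ DIM('a)))"
      using c C r by (simp add: ennreal_mult' [symmetric] mult_ac)
    finally show "(\<integral>\<^sup>+ x. ennreal (c k) * indicator (ball (0::'a) (r k)) x \<partial>lborel) = ennreal (C * A * q ^ k)"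
      by (simp only: geo) (simp add: mult_ac)
  qed
  also have "\<dots> = ennreal (\<Sum>k. C * A * q ^ k)"
    using q A C by (intro suminf_ennreal2) (auto intro!: summable_mult)
  finally show ?thesis by (simp add: le_less_trans)
qed

lemma nn_integral_norm_powr_ball:
  fixes a :: real
  assumes "a < real DIM('a::euclidean_space)"
  shows "(\<integral>\<^sup>+ x\<in>ball (0::'a) 1. ennreal (norm x powr - a) \<partial>lborel) < \<infinity>"
proof -
  \<comment> \<open>\<open>cutoff_kernel_finite\<close> uses an exponent that can be negative;
    raising it to 0 only enlarges the integrand on the unit ball and makes the power monotone on
    dyadic shells.\<close>
  define b where "b = max a 0"
  have b: "0 \<le> b" "b < real DIM('a)" "a \<le> b" using assms by (auto simp: b_def)
  show ?thesis
  proof (rule nn_integral_dyadic_finite[where c = "\<lambda>k. (2 powr b) ^ Suc k" and r = "\<lambda>k. (1/2) ^ k"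
        and A = "2 powr b" and q = "2 powr b / 2 ^ DIM('a)"])
    show "2 powr b / 2 ^ DIM('a) < 1"
      using b by (simp add: powr_realpow[symmetric])
    show "(2 powr b) ^ Suc k * ((1/2) ^ k) ^ DIM('a) = 2 powr b * (2 powr b / 2 ^ DIM('a)) ^ k" for k
      by (simp add: power_divide power_mult[symmetric] mult.commute)
  next
    fix x :: 'a
    assume *: "ennreal (norm x powr - a) * indicator (ball 0 1) x \<noteq> 0" "x \<noteq> 0"
    then have x: "norm x < 1" "0 < norm x" by (auto simp: indicator_def split: if_splits)
    obtain k where k: "(1/2) ^ Suc k \<le> norm x" "norm x < (1/2) ^ k"
      using dyadic_below_one x by blast
    have "norm x powr - a \<le> norm x powr - b"
      using x b by (intro powr_mono') auto
    also have "\<dots> \<le> ((1/2) ^ Suc k) powr - b"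
      using k b by (intro powr_mono2') auto
    also have "\<dots> = (2 powr b) ^ Suc k"
      by (simp add: powr_realpow[symmetric] powr_powr powr_minus_divide powr_divide mult_ac del: power_Suc)
    finally show "\<exists>k. ennreal (norm x powr - a) * indicator (ball 0 1) x \<le> ennreal ((2 powr b) ^ Suc k) \<and> x \<in> ball 0 ((1/2) ^ k)"
      using x k by (intro exI[of _ k]) (auto simp: indicator_def intro!: ennreal_leI)
  qed auto
qed

lemma nn_integral_norm_powr_outside:
  fixes a :: real
  assumes "real DIM('a::euclidean_space) < a"
  shows "(\<integral>\<^sup>+ x\<in>- ball (0::'a) 1. ennreal (norm x powr - a) \<partial>lborel) < \<infinity>"
proof -
  have a: "0 < a" using assms by (meson le_less_trans of_nat_0_le_iff)
  show ?thesis
  proof (rule nn_integral_dyadic_finite[where c = "\<lambda>k. (2 powr - a) ^ k" and r = "\<lambda>k. 2 ^ Suc k"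
        and A = "2 ^ DIM('a)" and q = "2 powr - a * 2 ^ DIM('a)"])
    show "2 powr - a * 2 ^ DIM('a) < 1"
      using assms by (simp add: powr_realpow[symmetric] powr_add[symmetric] powr_less_one)
    show "(2 powr - a) ^ k * (2 ^ Suc k) ^ DIM('a) = 2 ^ DIM('a) * (2 powr - a * 2 ^ DIM('a)) ^ k" for k
      by (simp add: power_mult_distrib power_mult[symmetric] mult.commute)
  next
    fix x :: 'a
    assume *: "ennreal (norm x powr - a) * indicator (- ball 0 1) x \<noteq> 0" "x \<noteq> 0"
    then have x: "norm x \<ge> 1" by (auto simp: indicator_def split: if_splits)
    obtain k where k: "2 ^ k \<le> norm x" "norm x < 2 ^ Suc k"
      using dyadic_above_one x by blast
    have "norm x powr - a \<le> (2 ^ k) powr - a"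
      using k a by (intro powr_mono2') auto
    also have "\<dots> = (2 powr - a) ^ k"
      by (simp add: powr_realpow[symmetric] powr_powr mult_ac)
    finally show "\<exists>k. ennreal (norm x powr - a) * indicator (- ball 0 1) x \<le> ennreal ((2 powr - a) ^ k) \<and> x \<in> ball 0 (2 ^ Suc k)"
      using x k by (intro exI[of _ k]) (auto simp: indicator_def intro!: ennreal_leI)
  qed auto
qed

section \<open>The commutator kernel and its decay\<close>

text \<open>Majorant, depending on \<open>x - y\<close> alone, of the Gagliardo integrand of a
  cutoff with Lipschitz constant \<open>1 / R\<close> and values in the unit interval.\<close>

definition cutoff_kernel :: "real \<Rightarrow> real \<Rightarrow> real \<Rightarrow> real ^ 'n \<Rightarrow> real" where
  "cutoff_kernel s p R z = min 1 (norm z / R) powr p / norm z powr (real CARD('n) + s * p)"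

lemma borel_measurable_cutoff_kernel [measurable]: "cutoff_kernel s p R \<in> borel_measurable borel"
  unfolding cutoff_kernel_def[abs_def] by measurable

text \<open>Near the origin the numerator lowers the exponent to \<open>N + s p - p\<close>, below
  \<open>N\<close> as \<open>s < 1\<close>; at infinity the exponent is \<open>N + s p\<close>,
  above \<open>N\<close> as \<open>s > 0\<close>.\<close>

lemma cutoff_kernel_finite:
  assumes "0 < s" "s < 1" "0 < p"
  shows "(\<integral>\<^sup>+ z. ennreal (cutoff_kernel s p 1 (z :: real ^ 'n)) \<partial>lborel) < \<infinity>"
proof -
  let ?N = "real CARD('n)"
  have eq: "ennreal (cutoff_kernel s p 1 (z :: real ^ 'n)) \<le>
      ennreal (norm z powr - (?N + s * p - p)) * indicator (ball 0 1) z
    + ennreal (norm z powr - (?N + s * p)) * indicator (- ball 0 1) z" for z :: "real ^ 'n"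
  proof (cases "norm z < 1")
    case True
    have "cutoff_kernel s p 1 z = norm z powr - (?N + s * p - p)"
      using True by (simp add: cutoff_kernel_def powr_diff powr_minus_divide)
    with True show ?thesis by simp
  next
    case False
    then have "cutoff_kernel s p 1 z = norm z powr - (?N + s * p)"
      unfolding cutoff_kernel_def by (subst powr_minus_divide) simp
    with False show ?thesis by simp
  qed
  have "(\<integral>\<^sup>+ z. ennreal (cutoff_kernel s p 1 (z :: real ^ 'n)) \<partial>lborel) \<le>
    (\<integral>\<^sup>+ z. ennreal (norm z powr - (?N + s * p - p)) * indicator (ball 0 1) z
    + ennreal (norm z powr - (?N + s * p)) * indicator (- ball 0 1) z \<partial>(lborel :: (real ^ 'n) measure))"
    by (intro nn_integral_mono eq)
  also have "\<dots> = (\<integral>\<^sup>+ z\<in>ball 0 1. ennreal (norm z powr - (?N + s * p - p)) \<partial>(lborel :: (real ^ 'n) measure))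
      + (\<integral>\<^sup>+ z\<in>- ball 0 1. ennreal (norm z powr - (?N + s * p)) \<partial>(lborel :: (real ^ 'n) measure))"
    by (rule nn_integral_add) measurable
  also have "\<dots> < \<infinity>"
  proof -
    have "s * p < p" using assms by simp
    then show ?thesis
      using nn_integral_norm_powr_ball[where a = "?N + s * p - p" and 'a = "real ^ 'n"]
       nn_integral_norm_powr_outside[where a = "?N + s * p" and 'a = "real ^ 'n"] assms
      by (simp add: less_top)
  qed
  finally show ?thesis .
qed

text \<open>Rescaling would give the exact rate \<open>R^(-s p)\<close>; dominated convergence
  against the kernel for \<open>R = 1\<close> reaches the limit without a change of
  variables.\<close>

lemma cutoff_kernel_tendsto_0:
  assumes "0 < s" "s < 1" "0 < p"
  shows "(\<lambda>n. \<integral>\<^sup>+ z. ennreal (cutoff_kernel s p (real (Suc n)) (z :: real ^ 'n)) \<partial>lborel) \<longlonglongrightarrow> 0"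
proof -
  have "(\<lambda>n. \<integral>\<^sup>+ z. ennreal (cutoff_kernel s p (real (Suc n)) (z :: real ^ 'n)) \<partial>lborel)
     \<longlonglongrightarrow> (\<integral>\<^sup>+ z. 0 \<partial>(lborel :: (real ^ 'n) measure))"
  proof (rule nn_integral_dominated_convergence[where w = "\<lambda>z. ennreal (cutoff_kernel s p 1 z)"])
    show "AE z in lborel. ennreal (cutoff_kernel s p (real (Suc n)) (z :: real ^ 'n)) \<le> ennreal (cutoff_kernel s p 1 z)" for n
    proof (intro AE_I2 ennreal_leI)
      fix z :: "real ^ 'n"
      have "norm z / real (Suc n) \<le> norm z / 1" by (intro divide_left_mono) auto
      then show "cutoff_kernel s p (real (Suc n)) z \<le> cutoff_kernel s p 1 z"
        unfolding cutoff_kernel_def using assms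
        by (intro divide_right_mono powr_mono2) (auto simp: min_le_iff_disj)
    qed
    show "AE z in lborel. (\<lambda>n. ennreal (cutoff_kernel s p (real (Suc n)) (z :: real ^ 'n))) \<longlonglongrightarrow> 0"
    proof (intro AE_I2)
      fix z :: "real ^ 'n"
      have "(\<lambda>n. norm z / real (Suc n)) \<longlonglongrightarrow> 0"
        by (rule LIMSEQ_Suc[OF lim_const_over_n])
      then have "(\<lambda>n. min 1 (norm z / real (Suc n))) \<longlonglongrightarrow> min 1 0" by (intro tendsto_intros)
      then have "(\<lambda>n. min 1 (norm z / real (Suc n)) powr p) \<longlonglongrightarrow> 0 powr p"
        using assms by (intro tendsto_powr') auto
      then have "(\<lambda>n. cutoff_kernel s p (real (Suc n)) z) \<longlonglongrightarrow> 0"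
        unfolding cutoff_kernel_def using assms by (auto intro: tendsto_divide_zero)
      then have "(\<lambda>n. ennreal (cutoff_kernel s p (real (Suc n)) z)) \<longlonglongrightarrow> ennreal 0"
        by (rule tendsto_ennrealI)
      then show "(\<lambda>n. ennreal (cutoff_kernel s p (real (Suc n)) z)) \<longlonglongrightarrow> 0" by simp
    qed
    show "(\<integral>\<^sup>+ z. ennreal (cutoff_kernel s p 1 (z :: real ^ 'n)) \<partial>lborel) < \<infinity>"
      using cutoff_kernel_finite assms by blast
  qed auto
  then show ?thesis by simp
qed

section \<open>The function Phi and the ball as a Lipschitz domain\<close>

definition phi_order :: "nat \<Rightarrow> real \<Rightarrow> nat" where
  "phi_order N s = nat \<lceil>real N / s - 1\<rceil>"

lemma phi_order_set: "{j::nat. real j < real N / s - 1} = {..<phi_order N s}"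
proof -
  have "real j < x \<longleftrightarrow> j < nat \<lceil>x\<rceil>" for j :: nat and x :: real
    by linarith
  then show ?thesis unfolding phi_order_def by auto
qed

text \<open>Removing an initial segment leaves a tail of the exponential series. For nonnegative
  \<alpha> its terms are nonnegative, and positivity, monotonicity and scaling of \<open>Phi\<close>
  are read off term by term.\<close>

lemma Phi_sums:
  "(\<lambda>j. (\<alpha> * \<bar>t\<bar> powr (real N / (real N - s))) ^ (j + phi_order N s) / fact (j + phi_order N s)) sums Phi N s \<alpha> t"
proof -
  let ?T = "\<alpha> * \<bar>t\<bar> powr (real N / (real N - s))"
  have "(\<lambda>j. ?T ^ j / fact j) sums exp ?T"
    using exp_converges[of ?T] by (simp add: field_simps)
  from sums_split_initial_segment[OF this, of "phi_order N s"]
  show ?thesis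
    by (simp add: Phi_def phi_order_set power_mult_distrib)
qed

lemma Phi_nonneg: "0 \<le> \<alpha> \<Longrightarrow> 0 \<le> Phi N s \<alpha> t"
  by (rule sums_le[OF _ sums_zero Phi_sums]) auto

lemma Phi_le_exp: "0 \<le> \<alpha> \<Longrightarrow> Phi N s \<alpha> t \<le> exp (\<alpha> * \<bar>t\<bar> powr (real N / (real N - s)))"
  unfolding Phi_def by (auto intro!: sum_nonneg)

lemma Phi_mono:
  assumes "0 \<le> \<alpha>" "s < real N" "\<bar>t\<bar> \<le> \<bar>t'\<bar>"
  shows "Phi N s \<alpha> t \<le> Phi N s \<alpha> t'"
proof (rule sums_le[OF _ Phi_sums Phi_sums])
  fix j
  have "\<bar>t\<bar> powr (real N / (real N - s)) \<le> \<bar>t'\<bar> powr (real N / (real N - s))"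
    using assms by (intro powr_mono2) auto
  then show "(\<alpha> * \<bar>t\<bar> powr (real N / (real N - s))) ^ (j + phi_order N s) / fact (j + phi_order N s)
      \<le> (\<alpha> * \<bar>t'\<bar> powr (real N / (real N - s))) ^ (j + phi_order N s) / fact (j + phi_order N s)"
    using assms by (intro divide_right_mono power_mono mult_left_mono) auto
qed

lemma Phi_mult: "Phi N s \<alpha> (c * t) = Phi N s (\<alpha> * \<bar>c\<bar> powr (real N / (real N - s))) t"
  unfolding Phi_def by (simp add: abs_mult powr_mult power_mult_distrib mult_ac)

text \<open>The series of \<^const>\<open>Phi\<close> starts at a power of \<open>|t|\<close> with exponent at least \<open>N / s\<close>.\<close>

lemma Phi_scale:
  assumes "0 \<le> \<alpha>" "0 < s" "s < real N" "0 \<le> c" "c \<le> 1"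
  shows "Phi N s \<alpha> (c * t) \<le> c powr (real N / s) * Phi N s \<alpha> t"
proof (rule sums_le[OF _ Phi_sums sums_mult[OF Phi_sums]])
  fix j
  let ?g = "real N / (real N - s)"
  let ?n = "j + phi_order N s"
  have "real N / s - 1 \<le> real (phi_order N s)" unfolding phi_order_def by linarith
  then have "real N / s - 1 \<le> real ?n" by simp
  then have "?g * (real N / s - 1) \<le> ?g * real ?n"
    using assms by (intro mult_left_mono) auto
  \<comment> \<open>This identity explains the bound \<open>N / s - 1\<close> on the subtracted
    indices: it makes the first surviving power of \<open>|t|\<close> at least the Sobolev
    exponent.\<close>
  moreover have "?g * (real N / s - 1) = real N / s" using assms by (simp add: field_simps)
  ultimately have e: "real N / s \<le> ?g * real ?n" by simp
  have "(c powr ?g) ^ ?n \<le> c powr (real N / s)"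
  proof (cases "c = 0")
    \<comment> \<open>Here \<open>0 ^ ?n\<close> must vanish while \<open>0 ^ 0 = 1\<close>, so
      positivity of \<open>?n\<close> has to be extracted from \<open>e\<close>.\<close>
    case True
    have "0 < ?g * real ?n"
      using e assms by (smt (verit) divide_pos_pos)
    then have "?n \<noteq> 0" by (intro notI) auto
    then show ?thesis using True by (simp add: power_0_left)
  next
    case False
    then have "(c powr ?g) ^ ?n = c powr (?g * real ?n)"
      using assms by (simp add: powr_realpow[symmetric] powr_powr)
    also have "\<dots> \<le> c powr (real N / s)" using e assms by (intro powr_mono') auto
    finally show ?thesis .
  qed
  then have "(c powr ?g) ^ ?n * ((\<alpha> * \<bar>t\<bar> powr ?g) ^ ?n / fact ?n) \<le> c powr (real N / s) * ((\<alpha> * \<bar>t\<bar> powr ?g) ^ ?n / fact ?n)"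
    using assms by (intro mult_right_mono) auto
  also have "(c powr ?g) ^ ?n * ((\<alpha> * \<bar>t\<bar> powr ?g) ^ ?n / fact ?n) = (\<alpha> * \<bar>c * t\<bar> powr ?g) ^ ?n / fact ?n"
    using assms by (simp add: abs_mult powr_mult power_mult_distrib mult_ac)
  finally show "(\<alpha> * \<bar>c * t\<bar> powr ?g) ^ ?n / fact ?n \<le> c powr (real N / s) * ((\<alpha> * \<bar>t\<bar> powr ?g) ^ ?n / fact ?n)" .
qed

text \<open>\<open>Phi_scale\<close> with factor \<open>|t| / k\<close> and argument
  \<open>k\<close>: below a fixed level \<open>Phi\<close> is controlled by the integrable function
  \<open>|u|^p\<close>.\<close>

lemma Phi_le_powr:
  assumes "0 \<le> \<alpha>" "0 < s" "s < real N" "0 < k" "\<bar>t\<bar> \<le> k"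
  shows "Phi N s \<alpha> t \<le> Phi N s \<alpha> k / k powr (real N / s) * \<bar>t\<bar> powr (real N / s)"
proof -
  have "Phi N s \<alpha> t = Phi N s \<alpha> (\<bar>t\<bar> / k * k)" using assms by (simp add: Phi_def)
  also have "\<dots> \<le> (\<bar>t\<bar> / k) powr (real N / s) * Phi N s \<alpha> k"
    using assms by (intro Phi_scale) auto
  finally show ?thesis using assms by (simp add: powr_divide mult_ac)
qed

lemma borel_measurable_Phi [measurable]: "Phi N s \<alpha> \<in> borel_measurable borel"
  unfolding Phi_def[abs_def] by measurable

text \<open>Convexity of the \<open>p\<close>-th power at
  \<open>l * (a / l) + (1 - l) * (b / (1 - l))\<close>. The free weight is the point: the factor of
  the first summand tends to 1 as \<open>l\<close> does, at the expense of the second.\<close>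

lemma powr_add_le:
  fixes a b l p :: real
  assumes "0 \<le> a" "0 \<le> b" "0 < l" "l < 1" "1 \<le> p"
  shows "(a + b) powr p \<le> l powr (1 - p) * a powr p + (1 - l) powr (1 - p) * b powr p"
proof (cases "a = 0 \<or> b = 0")
  \<comment> \<open>Convexity is applied to positive arguments only; if a summand vanishes, it is
    enough that both factors are at least 1.\<close>
  case True
  have "1 \<le> l powr (1 - p)" "1 \<le> (1 - l) powr (1 - p)"
    using powr_mono'[of "1 - p" 0 l] powr_mono'[of "1 - p" 0 "1 - l"] assms by auto
  then have "1 * a powr p \<le> l powr (1 - p) * a powr p" "1 * b powr p \<le> (1 - l) powr (1 - p) * b powr p"
    by (intro mult_right_mono; simp)+
  with True assms show ?thesis by auto
next
  case False
  have "(l * (a / l) + (1 - l) * (b / (1 - l))) powr p \<le> l * (a / l) powr p + (1 - l) * (b / (1 - l)) powr p"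
    using convex_onD[OF powr_convex[OF \<open>1 \<le> p\<close>], of "1 - l" "a / l" "b / (1 - l)"] assms False by simp
  moreover have "l * (a / l) powr p = l powr (1 - p) * a powr p"
    using assms by (simp add: powr_divide powr_diff)
  moreover have "(1 - l) * (b / (1 - l)) powr p = (1 - l) powr (1 - p) * b powr p"
    using assms by (simp add: powr_divide powr_diff)
  ultimately show ?thesis using assms by simp
qed

section \<open>The ball as a Lipschitz domain\<close>

text \<open>The lower hemisphere is the graph of \<open>- sqrt (r^2 - |x|^2)\<close>, whose slope
  blows up at the equator. Capping the norm at \<open>r / 2\<close> cures this: the difference of
  squares gives \<open>|A - B| (A + B) = |a - b| (a + b)\<close>, and
  \<open>a + b \<le> r \<le> A + B\<close>.\<close>

lemma lipschitz_on_sqrt_cap: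
  assumes "0 < r"
  shows "1-lipschitz_on X (\<lambda>x::'a::real_normed_vector. - sqrt (r\<^sup>2 - (min (norm x) (r / 2))\<^sup>2))"
proof -
  have *: "\<bar>sqrt (r\<^sup>2 - a\<^sup>2) - sqrt (r\<^sup>2 - b\<^sup>2)\<bar> \<le> \<bar>a - b\<bar>"
    if "0 \<le> a" "a \<le> r / 2" "0 \<le> b" "b \<le> r / 2" for a b
  proof -
    define A B where "A = sqrt (r\<^sup>2 - a\<^sup>2)" and "B = sqrt (r\<^sup>2 - b\<^sup>2)"
    have aa: "a\<^sup>2 \<le> (r/2)\<^sup>2" "b\<^sup>2 \<le> (r/2)\<^sup>2" using that by (auto intro: power_mono)
    have q: "(r/2)\<^sup>2 = r\<^sup>2 / 4" by (simp add: power_divide)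
    have "0 \<le> r\<^sup>2" by simp
    then have le: "(r/2)\<^sup>2 \<le> r\<^sup>2 - a\<^sup>2" "(r/2)\<^sup>2 \<le> r\<^sup>2 - b\<^sup>2"
      using aa unfolding q by linarith+
    have AB: "A \<ge> r / 2" "B \<ge> r / 2"
      unfolding A_def B_def by (rule real_le_rsqrt[OF le(1)], rule real_le_rsqrt[OF le(2)])
    have A2: "A\<^sup>2 = r\<^sup>2 - a\<^sup>2" "B\<^sup>2 = r\<^sup>2 - b\<^sup>2"
      unfolding A_def B_def using order_trans[OF zero_le_power2 le(1)] order_trans[OF zero_le_power2 le(2)]
      by (simp_all del: diff_ge_0_iff_ge)
    have "\<bar>A - B\<bar> * (A + B) = \<bar>(A - B) * (A + B)\<bar>" using AB assms by (simp add: abs_mult)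
    also have "(A - B) * (A + B) = (b - a) * (b + a)"
      using A2 by (simp add: algebra_simps power2_eq_square)
    also have "\<bar>\<dots>\<bar> = \<bar>a - b\<bar> * (a + b)" using that by (simp add: abs_mult abs_minus_commute)
    also have "\<dots> \<le> \<bar>a - b\<bar> * (A + B)" using that AB by (intro mult_left_mono) auto
    finally show ?thesis using AB assms unfolding A_def B_def by simp
  qed
  show ?thesis
  proof (rule lipschitz_onI)
    fix x y :: 'a
    have "\<bar>min (norm x) (r / 2) - min (norm y) (r / 2)\<bar> \<le> \<bar>norm x - norm y\<bar>" by linarith
    also have "\<dots> \<le> norm (x - y)" by (rule norm_triangle_ineq3)
    finally have "\<bar>min (norm x) (r / 2) - min (norm y) (r / 2)\<bar> \<le> norm (x - y)" .
    moreover have "\<bar>sqrt (r\<^sup>2 - (min (norm x) (r / 2))\<^sup>2) - sqrt (r\<^sup>2 - (min (norm y) (r / 2))\<^sup>2)\<bar>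
        \<le> \<bar>min (norm x) (r / 2) - min (norm y) (r / 2)\<bar>"
      using assms by (intro *) auto
    ultimately show "dist (- sqrt (r\<^sup>2 - (min (norm x) (r / 2))\<^sup>2)) (- sqrt (r\<^sup>2 - (min (norm y) (r / 2))\<^sup>2)) \<le> 1 * dist x y"
      unfolding dist_norm real_norm_def by linarith
  qed auto
qed

text \<open>With the inward unit normal \<open>e\<close> at \<open>z\<close>, the sphere near
  \<open>z\<close> is the lower cap. Within distance \<open>r / 2\<close> of \<open>z\<close> the
  part of \<open>x\<close> orthogonal to \<open>e\<close> is shorter than \<open>r / 2\<close>, so
  the capped graph function agrees with the true one.\<close>

lemma bounded_lipschitz_domain_ball:
  assumes "0 < r"
  shows "bounded_lipschitz_domain (ball (0 :: real ^ 'n) r)"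
  unfolding bounded_lipschitz_domain_def lipschitz_boundary_def
proof (intro conjI ballI)
  fix z :: "real ^ 'n"
  assume "z \<in> frontier (ball 0 r)"
  then have z: "norm z = r" using assms by (simp add: frontier_ball)
  define e where "e = - (1 / r) *\<^sub>R z"
  have e: "norm e = 1" "z \<bullet> e = - r" "z = - r *\<^sub>R e"
    using z assms by (auto simp: e_def power2_norm_eq_inner[symmetric] power2_eq_square)
  let ?g = "\<lambda>x::real ^ 'n. - sqrt (r\<^sup>2 - (min (norm x) (r / 2))\<^sup>2)"
  have "x \<in> ball 0 r \<longleftrightarrow> ?g (x - (x \<bullet> e) *\<^sub>R e) < x \<bullet> e" if x: "x \<in> ball z (r / 2)" for x
  proof -
    define t where "t = x \<bullet> e"
    define y where "y = x - t *\<^sub>R e"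
    have ee: "e \<bullet> e = 1" using e(1) by (simp add: norm_eq_1)
    have ye: "y \<bullet> e = 0" by (simp add: y_def t_def inner_diff_left ee)
    have nx: "(norm x)\<^sup>2 = (norm y)\<^sup>2 + t\<^sup>2"
    proof -
      have "x = y + t *\<^sub>R e" by (simp add: y_def)
      then show ?thesis
        using norm_add_Pythagorean[of y "t *\<^sub>R e"] ye e(1) by (simp add: orthogonal_def)
    qed
    have d: "norm (x - z) < r / 2" using x by (simp add: dist_norm norm_minus_commute)
    have "(norm (x - z))\<^sup>2 = (norm y)\<^sup>2 + (t + r)\<^sup>2"
    proof -
      have "x - z = y + (t + r) *\<^sub>R e" using e(3) by (simp add: y_def algebra_simps)
      then show ?thesis
        using norm_add_Pythagorean[of y "(t + r) *\<^sub>R e"] ye e(1) by (simp add: orthogonal_def)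
    qed
    then have "(norm y)\<^sup>2 \<le> (norm (x - z))\<^sup>2" "(t + r)\<^sup>2 \<le> (norm (x - z))\<^sup>2" by auto
    then have y: "norm y < r / 2" and t: "\<bar>t + r\<bar> < r / 2"
      using d by (auto simp: power2_le_iff_abs_le abs_le_square_iff[symmetric])
    \<comment> \<open>The sign selects the lower hemisphere and permits taking square roots in the
      comparison of \<open>- t\<close> below.\<close>
    have tn: "t < 0" using t assms by linarith
    have "x \<in> ball 0 r \<longleftrightarrow> (norm x)\<^sup>2 < r\<^sup>2"
      using assms by (auto simp: abs_square_less_1 power2_less_imp_less intro: power_strict_mono)
    also have "\<dots> \<longleftrightarrow> (- t)\<^sup>2 < r\<^sup>2 - (norm y)\<^sup>2" using nx by auto
    also have "\<dots> \<longleftrightarrow> - t < sqrt (r\<^sup>2 - (norm y)\<^sup>2)"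
      using tn by (metis abs_of_pos neg_0_less_iff_less real_sqrt_abs real_sqrt_less_iff)
    also have "\<dots> \<longleftrightarrow> ?g y < t" using y by auto
    finally show ?thesis by (simp add: y_def t_def)
  qed
  then show "\<exists>e ra L g. norm e = 1 \<and> 0 < ra \<and> L-lipschitz_on {y. y \<bullet> e = 0} g \<and>
        ball 0 r \<inter> ball z ra = {x \<in> ball z ra. g (x - (x \<bullet> e) *\<^sub>R e) < x \<bullet> e}"
    using e(1) assms lipschitz_on_sqrt_cap[OF assms, of "{y. y \<bullet> e = 0}"]
    by (intro exI[of _ e] exI[of _ "r / 2"] exI[of _ 1] exI[of _ ?g]) auto
qed (use assms in auto)

section \<open>Smooth mollifiers\<close>

text \<open>The classical flat function \<open>exp (- 1 / t)\<close>, extended by 0; the extra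
  negative powers make the span of the family closed under differentiation.\<close>

definition flat :: "nat \<Rightarrow> real \<Rightarrow> real" where
  "flat m t = (if t \<le> 0 then 0 else exp (- 1 / t) / t ^ m)"

text \<open>The single term of index \<open>m + 2\<close> in the series of
  \<open>exp (1 / t)\<close> is a lower bound for it. The surplus square makes the difference
  quotient at 0 vanish in the limit in \<open>DERIV_flat\<close>.\<close>

lemma flat_bound: "\<bar>flat m t\<bar> \<le> fact (m + 2) * t\<^sup>2"
proof (cases "t \<le> 0")
  case False
  then have t: "t > 0" by simp
  have "(1 / t) ^ (m + 2) / fact (m + 2) \<le> exp (1 / t)"
  proof -
    have s: "(\<lambda>n. (1 / t) ^ n / fact n) sums exp (1 / t)"
      using exp_converges[of "1 / t"] by (simp add: divide_inverse mult.commute)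
    show ?thesis
      using sum_le_suminf[OF sums_summable[OF s], of "{m + 2}"] t sums_unique[OF s] by simp
  qed
  then have "1 / exp (1 / t) \<le> 1 / ((1 / t) ^ (m + 2) / fact (m + 2))"
    using t by (intro divide_left_mono mult_pos_pos divide_pos_pos) auto
  also have "\<dots> = fact (m + 2) * t ^ (m + 2)" by (simp add: power_divide)
  finally have "exp (- 1 / t) \<le> fact (m + 2) * t ^ (m + 2)"
    by (simp add: exp_minus inverse_eq_divide)
  then have "exp (- 1 / t) / t ^ m \<le> fact (m + 2) * t ^ (m + 2) / t ^ m"
    using t by (intro divide_right_mono) auto
  also have "\<dots> = fact (m + 2) * t\<^sup>2" using t by (simp only: power_add) simp
  finally show ?thesis using t by (simp add: flat_def del: fact_Suc)
qed (simp add: flat_def)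

lemma DERIV_flat: "(flat m has_real_derivative (flat (m + 2) t - real m * flat (m + 1) t)) (at t)"
proof (cases t "0 :: real" rule: linorder_cases)
  case less
  have "((\<lambda>_. 0) has_real_derivative 0) (at t)" by simp
  then have "(flat m has_real_derivative 0) (at t)"
    by (rule has_field_derivative_transform_within_open[where S = "{..<0}"]) (use less in \<open>auto simp: flat_def\<close>)
  then show ?thesis using less by (simp add: flat_def)
next
  case greater
  have "((\<lambda>t. exp (- 1 / t) / t ^ m) has_real_derivative (flat (m + 2) t - real m * flat (m + 1) t)) (at t)"
  proof -
    have "((\<lambda>t. exp (- 1 / t)) has_real_derivative exp (- 1 / t) * (1 / t\<^sup>2)) (at t)"
      using greater by (auto intro!: derivative_eq_intros simp: power2_eq_square)
    from DERIV_divide[OF this DERIV_pow[of m t]] greater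
    have "((\<lambda>t. exp (- 1 / t) / t ^ m) has_real_derivative
        (exp (- 1 / t) * (1 / t\<^sup>2) * t ^ m - exp (- 1 / t) * (real m * t ^ (m - Suc 0))) / (t ^ m * t ^ m)) (at t)"
      by simp
    moreover have "real m * t ^ (m - Suc 0) = real m * t ^ m / t"
      using greater by (cases m) auto
    then have "(exp (- 1 / t) * (1 / t\<^sup>2) * t ^ m - exp (- 1 / t) * (real m * t ^ (m - Suc 0))) / (t ^ m * t ^ m)
        = flat (m + 2) t - real m * flat (m + 1) t"
      unfolding \<open>real m * t ^ (m - Suc 0) = real m * t ^ m / t\<close>
      using greater by (simp add: flat_def divide_simps) (simp add: algebra_simps power2_eq_square)
    ultimately show ?thesis by simp
  qed
  then show ?thesis
    by (rule has_field_derivative_transform_within_open[where S = "{0<..}"]) (use greater in \<open>auto simp: flat_def\<close>)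
next
  case equal
  have "((\<lambda>h. (flat m (0 + h) - flat m 0) / h) \<longlongrightarrow> 0) (at 0)"
  proof (rule Lim_null_comparison)
    show "\<forall>\<^sub>F h in at 0. norm ((flat m (0 + h) - flat m 0) / h) \<le> fact (m + 2) * \<bar>h\<bar>"
    proof (rule eventually_at_filter[THEN iffD2, OF always_eventually], intro allI impI)
      fix h :: real assume "h \<noteq> 0"
      have "\<bar>flat m h\<bar> / \<bar>h\<bar> \<le> (fact (m + 2) * h\<^sup>2) / \<bar>h\<bar>"
        by (intro divide_right_mono flat_bound) auto
      also have "\<dots> = fact (m + 2) * \<bar>h\<bar>" using \<open>h \<noteq> 0\<close>
        by (simp add: power2_eq_square abs_if field_simps)
      finally show "norm ((flat m (0 + h) - flat m 0) / h) \<le> fact (m + 2) * \<bar>h\<bar>"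
        by (simp add: flat_def[of m 0])
    qed
    show "((\<lambda>h. fact (m + 2) * \<bar>h\<bar>) \<longlongrightarrow> 0) (at (0::real))"
      by (auto intro!: tendsto_eq_intros)
  qed
  then show ?thesis using equal by (simp add: DERIV_def flat_def)
qed

text \<open>Closure under directional derivatives makes every member smooth, without computing higher derivatives.\<close>

inductive_set bump_algebra :: "real \<Rightarrow> (real ^ 'n \<Rightarrow> real) set" for c :: real where
  const: "(\<lambda>x. k) \<in> bump_algebra c"
| inner: "(\<lambda>x. x \<bullet> w) \<in> bump_algebra c"
| flat: "(\<lambda>x. flat m (1 - c * (x \<bullet> x))) \<in> bump_algebra c"
| add: "f \<in> bump_algebra c \<Longrightarrow> g \<in> bump_algebra c \<Longrightarrow> (\<lambda>x. f x + g x) \<in> bump_algebra c"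
| mult: "f \<in> bump_algebra c \<Longrightarrow> g \<in> bump_algebra c \<Longrightarrow> (\<lambda>x. f x * g x) \<in> bump_algebra c"

text \<open>In the \<open>flat\<close> case the chain rule produces the inner product
  \<open>x \<bullet> v\<close>, which is why linear forms are among the generators.\<close>

lemma bump_algebra_has_derivative:
  "f \<in> bump_algebra c \<Longrightarrow>
    \<exists>D. (\<forall>x. (f has_derivative D x) (at x)) \<and> (\<forall>v. (\<lambda>x. D x v) \<in> bump_algebra c)"
proof (induction rule: bump_algebra.induct)
  case (const k)
  show ?case
    by (intro exI[of _ "\<lambda>x v. 0"]) (auto intro: bump_algebra.const)
next
  case (inner w)
  show ?case
    by (intro exI[of _ "\<lambda>x v. v \<bullet> w"]) (auto intro: bump_algebra.const bounded_linear_imp_has_derivative bounded_linear_inner_left)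
next
  case (flat m)
  let ?D = "\<lambda>x v. (flat (m + 2) (1 - c * (x \<bullet> x)) + (- real m) * flat (m + 1) (1 - c * (x \<bullet> x))) * ((- 2 * c) * (x \<bullet> v))"
  have "((\<lambda>x. flat m (1 - c * (x \<bullet> x))) has_derivative ?D x) (at x)" for x :: "real ^ 'n"
  proof -
    have "((\<lambda>x. 1 - c * (x \<bullet> x)) has_derivative (\<lambda>v. (- 2 * c) * (x \<bullet> v))) (at x)"
      by (auto intro!: derivative_eq_intros simp: inner_commute)
    from has_derivative_compose[OF this DERIV_flat[unfolded has_field_derivative_def]]
    show ?thesis by simp
  qed
  moreover have "(\<lambda>x. ?D x v) \<in> bump_algebra c" for v
    by (intro bump_algebra.intros)
  ultimately show ?case by (intro exI[of _ ?D]) blast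
next
  case (add f g)
  then obtain D D' where
      D: "\<And>x. (f has_derivative D x) (at x)" "\<And>v. (\<lambda>x. D x v) \<in> bump_algebra c" and
      D': "\<And>x. (g has_derivative D' x) (at x)" "\<And>v. (\<lambda>x. D' x v) \<in> bump_algebra c" by metis
  show ?case
    using D D' by (intro exI[of _ "\<lambda>x v. D x v + D' x v"]) (auto intro: bump_algebra.add has_derivative_add)
next
  case (mult f g)
  then obtain D D' where
      D: "\<And>x. (f has_derivative D x) (at x)" "\<And>v. (\<lambda>x. D x v) \<in> bump_algebra c" and
      D': "\<And>x. (g has_derivative D' x) (at x)" "\<And>v. (\<lambda>x. D' x v) \<in> bump_algebra c" by metis
  have "((\<lambda>x. f x * g x) has_derivative (\<lambda>v. f x * D' x v + D x v * g x)) (at x)" for x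
    by (rule has_derivative_mult[OF D(1) D'(1)])
  moreover have "(\<lambda>x. f x * D' x v + D x v * g x) \<in> bump_algebra c" for v
    by (intro bump_algebra.intros D D' mult)
  ultimately show ?case
    by (intro exI[of _ "\<lambda>x v. f x * D' x v + D x v * g x"]) auto
qed

lemma bump_algebra_Ck: "f \<in> bump_algebra c \<Longrightarrow> Ck_function k f"
proof (induction k arbitrary: f)
  case 0
  then obtain D where "\<And>x. (f has_derivative D x) (at x)"
    using bump_algebra_has_derivative by blast
  then show ?case
    by (auto intro!: has_derivative_continuous_on[where f' = D])
next
  case (Suc k)
  then obtain D where D: "\<And>x. (f has_derivative D x) (at x)" "\<And>v. (\<lambda>x. D x v) \<in> bump_algebra c"
    using bump_algebra_has_derivative by blast
  have "frechet_derivative f (at x) = D x" for x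
    using frechet_derivative_at[OF D(1)] by simp
  with D Suc show ?case by (auto simp: differentiable_def)
qed

lemma Ck_function_continuous: "\<forall>k. Ck_function k f \<Longrightarrow> continuous_on UNIV f"
  by (metis Ck_function.simps(1))

text \<open>A bump of height at most 1 is divided by its integral, which is at least
  \<open>U * \<epsilon> ^ N\<close>. That \<open>B\<close> does not depend on \<epsilon> is what
  lets the bound be traded for a power of \<epsilon> in \<open>conv_approx\<close>.\<close>

lemma ex_mollifier:
  "\<exists>B>0. \<forall>\<epsilon>>0. \<exists>\<rho> :: real ^ 'n \<Rightarrow> real. (\<forall>k. Ck_function k \<rho>) \<and> (\<forall>x. 0 \<le> \<rho> x) \<and>
     (\<forall>x. \<rho> x \<le> B / \<epsilon> ^ CARD('n)) \<and> (\<forall>x. \<epsilon> \<le> norm x \<longrightarrow> \<rho> x = 0) \<and>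
     (\<integral>\<^sup>+ x. ennreal (\<rho> x) \<partial>lborel) = 1"
proof -
  \<comment> \<open>On the ball of radius \<open>\<epsilon> / 2\<close> the argument of
    \<open>flat\<close> is at least 3/4, so the bump is at least \<open>exp (- 4 / 3)\<close>;
    \<open>U\<close> is this value times the volume of a ball of radius 1/2.\<close>
  define U where "U = exp (- 4 / 3) * unit_ball_vol (real CARD('n)) / 2 ^ CARD('n)"
  have U: "U > 0" by (simp add: U_def)
  have "\<exists>\<rho> :: real ^ 'n \<Rightarrow> real. (\<forall>k. Ck_function k \<rho>) \<and> (\<forall>x. 0 \<le> \<rho> x) \<and>
     (\<forall>x. \<rho> x \<le> (1 / U) / \<epsilon> ^ CARD('n)) \<and> (\<forall>x. \<epsilon> \<le> norm x \<longrightarrow> \<rho> x = 0) \<and>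
     (\<integral>\<^sup>+ x. ennreal (\<rho> x) \<partial>lborel) = 1" if e: "\<epsilon> > 0" for \<epsilon> :: real
  proof -
    define \<eta> where "\<eta> = (\<lambda>x :: real ^ 'n. flat 0 (1 - (1 / \<epsilon>\<^sup>2) * (x \<bullet> x)))"
    have alg: "\<eta> \<in> bump_algebra (1 / \<epsilon>\<^sup>2)" unfolding \<eta>_def by (rule bump_algebra.flat)
    have \<eta>0: "0 \<le> \<eta> x" "\<eta> x \<le> 1" for x by (auto simp: \<eta>_def flat_def)
    have supp: "\<eta> x = 0" if "\<epsilon> \<le> norm x" for x
    proof -
      have "\<epsilon>\<^sup>2 \<le> (norm x)\<^sup>2" using e that by (intro power_mono) auto
      then show ?thesis using e by (simp add: \<eta>_def flat_def power2_norm_eq_inner field_simps)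
    qed
    have cont: "continuous_on UNIV \<eta>" using bump_algebra_Ck[OF alg, of 0] by simp
    have int: "integrable lborel \<eta>"
    proof -
      have "integrable lborel (\<lambda>x. indicator (cball 0 \<epsilon>) x *\<^sub>R \<eta> x)"
        by (intro borel_integrable_compact continuous_on_subset[OF cont]) auto
      also have "(\<lambda>x. indicator (cball 0 \<epsilon>) x *\<^sub>R \<eta> x) = \<eta>"
        using supp by (auto simp: indicator_def fun_eq_iff)
      finally show ?thesis .
    qed
    define c where "c = integral\<^sup>L lborel \<eta>"
    have nn: "(\<integral>\<^sup>+ x. ennreal (\<eta> x) \<partial>lborel) = ennreal c"
      unfolding c_def using int \<eta>0 by (intro nn_integral_eq_integral) auto
    have "ennreal (U * \<epsilon> ^ CARD('n)) = (\<integral>\<^sup>+ x. ennreal (exp (- 4 / 3)) * indicator (ball (0 :: real ^ 'n) (\<epsilon> / 2)) x \<partial>lborel)"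
      using e by (subst nn_integral_cmult_indicator)
        (auto simp: emeasure_ball U_def ennreal_mult'[symmetric] power_divide)
    also have "\<dots> \<le> (\<integral>\<^sup>+ x. ennreal (\<eta> x) \<partial>lborel)"
    proof (intro nn_integral_mono)
      fix x :: "real ^ 'n"
      show "ennreal (exp (- 4 / 3)) * indicator (ball (0 :: real ^ 'n) (\<epsilon> / 2)) x \<le> ennreal (\<eta> x)"
      proof (cases "norm x < \<epsilon> / 2")
        case True
        define t where "t = 1 - (1 / \<epsilon>\<^sup>2) * (x \<bullet> x)"
        have "(norm x)\<^sup>2 \<le> (\<epsilon> / 2)\<^sup>2" using True by (intro power_mono) auto
        then have t: "t \<ge> 3 / 4" using e by (simp add: t_def power2_norm_eq_inner field_simps)
        then have "- 4 / 3 \<le> - 1 / t" by (simp add: field_simps)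
        then have "exp (- 4 / 3) \<le> \<eta> x" using t by (simp only: \<eta>_def flat_def t_def[symmetric]) simp
        then show ?thesis using True by (simp add: indicator_def ennreal_leI)
      qed (simp add: indicator_def)
    qed
    finally have cU: "U * \<epsilon> ^ CARD('n) \<le> c"
      unfolding nn using \<eta>0 by (subst (asm) ennreal_le_iff) (auto simp: c_def)
    have c: "c > 0" using cU U e by (smt (verit) mult_pos_pos zero_less_power)
    define \<rho> where "\<rho> = (\<lambda>x. (1 / c) * \<eta> x)"
    have "\<rho> \<in> bump_algebra (1 / \<epsilon>\<^sup>2)" unfolding \<rho>_def by (intro bump_algebra.intros alg)
    then have "\<forall>k. Ck_function k \<rho>" using bump_algebra_Ck by blast
    moreover have "\<rho> x \<le> (1 / U) / \<epsilon> ^ CARD('n)" for x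
    proof -
      have "\<rho> x \<le> (1 / c) * 1" unfolding \<rho>_def using \<eta>0 c by (intro mult_left_mono) auto
      also have "\<dots> \<le> 1 / (U * \<epsilon> ^ CARD('n))"
        using cU U e by (simp add: frac_le)
      finally show ?thesis by simp
    qed
    moreover have "(\<integral>\<^sup>+ x. ennreal (\<rho> x) \<partial>lborel) = 1"
    proof -
      have "(\<integral>\<^sup>+ x. ennreal (\<rho> x) \<partial>lborel) = (\<integral>\<^sup>+ x. ennreal (1 / c) * ennreal (\<eta> x) \<partial>lborel)"
        unfolding \<rho>_def using c \<eta>0 by (intro nn_integral_cong) (simp add: ennreal_mult'[symmetric])
      also have "\<dots> = ennreal (1 / c) * ennreal c"
        using int by (subst nn_integral_cmult) (auto simp: nn)
      also have "\<dots> = 1" using c by (simp add: ennreal_mult''[symmetric])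
      finally show ?thesis .
    qed
    ultimately show ?thesis using \<eta>0 supp c by (intro exI[of _ \<rho>]) (auto simp: \<rho>_def)
  qed
  then show ?thesis using U by (intro exI[of _ "1 / U"]) auto
qed

section \<open>Convolution with a smooth kernel\<close>

definition conv :: "(real ^ 'n \<Rightarrow> real) \<Rightarrow> (real ^ 'n \<Rightarrow> real) \<Rightarrow> real ^ 'n \<Rightarrow> real" where
  "conv \<rho> v x = (\<integral>y. \<rho> (x - y) * v y \<partial>lborel)"

lemma bounded_of_bounded_support:
  fixes g :: "real ^ 'n \<Rightarrow> real"
  assumes "continuous_on UNIV g" "\<And>x. r < norm x \<Longrightarrow> g x = 0"
  shows "\<exists>M\<ge>0. \<forall>x. \<bar>g x\<bar> \<le> M"
proof -
  have "compact (g ` cball 0 r)"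
    by (intro compact_continuous_image continuous_on_subset[OF assms(1)]) auto
  then obtain M where M: "\<And>x. x \<in> cball 0 r \<Longrightarrow> \<bar>g x\<bar> \<le> M"
    using compact_imp_bounded[of "g ` cball 0 r"] unfolding bounded_iff by (metis imageI real_norm_def)
  have "\<bar>g x\<bar> \<le> max M 0" for x
    using M[of x] assms(2)[of x] by (cases "norm x \<le> r") auto
  then show ?thesis by (intro exI[of _ "max M 0"]) auto
qed

lemma integrable_conv_integrand:
  fixes g v :: "real ^ 'n \<Rightarrow> real"
  assumes "continuous_on UNIV g" "\<And>x. \<bar>g x\<bar> \<le> M" "integrable lborel v"
  shows "integrable lborel (\<lambda>y. g (x - y) * v y)"
proof (rule Bochner_Integration.integrable_bound[where f = "\<lambda>y. M * v y"])
  have [measurable]: "g \<in> borel_measurable borel"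
    by (rule borel_measurable_continuous_onI[OF assms(1)])
  have [measurable]: "v \<in> borel_measurable borel"
    using borel_measurable_integrable[OF assms(3)] by simp
  show "(\<lambda>y. g (x - y) * v y) \<in> borel_measurable lborel" by measurable
  show "AE y in lborel. norm (g (x - y) * v y) \<le> norm (M * v y)"
    using assms(2) by (auto simp: abs_mult intro!: mult_right_mono order_trans[OF assms(2)])
qed (use assms in auto)

text \<open>Differentiation under the integral along an arbitrary null sequence of increments: the
  remainder quotient of \<open>\<rho>\<close> tends to 0 pointwise and is at most
  \<open>2 * L\<close> by the Lipschitz bound, so \<open>2 * L * |v|\<close> dominates.\<close>

lemma conv_has_derivative:
  fixes \<rho> v :: "real ^ 'n \<Rightarrow> real"
  assumes v: "integrable lborel v" and \<rho>: "\<forall>k. Ck_function k \<rho>" and supp: "\<And>x. r < norm x \<Longrightarrow> \<rho> x = 0"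
  shows "(conv \<rho> v has_derivative (\<lambda>h. conv (\<lambda>x. frechet_derivative \<rho> (at x) h) v x)) (at x)"
proof -
  define D where "D x h = frechet_derivative \<rho> (at x) h" for x h
  have "Ck_function 1 \<rho>" "Ck_function 0 \<rho>" using \<rho> by auto
  then have cont: "continuous_on UNIV \<rho>" and "\<And>x. \<rho> differentiable (at x)"
    and contD: "continuous_on UNIV (\<lambda>x. D x h)" for h
    by (simp_all add: D_def)
  then have diff: "(\<rho> has_derivative D x) (at x)" for x
    unfolding D_def[abs_def] by (simp add: frechet_derivative_works)
  have suppD: "D x h = 0" if "r < norm x" for x h
  proof -
    have "((\<lambda>_. 0) has_derivative D x) (at x)"
      by (rule has_derivative_transform_within_open[OF diff, of "- cball 0 r"]) (use that supp in auto)
    then have "D x = (\<lambda>_. 0)" by (rule has_derivative_unique) simp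
    then show ?thesis by simp
  qed
  obtain B where B: "\<And>x. \<bar>\<rho> x\<bar> \<le> B"
    using bounded_of_bounded_support[OF cont supp] by blast
  have "\<forall>h. \<exists>M\<ge>0. \<forall>x. \<bar>D x h\<bar> \<le> M"
    using bounded_of_bounded_support[OF contD suppD] by blast
  then obtain M where M: "\<And>h. M h \<ge> 0" "\<And>x h. \<bar>D x h\<bar> \<le> M h" by metis
  \<comment> \<open>\<open>Ck_function\<close> supplies continuity of each directional derivative
    separately, so a bound uniform in the direction is assembled from the basis vectors.\<close>
  define L where "L = (\<Sum>b\<in>Basis. M b)"
  have L: "L \<ge> 0" unfolding L_def using M by (auto intro: sum_nonneg)
  have linD: "linear (D x)" for x using diff has_derivative_linear by blast
  have DL: "\<bar>D x h\<bar> \<le> L * norm h" for x h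
  proof -
    have "D x h = D x (\<Sum>b\<in>Basis. (h \<bullet> b) *\<^sub>R b)" by (simp add: euclidean_representation)
    also have "\<dots> = (\<Sum>b\<in>Basis. (h \<bullet> b) * D x b)"
      by (simp add: linear_sum[OF linD] linear_scale[OF linD])
    also have "\<bar>\<dots>\<bar> \<le> (\<Sum>b\<in>Basis. \<bar>(h \<bullet> b) * D x b\<bar>)" by (rule sum_abs)
    also have "\<dots> \<le> (\<Sum>b\<in>Basis. norm h * M b)"
      by (intro sum_mono) (auto simp: abs_mult intro!: mult_mono Basis_le_norm M)
    finally show ?thesis by (simp add: L_def sum_distrib_left mult.commute)
  qed
  have lip: "\<bar>\<rho> a - \<rho> b\<bar> \<le> L * norm (a - b)" for a b
    using differentiable_bound[of UNIV \<rho> D L a b] diff onorm_le[of "D _" L] DL by auto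
  have int\<rho>: "integrable lborel (\<lambda>y. \<rho> (x - y) * v y)" for x
    by (rule integrable_conv_integrand[OF cont B v])
  have intD: "integrable lborel (\<lambda>y. D (x - y) h * v y)" for x h
    by (rule integrable_conv_integrand[OF contD M(2) v])
  have [measurable]: "v \<in> borel_measurable borel" "\<rho> \<in> borel_measurable borel" "\<And>h. (\<lambda>x. D x h) \<in> borel_measurable borel"
    using borel_measurable_integrable[OF v] cont contD by (auto intro: borel_measurable_continuous_onI)
  have bl: "bounded_linear (\<lambda>h. conv (\<lambda>x. D x h) v x)"
    unfolding linear_conv_bounded_linear[symmetric] conv_def
    using intD by (intro linearI) (simp_all add: linear_add[OF linD] linear_scale[OF linD] distrib_right mult.assoc)
  have "(\<lambda>h. norm (conv \<rho> v (x + h) - conv \<rho> v x - conv (\<lambda>x. D x h) v x) / norm h) \<midarrow>0\<rightarrow> 0"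
    unfolding tendsto_at_iff_sequentially comp_def
  proof (intro allI impI)
    fix X :: "nat \<Rightarrow> real ^ 'n"
    assume X: "\<forall>i. X i \<in> UNIV - {0}" "X \<longlonglongrightarrow> 0"
    define q where "q i y = (\<rho> (x - y + X i) - \<rho> (x - y) - D (x - y) (X i)) / norm (X i)" for i y
    have X0: "X i \<noteq> 0" for i using X by auto
    have q: "(\<integral>y. q i y * v y \<partial>lborel) = (conv \<rho> v (x + X i) - conv \<rho> v x - conv (\<lambda>x. D x (X i)) v x) / norm (X i)" for i
    proof -
      have "(\<integral>y. q i y * v y \<partial>lborel) = (\<integral>y. (\<rho> (x + X i - y) * v y - \<rho> (x - y) * v y - D (x - y) (X i) * v y) / norm (X i) \<partial>lborel)"
        by (intro Bochner_Integration.integral_cong) (simp_all add: q_def algebra_simps)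
      also have "\<dots> = ((\<integral>y. \<rho> (x + X i - y) * v y \<partial>lborel) - (\<integral>y. \<rho> (x - y) * v y \<partial>lborel) - (\<integral>y. D (x - y) (X i) * v y \<partial>lborel)) / norm (X i)"
        using int\<rho>[of "x + X i"] int\<rho>[of x] intD[of x "X i"] by simp
      finally show ?thesis by (simp add: conv_def)
    qed
    have "(\<lambda>i. \<integral>y. q i y * v y \<partial>lborel) \<longlonglongrightarrow> (\<integral>y. 0 \<partial>(lborel :: (real ^ 'n) measure))"
    proof (rule integral_dominated_convergence[where w = "\<lambda>y. 2 * L * \<bar>v y\<bar>"])
      show "(\<lambda>y. q i y * v y) \<in> borel_measurable lborel" for i
        unfolding q_def by measurable
      show "AE y in lborel. (\<lambda>i. q i y * v y) \<longlonglongrightarrow> 0"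
      proof (intro AE_I2)
        fix y
        have "(\<lambda>h. norm (\<rho> (x - y + h) - \<rho> (x - y) - D (x - y) h) / norm h) \<midarrow>0\<rightarrow> 0"
          using diff[of "x - y"] unfolding has_derivative_at by blast
        then have "(\<lambda>i. \<bar>q i y\<bar>) \<longlonglongrightarrow> 0"
          using X unfolding tendsto_at_iff_sequentially comp_def q_def by (auto simp: abs_divide)
        then have "(\<lambda>i. q i y) \<longlonglongrightarrow> 0" by (simp add: tendsto_rabs_zero_iff)
        then show "(\<lambda>i. q i y * v y) \<longlonglongrightarrow> 0" by (rule tendsto_mult_left_zero)
      qed
      show "AE y in lborel. norm (q i y * v y) \<le> 2 * L * \<bar>v y\<bar>" for i
      proof (intro AE_I2)
        fix y
        have "\<bar>\<rho> (x - y + X i) - \<rho> (x - y) - D (x - y) (X i)\<bar> \<le> 2 * L * norm (X i)"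
          using lip[of "x - y + X i" "x - y"] DL[of "x - y" "X i"] by simp
        then have "\<bar>q i y\<bar> \<le> 2 * L" using X0[of i] by (simp add: q_def abs_divide divide_le_eq)
        then show "norm (q i y * v y) \<le> 2 * L * \<bar>v y\<bar>" by (simp add: abs_mult mult_right_mono)
      qed
    qed (use v in auto)
    then have "(\<lambda>i. \<bar>\<integral>y. q i y * v y \<partial>lborel\<bar>) \<longlonglongrightarrow> 0" by (simp add: tendsto_rabs_zero)
    then show "(\<lambda>i. norm (conv \<rho> v (x + X i) - conv \<rho> v x - conv (\<lambda>x. D x (X i)) v x) / norm (X i)) \<longlonglongrightarrow> 0"
      by (simp add: q abs_divide)
  qed
  with bl show ?thesis unfolding has_derivative_at D_def by blast
qed

text \<open>Induction with \<open>\<rho>\<close> generalised: a directional derivative falls on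
  \<open>\<rho>\<close>, and the differentiated kernel is again smooth and vanishes outside the same
  ball.\<close>

lemma Ck_function_conv:
  fixes \<rho> v :: "real ^ 'n \<Rightarrow> real"
  assumes v: "integrable lborel v" and \<rho>: "\<forall>k. Ck_function k \<rho>" and supp: "\<And>x. r < norm x \<Longrightarrow> \<rho> x = 0"
  shows "Ck_function k (conv \<rho> v)"
  using \<rho> supp
proof (induction k arbitrary: \<rho>)
  case 0
  show ?case
    unfolding Ck_function.simps
    by (rule has_derivative_continuous_on, rule has_derivative_at_withinI, rule conv_has_derivative[OF v 0])
next
  case (Suc k)
  note der = conv_has_derivative[OF v Suc.prems]
  have "Ck_function k (\<lambda>x. frechet_derivative (conv \<rho> v) (at x) h)" for h
  proof -
    have "Ck_function k (conv (\<lambda>x. frechet_derivative \<rho> (at x) h) v)"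
    proof (rule Suc.IH)
      show "\<forall>k. Ck_function k (\<lambda>x. frechet_derivative \<rho> (at x) h)"
        using Suc.prems(1) by (metis Ck_function.simps(2))
      fix x :: "real ^ 'n" assume x: "r < norm x"
      have "\<rho> differentiable at x" using Suc.prems(1) by (metis Ck_function.simps(2))
      then have "frechet_derivative \<rho> (at x) = frechet_derivative (\<lambda>_. 0) (at x)"
        by (rule frechet_derivative_transform_within_open[of _ _ "- cball 0 r"]) (use x Suc.prems(2) in auto)
      then show "frechet_derivative \<rho> (at x) h = 0" by simp
    qed
    moreover have "frechet_derivative (conv \<rho> v) (at x) h = conv (\<lambda>x. frechet_derivative \<rho> (at x) h) v x" for x
      by (rule fun_cong[OF frechet_derivative_at[OF der, symmetric]])
    ultimately show ?thesis by simp
  qed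
  then show ?case using der by (auto simp: differentiable_def)
qed

section \<open>Approximation by test functions\<close>

lemma distr_lborel_reflect: "distr lborel borel (\<lambda>z. a - z) = (lborel :: 'a::euclidean_space measure)"
proof -
  have "(lborel :: 'a measure) = density (distr lborel borel (\<lambda>x. a + (-1) *\<^sub>R x)) (\<lambda>_. ennreal (\<bar>-1 :: real\<bar> ^ DIM('a)))"
    by (rule lborel_affine) simp
  then show ?thesis by (simp add: density_1)
qed

lemma nn_integral_lborel_reflect:
  fixes f :: "'a::euclidean_space \<Rightarrow> ennreal"
  assumes [measurable]: "f \<in> borel_measurable borel"
  shows "(\<integral>\<^sup>+ z. f (a - z) \<partial>lborel) = (\<integral>\<^sup>+ z. f z \<partial>lborel)"
proof -
  have "(\<integral>\<^sup>+ z. f z \<partial>lborel) = (\<integral>\<^sup>+ z. f z \<partial>(distr lborel borel (\<lambda>z. a - z)))"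
    by (simp add: distr_lborel_reflect)
  also have "\<dots> = (\<integral>\<^sup>+ z. f (a - z) \<partial>lborel)" by (rule nn_integral_distr) auto
  finally show ?thesis by simp
qed

lemma nn_integral_lborel_shift:
  fixes f :: "'a::euclidean_space \<Rightarrow> ennreal"
  assumes [measurable]: "f \<in> borel_measurable borel"
  shows "(\<integral>\<^sup>+ z. f (z + a) \<partial>lborel) = (\<integral>\<^sup>+ z. f z \<partial>lborel)"
proof -
  have "(\<integral>\<^sup>+ z. f z \<partial>lborel) = (\<integral>\<^sup>+ z. f z \<partial>(distr lborel borel ((+) a)))"
    by (simp add: lborel_distr_plus)
  also have "\<dots> = (\<integral>\<^sup>+ z. f (a + z) \<partial>lborel)" by (rule nn_integral_distr) auto
  finally show ?thesis by (simp add: add.commute)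
qed

text \<open>Completion does not change nonnegative integrals, even of nonmeasurable functions. From
  here on \<open>lborel\<close> is used, where Tonelli and the changes of variables are at
  hand.\<close>

lemma gagliardo_energy_lborel:
  fixes u :: "real ^ 'n \<Rightarrow> real"
  shows "gagliardo_energy s p u = (\<integral>\<^sup>+ x. (\<integral>\<^sup>+ y. ennreal (\<bar>u x - u y\<bar> powr p
        / norm (x - y) powr (real CARD('n) + s * p)) \<partial>lborel) \<partial>lborel)"
  by (simp add: gagliardo_energy_def nn_integral_completion)

text \<open>Jensen's inequality for the probability density \<open>w\<close>. With \<open>m\<close>
  the mean of \<open>|f|\<close>, Young's inequality bounds \<open>|f| * m^(p-1)\<close> by
  \<open>|f|^p / p + m^p / q\<close>, the tangent line of the power at \<open>m\<close>; integrating
  against \<open>w\<close> leaves \<open>m^p / p\<close> on the left.\<close>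

lemma jensen_powr:
  fixes w f :: "'a \<Rightarrow> real"
  assumes [measurable]: "w \<in> borel_measurable M" "f \<in> borel_measurable M"
    and w: "\<And>x. 0 \<le> w x" "(\<integral>\<^sup>+ x. ennreal (w x) \<partial>M) = 1" and p: "1 < p"
  shows "ennreal (\<bar>\<integral>x. w x * f x \<partial>M\<bar> powr p) \<le> (\<integral>\<^sup>+ x. ennreal (w x * \<bar>f x\<bar> powr p) \<partial>M)"
proof (cases "integrable M (\<lambda>x. w x * f x) \<and> (\<integral>\<^sup>+ x. ennreal (w x * \<bar>f x\<bar> powr p) \<partial>M) < \<infinity>")
  \<comment> \<open>A nonintegrable integrand has integral 0 by default, so the left side is 0;
    otherwise the right side is infinite.\<close>
  case False
  then show ?thesis
    by (auto simp: not_integrable_integral_eq less_top[symmetric])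
next
  case True
  have intp: "integrable M (\<lambda>x. w x * \<bar>f x\<bar> powr p)"
    using True w by (intro integrableI_nonneg) auto
  have "integrable M (\<lambda>x. \<bar>w x * f x\<bar>)" using True by auto
  then have inta: "integrable M (\<lambda>x. w x * \<bar>f x\<bar>)" using w by (simp add: abs_mult)
  have intw: "integrable M w" using w by (intro integrableI_nonneg) auto
  have w1: "(\<integral>x. w x \<partial>M) = 1" using w by (simp add: integral_eq_nn_integral)
  define m where "m = (\<integral>x. w x * \<bar>f x\<bar> \<partial>M)"
  have m: "0 \<le> m" unfolding m_def using w by (intro Bochner_Integration.integral_nonneg) auto
  have "\<bar>\<integral>x. w x * f x \<partial>M\<bar> \<le> (\<integral>x. \<bar>w x * f x\<bar> \<partial>M)" by (rule integral_abs_bound)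
  also have "\<dots> = m" unfolding m_def using w by (simp add: abs_mult)
  finally have le: "\<bar>\<integral>x. w x * f x \<partial>M\<bar> \<le> m" .
  define q where "q = p / (p - 1)"
  have q: "1 < q" "1 / p + 1 / q = 1" "(p - 1) * q = p" using p by (auto simp: q_def field_simps)
  have young: "w x * \<bar>f x\<bar> * m powr (p - 1) \<le> w x * \<bar>f x\<bar> powr p / p + w x * (m powr p / q)" for x
  proof -
    have "\<bar>f x\<bar> * m powr (p - 1) \<le> \<bar>f x\<bar> powr p / p + (m powr (p - 1)) powr q / q"
      by (rule Youngs_inequality) (use p q in auto)
    then have "w x * (\<bar>f x\<bar> * m powr (p - 1)) \<le> w x * (\<bar>f x\<bar> powr p / p + m powr p / q)"
      using w q by (intro mult_left_mono) (auto simp: powr_powr)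
    then show ?thesis by (simp add: algebra_simps)
  qed
  have "(\<integral>x. w x * \<bar>f x\<bar> * m powr (p - 1) \<partial>M) \<le> (\<integral>x. w x * \<bar>f x\<bar> powr p / p + w x * (m powr p / q) \<partial>M)"
    using inta intp intw young by (intro integral_mono) auto
  then have "m * m powr (p - 1) \<le> (\<integral>x. w x * \<bar>f x\<bar> powr p \<partial>M) / p + m powr p / q"
    using intp intw w1 by (simp add: m_def)
  moreover have "m * m powr (p - 1) = m powr p"
    using m p by (cases "m = 0") (auto simp: powr_diff)
  moreover have "m powr p = m powr p / p + m powr p / q"
    using q(2) by (metis distrib_left mult.right_neutral times_divide_eq_right)
  ultimately have "m powr p / p \<le> (\<integral>x. w x * \<bar>f x\<bar> powr p \<partial>M) / p" by simp
  then have "m powr p \<le> (\<integral>x. w x * \<bar>f x\<bar> powr p \<partial>M)" using p by (simp add: divide_le_cancel)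
  then have "\<bar>\<integral>x. w x * f x \<partial>M\<bar> powr p \<le> (\<integral>x. w x * \<bar>f x\<bar> powr p \<partial>M)"
    using powr_mono2[of p _ m, OF _ _ le] p by linarith
  then have "ennreal (\<bar>\<integral>x. w x * f x \<partial>M\<bar> powr p) \<le> ennreal (\<integral>x. w x * \<bar>f x\<bar> powr p \<partial>M)"
    by (rule ennreal_leI)
  also have "\<dots> = (\<integral>\<^sup>+ x. ennreal (w x * \<bar>f x\<bar> powr p) \<partial>M)"
    using intp w by (intro nn_integral_eq_integral[symmetric]) auto
  finally show ?thesis .
qed

lemma integrable_lborel_reflect:
  fixes f :: "real ^ 'n \<Rightarrow> real"
  assumes "integrable lborel f"
  shows "integrable lborel (\<lambda>z. f (a - z))" "(\<integral>z. f (a - z) \<partial>lborel) = (\<integral>z. f z \<partial>lborel)"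
proof -
  have [measurable]: "f \<in> borel_measurable borel" using borel_measurable_integrable[OF assms] by simp
  have "integrable (distr lborel borel (\<lambda>z. a - z)) f" using assms by (simp add: distr_lborel_reflect)
  then show "integrable lborel (\<lambda>z. f (a - z))" by (subst (asm) integrable_distr_eq) auto
  have "(\<integral>z. f z \<partial>lborel) = (\<integral>z. f z \<partial>(distr lborel borel (\<lambda>z. a - z)))"
    by (simp add: distr_lborel_reflect)
  also have "\<dots> = (\<integral>z. f (a - z) \<partial>lborel)" by (rule integral_distr) auto
  finally show "(\<integral>z. f (a - z) \<partial>lborel) = (\<integral>z. f z \<partial>lborel)" by simp
qed

section \<open>Mollification and the Gagliardo energy\<close>

locale mollification =
  fixes \<rho> v :: "real ^ 'n \<Rightarrow> real" and s p B :: real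
  assumes v: "integrable lborel v"
    and \<rho>_cont: "continuous_on UNIV \<rho>" and \<rho>_nonneg: "\<And>x. 0 \<le> \<rho> x" and \<rho>_bound: "\<And>x. \<rho> x \<le> B"
    and \<rho>_int: "(\<integral>\<^sup>+ x. ennreal (\<rho> x) \<partial>lborel) = 1"
    and p: "1 < p"
begin

lemma meas [measurable]: "v \<in> borel_measurable borel" "\<rho> \<in> borel_measurable borel"
  using borel_measurable_integrable[OF v] \<rho>_cont by (auto intro: borel_measurable_continuous_onI)

lemma integrable_\<rho>: "integrable lborel \<rho>"
  using \<rho>_int \<rho>_nonneg by (intro integrableI_nonneg) auto

lemma integral_\<rho>: "(\<integral>x. \<rho> x \<partial>lborel) = 1"
  using \<rho>_int \<rho>_nonneg by (simp add: integral_eq_nn_integral)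

lemma conv_alt: "integrable lborel (\<lambda>z. \<rho> z * v (x - z))" "conv \<rho> v x = (\<integral>z. \<rho> z * v (x - z) \<partial>lborel)"
proof -
  have "integrable lborel (\<lambda>y. \<rho> (x - y) * v y)"
    using \<rho>_nonneg \<rho>_bound by (intro integrable_conv_integrand[OF \<rho>_cont _ v, of B]) auto
  from integrable_lborel_reflect[OF this, of x]
  show "integrable lborel (\<lambda>z. \<rho> z * v (x - z))" "conv \<rho> v x = (\<integral>z. \<rho> z * v (x - z) \<partial>lborel)"
    by (auto simp: conv_def)
qed

lemma conv_diff_le:
  "ennreal (\<bar>conv \<rho> v x - conv \<rho> v y\<bar> powr p) \<le> (\<integral>\<^sup>+ z. ennreal (\<rho> z * \<bar>v (x - z) - v (y - z)\<bar> powr p) \<partial>lborel)"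
proof -
  have "conv \<rho> v x - conv \<rho> v y = (\<integral>z. \<rho> z * (v (x - z) - v (y - z)) \<partial>lborel)"
    using conv_alt by (simp add: right_diff_distrib)
  then show ?thesis
    using jensen_powr[of \<rho> lborel "\<lambda>z. v (x - z) - v (y - z)" p] \<rho>_nonneg \<rho>_int p by simp
qed

lemma conv_minus_le:
  "ennreal (\<bar>conv \<rho> v x - v x\<bar> powr p) \<le> (\<integral>\<^sup>+ z. ennreal (\<rho> z * \<bar>v (x - z) - v x\<bar> powr p) \<partial>lborel)"
proof -
  have "conv \<rho> v x - v x = (\<integral>z. \<rho> z * (v (x - z) - v x) \<partial>lborel)"
    using conv_alt integrable_\<rho> by (simp add: right_diff_distrib integral_\<rho>)
  then show ?thesis
    using jensen_powr[of \<rho> lborel "\<lambda>z. v (x - z) - v x" p] \<rho>_nonneg \<rho>_int p by simp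
qed

text \<open>A mollification averages translates of \<open>v\<close>, and the energy is convex and
  invariant under translation: Jensen inside the double integral, then Tonelli moves
  \<open>z\<close> outermost, where the shifted energy no longer depends on it.\<close>

lemma gagliardo_energy_conv: "gagliardo_energy s p (conv \<rho> v) \<le> gagliardo_energy s p v"
proof -
  define k where "k x = 1 / norm (x :: real ^ 'n) powr (real CARD('n) + s * p)" for x
  have k: "0 \<le> k x" for x by (simp add: k_def)
  have [measurable]: "k \<in> borel_measurable borel" unfolding k_def by measurable
  define F where "F x y = ennreal (\<bar>v x - v y\<bar> powr p * k (x - y))" for x y
  have [measurable]: "(\<lambda>(x, y). F x y) \<in> borel_measurable (borel \<Otimes>\<^sub>M borel)"
    unfolding F_def by measurable
  have E: "gagliardo_energy s p v = (\<integral>\<^sup>+ x. \<integral>\<^sup>+ y. F x y \<partial>lborel \<partial>lborel)"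
    by (simp add: gagliardo_energy_lborel F_def k_def)
  have "gagliardo_energy s p (conv \<rho> v) = (\<integral>\<^sup>+ x. \<integral>\<^sup>+ y. ennreal (\<bar>conv \<rho> v x - conv \<rho> v y\<bar> powr p) * ennreal (k (x - y)) \<partial>lborel \<partial>lborel)"
    by (simp add: gagliardo_energy_lborel k_def ennreal_mult[symmetric])
  also have "\<dots> \<le> (\<integral>\<^sup>+ x. \<integral>\<^sup>+ y. \<integral>\<^sup>+ z. ennreal (\<rho> z) * F (x - z) (y - z) \<partial>lborel \<partial>lborel \<partial>lborel)"
  proof (intro nn_integral_mono)
    fix x y
    have "ennreal (\<bar>conv \<rho> v x - conv \<rho> v y\<bar> powr p) * ennreal (k (x - y))
       \<le> (\<integral>\<^sup>+ z. ennreal (\<rho> z * \<bar>v (x - z) - v (y - z)\<bar> powr p) \<partial>lborel) * ennreal (k (x - y))"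
      by (intro mult_right_mono conv_diff_le) auto
    also have "\<dots> = (\<integral>\<^sup>+ z. ennreal (\<rho> z * \<bar>v (x - z) - v (y - z)\<bar> powr p) * ennreal (k (x - y)) \<partial>lborel)"
      by (rule nn_integral_multc[symmetric]) measurable
    also have "\<dots> = (\<integral>\<^sup>+ z. ennreal (\<rho> z) * F (x - z) (y - z) \<partial>lborel)"
      using \<rho>_nonneg k by (intro nn_integral_cong) (simp add: F_def ennreal_mult mult.assoc)
    finally show "ennreal (\<bar>conv \<rho> v x - conv \<rho> v y\<bar> powr p) * ennreal (k (x - y))
       \<le> (\<integral>\<^sup>+ z. ennreal (\<rho> z) * F (x - z) (y - z) \<partial>lborel)" .
  qed
  also have "\<dots> = (\<integral>\<^sup>+ x. \<integral>\<^sup>+ z. \<integral>\<^sup>+ y. ennreal (\<rho> z) * F (x - z) (y - z) \<partial>lborel \<partial>lborel \<partial>lborel)"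
    by (intro nn_integral_cong lborel_pair.Fubini') measurable
  also have "\<dots> = (\<integral>\<^sup>+ z. \<integral>\<^sup>+ x. \<integral>\<^sup>+ y. ennreal (\<rho> z) * F (x - z) (y - z) \<partial>lborel \<partial>lborel \<partial>lborel)"
    by (rule lborel_pair.Fubini') measurable
  also have "\<dots> = (\<integral>\<^sup>+ z. ennreal (\<rho> z) * gagliardo_energy s p v \<partial>lborel)"
  proof (intro nn_integral_cong)
    fix z
    have "(\<integral>\<^sup>+ x. \<integral>\<^sup>+ y. ennreal (\<rho> z) * F (x - z) (y - z) \<partial>lborel \<partial>lborel)
       = ennreal (\<rho> z) * (\<integral>\<^sup>+ x. \<integral>\<^sup>+ y. F (x - z) (y - z) \<partial>lborel \<partial>lborel)"
      by (simp add: nn_integral_cmult)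
    also have "(\<integral>\<^sup>+ x. \<integral>\<^sup>+ y. F (x - z) (y - z) \<partial>lborel \<partial>lborel) = (\<integral>\<^sup>+ x. \<integral>\<^sup>+ y. F (x - z) y \<partial>lborel \<partial>lborel)"
    proof (rule nn_integral_cong)
      fix x
      show "(\<integral>\<^sup>+ y. F (x - z) (y - z) \<partial>lborel) = (\<integral>\<^sup>+ y. F (x - z) y \<partial>lborel)"
        using nn_integral_lborel_shift[of "\<lambda>y. F (x - z) y" "- z"] by simp
    qed
    also have "\<dots> = (\<integral>\<^sup>+ x. \<integral>\<^sup>+ y. F x y \<partial>lborel \<partial>lborel)"
      using nn_integral_lborel_shift[of "\<lambda>x. \<integral>\<^sup>+ y. F x y \<partial>lborel" "- z"] by simp
    finally show "(\<integral>\<^sup>+ x. \<integral>\<^sup>+ y. ennreal (\<rho> z) * F (x - z) (y - z) \<partial>lborel \<partial>lborel) = ennreal (\<rho> z) * gagliardo_energy s p v"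
      by (simp add: E)
  qed
  also have "\<dots> = gagliardo_energy s p v"
    by (subst nn_integral_multc) (auto simp: \<rho>_int)
  finally show ?thesis .
qed

text \<open>The inner Gagliardo integral on the right is finite for almost every \<open>x\<close>, which gives almost everywhere
  convergence of the mollifications without Lebesgue points or continuity of translations.\<close>

lemma conv_approx:
  assumes supp: "\<And>x. \<epsilon> \<le> norm x \<Longrightarrow> \<rho> x = 0" and e: "0 < \<epsilon>" and sp: "0 \<le> real CARD('n) + s * p" and B: "0 \<le> B"
  shows "ennreal (\<bar>conv \<rho> v x - v x\<bar> powr p) \<le> ennreal (B * \<epsilon> powr (real CARD('n) + s * p)) *
    (\<integral>\<^sup>+ y. ennreal (\<bar>v x - v y\<bar> powr p / norm (x - y) powr (real CARD('n) + s * p)) \<partial>lborel)"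
proof -
  let ?e = "real CARD('n) + s * p"
  have "ennreal (\<bar>conv \<rho> v x - v x\<bar> powr p) \<le> (\<integral>\<^sup>+ z. ennreal (\<rho> z * \<bar>v (x - z) - v x\<bar> powr p) \<partial>lborel)"
    by (rule conv_minus_le)
  also have "\<dots> \<le> (\<integral>\<^sup>+ z. ennreal (B * \<epsilon> powr ?e) * ennreal (\<bar>v x - v (x - z)\<bar> powr p / norm z powr ?e) \<partial>lborel)"
  proof (intro nn_integral_mono)
    fix z
    show "ennreal (\<rho> z * \<bar>v (x - z) - v x\<bar> powr p) \<le> ennreal (B * \<epsilon> powr ?e) * ennreal (\<bar>v x - v (x - z)\<bar> powr p / norm z powr ?e)"
    proof (cases "z = 0 \<or> \<epsilon> \<le> norm z")
      case True
      then show ?thesis using supp by auto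
    next
      case False
      then have z: "0 < norm z" "norm z \<le> \<epsilon>" by auto
      have "norm z powr ?e \<le> \<epsilon> powr ?e" using z sp by (intro powr_mono2) auto
      \<comment> \<open>Inserting this factor on the support of \<open>\<rho>\<close> turns the
        local average into the Gagliardo integral at \<open>x\<close>.\<close>
      then have "1 \<le> \<epsilon> powr ?e / norm z powr ?e" using z by simp
      then have "1 * (B * \<bar>v (x - z) - v x\<bar> powr p) \<le> \<epsilon> powr ?e / norm z powr ?e * (B * \<bar>v (x - z) - v x\<bar> powr p)"
        using B by (intro mult_right_mono) auto
      moreover have "\<rho> z * \<bar>v (x - z) - v x\<bar> powr p \<le> B * \<bar>v (x - z) - v x\<bar> powr p"
        using \<rho>_bound by (intro mult_right_mono) auto
      ultimately have "\<rho> z * \<bar>v (x - z) - v x\<bar> powr p \<le> B * \<epsilon> powr ?e * (\<bar>v x - v (x - z)\<bar> powr p / norm z powr ?e)"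
        by (simp add: mult_ac abs_minus_commute)
      then show ?thesis using B by (subst ennreal_mult[symmetric]) (auto intro: ennreal_leI)
    qed
  qed
  also have "\<dots> = ennreal (B * \<epsilon> powr ?e) * (\<integral>\<^sup>+ z. ennreal (\<bar>v x - v (x - z)\<bar> powr p / norm z powr ?e) \<partial>lborel)"
    by (rule nn_integral_cmult) measurable
  also have "(\<integral>\<^sup>+ z. ennreal (\<bar>v x - v (x - z)\<bar> powr p / norm z powr ?e) \<partial>lborel)
     = (\<integral>\<^sup>+ y. ennreal (\<bar>v x - v y\<bar> powr p / norm (x - y) powr ?e) \<partial>lborel)"
    using nn_integral_lborel_reflect[of "\<lambda>y. ennreal (\<bar>v x - v y\<bar> powr p / norm (x - y) powr ?e)" x] by simp
  finally show ?thesis .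
qed

end

lemma integrable_powr_of_bounded_support:
  fixes f :: "real ^ 'n \<Rightarrow> real"
  assumes "continuous_on UNIV f" "\<And>x. r < norm x \<Longrightarrow> f x = 0" "0 < p"
  shows "integrable lborel (\<lambda>x. \<bar>f x\<bar> powr p)"
proof -
  have "integrable lborel (\<lambda>x. indicator (cball 0 r) x *\<^sub>R \<bar>f x\<bar> powr p)"
    using assms by (intro borel_integrable_compact continuous_on_powr' continuous_intros continuous_on_subset[OF assms(1)]) auto
  also have "(\<lambda>x. indicator (cball 0 r) x *\<^sub>R \<bar>f x\<bar> powr p) = (\<lambda>x. \<bar>f x\<bar> powr p)"
    using assms by (auto simp: indicator_def fun_eq_iff)
  finally show ?thesis .
qed

text \<open>Mollification at shrinking radii. The convergence holds at every point where the inner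
  Gagliardo integral \<open>G\<close> of \<open>v\<close> is finite, hence almost everywhere when
  the energy is.\<close>

lemma test_function_approx:
  fixes v :: "real ^ 'n \<Rightarrow> real"
  assumes v: "integrable lborel v" and supp: "\<And>x. a < norm x \<Longrightarrow> v x = 0" and ab: "0 \<le> a" "a < b"
    and sp: "0 < s" "1 < p" and fin: "gagliardo_energy s p v < \<infinity>"
  shows "\<exists>f. (\<forall>k::nat. f k \<in> test_functions (ball 0 b) \<inter> frac_sobolev s p \<and> f k \<in> borel_measurable borel
        \<and> gagliardo_energy s p (f k) \<le> gagliardo_energy s p v)
      \<and> (AE x in lborel. (\<lambda>k. f k x) \<longlonglongrightarrow> v x)"
proof -
  obtain B where B: "B > 0" and ex: "\<And>\<epsilon>. \<epsilon> > 0 \<Longrightarrow> \<exists>\<rho> :: real ^ 'n \<Rightarrow> real. (\<forall>k. Ck_function k \<rho>) \<and> (\<forall>x. 0 \<le> \<rho> x) \<and>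
     (\<forall>x. \<rho> x \<le> B / \<epsilon> ^ CARD('n)) \<and> (\<forall>x. \<epsilon> \<le> norm x \<longrightarrow> \<rho> x = 0) \<and>
     (\<integral>\<^sup>+ x. ennreal (\<rho> x) \<partial>lborel) = 1"
    using ex_mollifier[where 'n = 'n] by blast
  \<comment> \<open>The shift by 2 keeps every radius strictly below the gap \<open>b - a\<close>,
    so that supports stay inside the open ball.\<close>
  define \<epsilon> where "\<epsilon> k = (b - a) / (real k + 2)" for k :: nat
  have e: "0 < \<epsilon> k" "\<epsilon> k < b - a" for k
    using ab divide_strict_left_mono[of 1 "real k + 2" "b - a"] by (auto simp: \<epsilon>_def)
  have "\<exists>\<rho> :: nat \<Rightarrow> real ^ 'n \<Rightarrow> real. \<forall>k. (\<forall>j. Ck_function j (\<rho> k)) \<and> (\<forall>x. 0 \<le> \<rho> k x) \<and>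
     (\<forall>x. \<rho> k x \<le> B / \<epsilon> k ^ CARD('n)) \<and> (\<forall>x. \<epsilon> k \<le> norm x \<longrightarrow> \<rho> k x = 0) \<and>
     (\<integral>\<^sup>+ x. ennreal (\<rho> k x) \<partial>lborel) = 1"
    by (intro choice allI ex e)
  then obtain \<rho> :: "nat \<Rightarrow> real ^ 'n \<Rightarrow> real" where \<rho>: "\<And>k. \<forall>j. Ck_function j (\<rho> k)" "\<And>k x. 0 \<le> \<rho> k x"
     "\<And>k x. \<rho> k x \<le> B / \<epsilon> k ^ CARD('n)" "\<And>k x. \<epsilon> k \<le> norm x \<Longrightarrow> \<rho> k x = 0" "\<And>k. (\<integral>\<^sup>+ x. ennreal (\<rho> k x) \<partial>lborel) = 1"
    by blast
  have moll: "mollification (\<rho> k) v p (B / \<epsilon> k ^ CARD('n))" for k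
    by unfold_locales (use \<rho> v sp Ck_function_continuous[OF \<rho>(1)] in auto)
  define f where "f k = conv (\<rho> k) v" for k
  have fCk: "Ck_function j (f k)" for j k
    unfolding f_def using \<rho>(4) by (intro Ck_function_conv[OF v \<rho>(1), of "\<epsilon> k"]) auto
  have fcont: "continuous_on UNIV (f k)" for k using fCk[of 0] by simp
  have fsupp: "f k x = 0" if "a + \<epsilon> k < norm x" for k x
  proof -
    have "\<rho> k (x - y) * v y = 0" for y
    proof (cases "a < norm y")
      case False
      then have "\<epsilon> k \<le> norm (x - y)" using that norm_triangle_ineq2[of x y] by linarith
      then show ?thesis using \<rho>(4) by simp
    qed (simp add: supp)
    then have "(\<lambda>y. \<rho> k (x - y) * v y) = (\<lambda>_. 0)" by auto
    then show ?thesis unfolding f_def conv_def by simp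
  qed
  have cl: "closure {x. f k x \<noteq> 0} \<subseteq> cball 0 (a + \<epsilon> k)" for k
    using fsupp by (intro closure_minimal) (auto simp: not_less[symmetric])
  have test: "f k \<in> test_functions (ball 0 b)" for k
    unfolding test_functions_def
  proof (intro CollectI conjI allI)
    show "compact (closure {x. f k x \<noteq> 0})"
      using cl by (meson bounded_cball bounded_subset closed_closure compact_eq_bounded_closed)
    show "closure {x. f k x \<noteq> 0} \<subseteq> ball 0 b"
      using cl[of k] e[of k] by force
  qed (rule fCk)
  have en: "gagliardo_energy s p (f k) \<le> gagliardo_energy s p v" for k
    unfolding f_def by (rule mollification.gagliardo_energy_conv[OF moll])
  have meas: "f k \<in> borel_measurable borel" for k
    by (rule borel_measurable_continuous_onI[OF fcont])
  have sob: "f k \<in> frac_sobolev s p" for k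
  proof -
    have "integrable lborel (\<lambda>x. \<bar>f k x\<bar> powr p)"
      using sp by (intro integrable_powr_of_bounded_support[OF fcont fsupp]) auto
    then show ?thesis
      unfolding frac_sobolev_def using meas[of k] en[of k] fin
      by (auto intro: measurable_completion integrable_completion[THEN iffD2] le_less_trans)
  qed
  have [measurable]: "v \<in> borel_measurable borel" using borel_measurable_integrable[OF v] by simp
  let ?e = "real CARD('n) + s * p"
  define G where "G x = (\<integral>\<^sup>+ y. ennreal (\<bar>v x - v y\<bar> powr p / norm (x - y) powr ?e) \<partial>lborel)" for x
  have [measurable]: "G \<in> borel_measurable lborel" unfolding G_def by measurable
  have "(\<integral>\<^sup>+ x. G x \<partial>lborel) < \<infinity>" using fin by (simp add: gagliardo_energy_lborel G_def)
  then have "AE x in lborel. G x \<noteq> \<infinity>" by (intro nn_integral_noteq_infinite) auto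
  then have "AE x in lborel. (\<lambda>k. f k x) \<longlonglongrightarrow> v x"
  proof eventually_elim
    case (elim x)
    define g where "g = enn2real (G x)"
    have g: "G x = ennreal g" "0 \<le> g" using elim by (auto simp: g_def ennreal_enn2real_if)
    have le: "\<bar>f k x - v x\<bar> powr p \<le> B * \<epsilon> k powr (s * p) * g" for k
    proof -
      have "ennreal (\<bar>f k x - v x\<bar> powr p) \<le> ennreal (B / \<epsilon> k ^ CARD('n) * \<epsilon> k powr ?e) * G x"
        unfolding f_def G_def
        by (rule mollification.conv_approx[OF moll]) (use \<rho> e B sp in \<open>auto intro: less_imp_le\<close>)
      \<comment> \<open>The height of the mollifier cancels the dimension in the exponent, and the
        remaining power \<open>s * p\<close> is positive.\<close>
      also have "B / \<epsilon> k ^ CARD('n) * \<epsilon> k powr ?e = B * \<epsilon> k powr (s * p)"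
        using e[of k] by (simp add: powr_add powr_realpow)
      also have "ennreal (B * \<epsilon> k powr (s * p)) * G x = ennreal (B * \<epsilon> k powr (s * p) * g)"
        using B g by (simp add: ennreal_mult[symmetric])
      finally show ?thesis using B g by (subst (asm) ennreal_le_iff) auto
    qed
    have "\<epsilon> \<longlonglongrightarrow> 0"
      unfolding \<epsilon>_def by real_asymp
    then have "(\<lambda>k. \<epsilon> k powr (s * p)) \<longlonglongrightarrow> 0 powr (s * p)"
      using sp e by (intro tendsto_powr') (auto intro: always_eventually less_imp_le)
    then have "(\<lambda>k. B * \<epsilon> k powr (s * p) * g) \<longlonglongrightarrow> B * 0 * g"
      by (intro tendsto_intros) simp
    then have "(\<lambda>k. (B * \<epsilon> k powr (s * p) * g) powr (1 / p)) \<longlonglongrightarrow> (B * 0 * g) powr (1 / p)"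
      using sp B g by (intro tendsto_powr') auto
    then have lim: "(\<lambda>k. (B * \<epsilon> k powr (s * p) * g) powr (1 / p)) \<longlonglongrightarrow> 0" by simp
    have "norm (f k x - v x) \<le> (B * \<epsilon> k powr (s * p) * g) powr (1 / p)" for k
      using powr_mono2[OF _ _ le[of k], of "1 / p"] sp by (simp add: powr_powr)
    then have "(\<lambda>k. f k x - v x) \<longlonglongrightarrow> 0"
      by (intro Lim_null_comparison[OF always_eventually lim]) auto
    then show ?case by (simp add: LIM_zero_iff)
  qed
  then show ?thesis using test sob meas en by blast
qed

section \<open>The inequality for compactly supported functions\<close>

text \<open>Convolution asks for integrability itself, not for a finite \<open>p\<close>-th power;
  on the ball \<open>|v| \<le> 1 + |v|^p\<close> supplies it.\<close>

lemma integrable_of_bounded_support: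
  fixes v :: "real ^ 'n \<Rightarrow> real"
  assumes [measurable]: "v \<in> borel_measurable borel" and "\<And>x. r < norm x \<Longrightarrow> v x = 0"
    and "(\<integral>\<^sup>+ x. ennreal (\<bar>v x\<bar> powr p) \<partial>lborel) < \<infinity>" and p: "1 \<le> p"
  shows "integrable lborel v"
proof (rule Bochner_Integration.integrable_bound)
  show "integrable lborel (\<lambda>x. indicator (cball 0 r) x + \<bar>v x\<bar> powr p)"
    using assms emeasure_bounded_finite[OF bounded_cball]
    by (intro Bochner_Integration.integrable_add integrable_real_indicator integrableI_nonneg) auto
  show "AE x in lborel. norm (v x) \<le> norm (indicator (cball 0 r) x + \<bar>v x\<bar> powr p)"
  proof (intro AE_I2)
    fix x
    show "norm (v x) \<le> norm (indicator (cball 0 r) x + \<bar>v x\<bar> powr p)"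
    proof (cases "norm x \<le> r")
      case True
      have "\<bar>v x\<bar> \<le> 1 + \<bar>v x\<bar> powr p"
      proof (cases "\<bar>v x\<bar> \<le> 1")
        case False
        then have "\<bar>v x\<bar> powr 1 \<le> \<bar>v x\<bar> powr p" using p by (intro powr_mono) auto
        then show ?thesis using False by simp
      qed (simp add: add_increasing2)
      then show ?thesis using True by simp
    qed (use assms in simp)
  qed
qed simp

text \<open>Fatou along the approximants, whose energies do not exceed that of \<open>v\<close>,
  extends the exponential bound from test functions to \<open>v\<close>.\<close>

lemma nn_integral_exp_le_of_test_functions:
  fixes v :: "real ^ 'n \<Rightarrow> real"
  assumes MT: "\<And>f :: real ^ 'n \<Rightarrow> real. f \<in> test_functions (ball 0 b) \<inter> frac_sobolev s p \<Longrightarrow> f \<in> borel_measurable borel \<Longrightarrow>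
        gagliardo_energy s p f \<le> 1 \<Longrightarrow> (\<integral>\<^sup>+ x\<in>ball 0 b. ennreal (exp (\<alpha> * \<bar>f x\<bar> powr g)) \<partial>lborel) \<le> C"
    and v: "integrable lborel v" and supp: "\<And>x. a < norm x \<Longrightarrow> v x = 0" and ab: "0 \<le> a" "a < b"
    and sp: "0 < s" "1 < p" "0 < g" and en: "gagliardo_energy s p v \<le> 1"
  shows "(\<integral>\<^sup>+ x\<in>ball 0 b. ennreal (exp (\<alpha> * \<bar>v x\<bar> powr g)) \<partial>lborel) \<le> C"
proof -
  have "gagliardo_energy s p v < \<infinity>" using en by (auto intro: le_less_trans)
  from test_function_approx[OF v supp ab sp(1,2) this] obtain f where
    f: "\<And>k::nat. f k \<in> test_functions (ball 0 b) \<inter> frac_sobolev s p" and [measurable]: "\<And>k. f k \<in> borel_measurable borel"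
    and fe: "\<And>k. gagliardo_energy s p (f k) \<le> gagliardo_energy s p v"
    and lim: "AE x in lborel. (\<lambda>k. f k x) \<longlonglongrightarrow> v x" by blast
  have [measurable]: "v \<in> borel_measurable borel" using borel_measurable_integrable[OF v] by simp
  let ?F = "\<lambda>u x. ennreal (exp (\<alpha> * \<bar>u x\<bar> powr g)) * indicator (ball (0::real ^ 'n) b) x"
  have "AE x in lborel. ?F v x = liminf (\<lambda>k. ?F (f k) x)"
    using lim
  proof eventually_elim
    case (elim x)
    have "(\<lambda>k. exp (\<alpha> * \<bar>f k x\<bar> powr g)) \<longlonglongrightarrow> exp (\<alpha> * \<bar>v x\<bar> powr g)"
      using sp elim by (intro tendsto_intros tendsto_powr') auto
    then have "(\<lambda>k. ?F (f k) x) \<longlonglongrightarrow> ?F v x"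
      by (cases "x \<in> ball 0 b") (auto intro: tendsto_ennrealI)
    then show ?case by (simp only: lim_imp_Liminf[OF sequentially_bot])
  qed
  then have "(\<integral>\<^sup>+ x. ?F v x \<partial>lborel) = (\<integral>\<^sup>+ x. liminf (\<lambda>k. ?F (f k) x) \<partial>lborel)"
    by (rule nn_integral_cong_AE)
  also have "\<dots> \<le> liminf (\<lambda>k. \<integral>\<^sup>+ x. ?F (f k) x \<partial>lborel)"
    by (rule nn_integral_liminf) measurable
  also have "\<dots> \<le> C"
  proof -
    have "(\<integral>\<^sup>+ x. ?F (f k) x \<partial>lborel) \<le> C" for k
      using MT[OF f _ order_trans[OF fe en]] by simp
    then have "liminf (\<lambda>k. \<integral>\<^sup>+ x. ?F (f k) x \<partial>lborel) \<le> liminf (\<lambda>k. C)"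
      by (intro Liminf_mono always_eventually) auto
    then show ?thesis by (simp add: Liminf_const)
  qed
  finally show ?thesis .
qed

lemma gagliardo_energy_mult:
  fixes u :: "real ^ 'n \<Rightarrow> real"
  assumes [measurable]: "u \<in> borel_measurable borel"
  shows "gagliardo_energy s p (\<lambda>x. c * u x) = ennreal (\<bar>c\<bar> powr p) * gagliardo_energy s p u"
proof -
  have "\<bar>c * u x - c * u y\<bar> powr p = \<bar>c\<bar> powr p * \<bar>u x - u y\<bar> powr p" for x y
    by (simp add: right_diff_distrib[symmetric] abs_mult powr_mult)
  then have "gagliardo_energy s p (\<lambda>x. c * u x) = (\<integral>\<^sup>+ x. \<integral>\<^sup>+ y. ennreal (\<bar>c\<bar> powr p) *
      ennreal (\<bar>u x - u y\<bar> powr p / norm (x - y) powr (real CARD('n) + s * p)) \<partial>lborel \<partial>lborel)"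
    by (simp add: gagliardo_energy_lborel ennreal_mult[symmetric])
  also have "\<dots> = ennreal (\<bar>c\<bar> powr p) * gagliardo_energy s p u"
    by (simp add: nn_integral_cmult gagliardo_energy_lborel)
  finally show ?thesis .
qed

text \<open>If the energy is at most \<open>E\<close>, then \<open>w = E^(-1/p) v\<close> has energy
  at most 1 and \<open>v = (E/M)^(1/p) * (M^(1/p) * w)\<close>. The inner factor goes into the
  exponent of the hypothesis; \<open>Phi_scale\<close> turns the outer one into
  \<open>E / M\<close>, because \<open>p = N / s\<close>. So the constant bound becomes linear in
  the energy.\<close>

lemma nn_integral_Phi_le_energy:
  fixes v :: "real ^ 'n \<Rightarrow> real" and s p \<alpha> b C M :: real
  defines "g \<equiv> real CARD('n) / (real CARD('n) - s)"
  assumes MT: "\<And>f :: real ^ 'n \<Rightarrow> real. f \<in> test_functions (ball 0 b) \<inter> frac_sobolev s p \<Longrightarrow> f \<in> borel_measurable borel \<Longrightarrow>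
        gagliardo_energy s p f \<le> 1 \<Longrightarrow>
        (\<integral>\<^sup>+ x\<in>ball 0 b. ennreal (exp (\<alpha> * M powr (g / p) * \<bar>f x\<bar> powr g)) \<partial>lborel) \<le> ennreal C"
    and v: "integrable lborel v" and supp: "\<And>x. a < norm x \<Longrightarrow> v x = 0" and ab: "0 \<le> a" "a < b"
    and sp: "0 < s" "s < real CARD('n)" "1 < p" "p = real CARD('n) / s" and \<alpha>: "0 \<le> \<alpha>"
    and M: "0 < M" "gagliardo_energy s p v \<le> ennreal M" and C: "0 \<le> C"
  shows "(\<integral>\<^sup>+ x\<in>ball 0 b. ennreal (exp (\<alpha> * \<bar>v x\<bar> powr g)) \<partial>lborel) \<le> ennreal C"
    and "(\<integral>\<^sup>+ x\<in>ball 0 b. ennreal (Phi CARD('n) s \<alpha> (v x)) \<partial>lborel) \<le> ennreal (C / M) * gagliardo_energy s p v"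
proof -
  have g: "0 < g" using sp by (simp add: g_def)
  have [measurable]: "v \<in> borel_measurable borel" using borel_measurable_integrable[OF v] by simp
  have scaled: "(\<integral>\<^sup>+ x\<in>ball 0 b. ennreal (exp (\<alpha> * M powr (g / p) * \<bar>E powr (- 1 / p) * v x\<bar> powr g)) \<partial>lborel) \<le> ennreal C"
    if E: "0 < E" "gagliardo_energy s p v \<le> ennreal E" for E
  proof (rule nn_integral_exp_le_of_test_functions[OF MT _ _ ab sp(1,3) g])
    have "gagliardo_energy s p (\<lambda>x. E powr (- 1 / p) * v x) = ennreal ((E powr (- 1 / p)) powr p) * gagliardo_energy s p v"
      by (subst gagliardo_energy_mult) simp_all
    also have "(E powr (- 1 / p)) powr p = 1 / E"
      using E sp(3) unfolding powr_powr by (simp add: powr_minus_divide)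
    also have "ennreal (1 / E) * gagliardo_energy s p v \<le> ennreal (1 / E) * ennreal E"
      using E by (intro mult_left_mono) auto
    also have "\<dots> = 1" using E by (simp add: ennreal_mult[symmetric])
    finally show "gagliardo_energy s p (\<lambda>x. E powr (- 1 / p) * v x) \<le> 1" .
  qed (use v supp in auto)
  have eq: "\<alpha> * M powr (g / p) * \<bar>M powr (- 1 / p) * v x\<bar> powr g = \<alpha> * \<bar>v x\<bar> powr g" for x
  proof -
    have "M powr (g / p) * (M powr (- 1 / p)) powr g = 1"
      using M by (simp add: powr_powr powr_add[symmetric])
    then show ?thesis by (simp add: abs_mult powr_mult mult_ac)
  qed
  show "(\<integral>\<^sup>+ x\<in>ball 0 b. ennreal (exp (\<alpha> * \<bar>v x\<bar> powr g)) \<partial>lborel) \<le> ennreal C"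
    using scaled[OF M] unfolding eq .
  let ?I = "\<integral>\<^sup>+ x\<in>ball 0 b. ennreal (Phi CARD('n) s \<alpha> (v x)) \<partial>lborel"
  have le: "?I \<le> ennreal (E / M * C)" if E: "0 < E" "E \<le> M" "gagliardo_energy s p v \<le> ennreal E" for E
  proof -
    have "Phi CARD('n) s \<alpha> (v x) \<le> E / M * exp (\<alpha> * M powr (g / p) * \<bar>E powr (- 1 / p) * v x\<bar> powr g)" for x
    proof -
      define w where "w = E powr (- 1 / p) * v x"
      have "(E / M) powr (1 / p) * M powr (1 / p) * E powr (- 1 / p) = 1"
        using E M by (simp add: powr_divide powr_minus_divide)
      then have "v x = (E / M) powr (1 / p) * (M powr (1 / p) * w)"
        by (simp add: w_def mult.assoc[symmetric])
      then have "Phi CARD('n) s \<alpha> (v x) = Phi CARD('n) s \<alpha> ((E / M) powr (1 / p) * (M powr (1 / p) * w))" by simp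
      also have "\<dots> \<le> ((E / M) powr (1 / p)) powr (real CARD('n) / s) * Phi CARD('n) s \<alpha> (M powr (1 / p) * w)"
        using \<alpha> sp(1-3) E M by (intro Phi_scale powr_le1) auto
      also have "((E / M) powr (1 / p)) powr (real CARD('n) / s) = E / M"
        using E M sp by (simp add: powr_powr)
      also have "Phi CARD('n) s \<alpha> (M powr (1 / p) * w) = Phi CARD('n) s (\<alpha> * M powr (g / p)) w"
        by (simp add: Phi_mult g_def powr_powr) (simp add: mult.commute)
      also have "E / M * \<dots> \<le> E / M * exp (\<alpha> * M powr (g / p) * \<bar>w\<bar> powr g)"
        unfolding g_def using \<alpha> E M by (intro mult_left_mono Phi_le_exp) auto
      finally show ?thesis by (simp add: w_def)
    qed
    then have "?I \<le> (\<integral>\<^sup>+ x. ennreal (E / M) * (ennreal (exp (\<alpha> * M powr (g / p) * \<bar>E powr (- 1 / p) * v x\<bar> powr g)) * indicator (ball 0 b) x) \<partial>lborel)"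
      using E M by (intro nn_integral_mono) (auto simp: indicator_def ennreal_mult[symmetric] intro!: ennreal_leI)
    also have "\<dots> = ennreal (E / M) * (\<integral>\<^sup>+ x\<in>ball 0 b. ennreal (exp (\<alpha> * M powr (g / p) * \<bar>E powr (- 1 / p) * v x\<bar> powr g)) \<partial>lborel)"
      by (rule nn_integral_cmult) measurable
    also have "\<dots> \<le> ennreal (E / M) * ennreal C"
      by (intro mult_left_mono scaled E) auto
    also have "\<dots> = ennreal (E / M * C)" using E M C by (intro ennreal_mult[symmetric]) auto
    finally show ?thesis .
  qed
  obtain E where E: "gagliardo_energy s p v = ennreal E" "0 \<le> E" "E \<le> M"
    using M by (metis ennreal_enn2real_if ennreal_le_iff enn2real_nonneg less_imp_le top.extremum_unique infinity_ennreal_def ennreal_neq_top)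
  have "?I \<le> ennreal (E / M * C)"
  proof (cases "E = 0")
    case False
    then show ?thesis using le[of E] E by simp
  next
    \<comment> \<open>A vanishing energy cannot be normalised, so the bound for
      \<open>E = M / (n + 1)\<close> is passed to the limit.\<close>
    case True
    have "(\<lambda>n. ennreal (M / (real n + 1) / M * C)) \<longlonglongrightarrow> ennreal 0"
      using M by (intro tendsto_ennrealI) real_asymp
    moreover have "?I \<le> ennreal (M / (real n + 1) / M * C)" for n
      using True E M by (intro le) (auto simp: field_simps)
    ultimately have "?I \<le> ennreal 0" by (intro LIMSEQ_le_const) auto
    then show ?thesis using True by simp
  qed
  also have "\<dots> = ennreal (C / M) * gagliardo_energy s p v"
    using E M C by (simp add: ennreal_mult[symmetric] mult_ac)
  finally show "?I \<le> ennreal (C / M) * gagliardo_energy s p v" .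
qed

section \<open>Localisation\<close>

definition cutoff :: "real \<Rightarrow> real ^ 'n \<Rightarrow> real" where
  "cutoff R x = max 0 (min 1 (2 - norm x / R))"

lemma borel_measurable_cutoff [measurable]: "cutoff R \<in> borel_measurable borel"
  unfolding cutoff_def[abs_def] by measurable

lemma cutoff_range: "0 \<le> cutoff R x" "cutoff R x \<le> 1"
  by (auto simp: cutoff_def)

lemma cutoff_powr_le_1: "0 \<le> p \<Longrightarrow> cutoff R x powr p \<le> 1"
  using cutoff_range[of R x] by (intro powr_le1) auto

lemma cutoff_eq_1: "0 < R \<Longrightarrow> norm x \<le> R \<Longrightarrow> cutoff R x = 1"
  by (simp add: cutoff_def field_simps)

lemma cutoff_eq_0: "0 < R \<Longrightarrow> 2 * R \<le> norm x \<Longrightarrow> cutoff R x = 0"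
  by (simp add: cutoff_def field_simps)

lemma cutoff_diff_le: "0 < R \<Longrightarrow> \<bar>cutoff R x - cutoff R y\<bar> \<le> min 1 (norm (x - y) / R)"
proof -
  assume R: "0 < R"
  have "\<bar>norm x / R - norm y / R\<bar> \<le> norm (x - y) / R"
    using R norm_triangle_ineq3[of x y] by (simp add: diff_divide_distrib[symmetric] divide_right_mono)
  then show ?thesis unfolding cutoff_def by linarith
qed

locale localization =
  fixes u :: "real ^ 'n \<Rightarrow> real" and s p R l :: real
  assumes u_meas [measurable]: "u \<in> borel_measurable borel"
    and s: "0 < s" "s < 1" and p: "1 < p" and R: "0 < R" and l: "0 < l" "l < 1"
begin

text \<open>The weights of \<open>powr_add_le\<close>: \<open>A\<close> multiplies the energy of
  \<open>u\<close> and tends to 1 as \<open>l\<close> does, while \<open>B\<close> multiplies the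
  commutator and blows up; a large \<open>R\<close> compensates by making \<open>K\<close>
  small.\<close>

definition A :: real where "A = l powr (1 - p)"
definition B :: real where "B = (1 - l) powr (1 - p)"

lemma AB: "0 \<le> A" "0 \<le> B" by (simp_all add: A_def B_def)

definition k :: "real ^ 'n \<Rightarrow> real" where "k x = 1 / norm x powr (real CARD('n) + s * p)"

lemma k_nonneg: "0 \<le> k x" by (simp add: k_def)

lemma k_meas [measurable]: "k \<in> borel_measurable borel" unfolding k_def by measurable

definition G :: "real ^ 'n \<Rightarrow> ennreal" where
  "G x = (\<integral>\<^sup>+ y. ennreal (\<bar>u x - u y\<bar> powr p * k (x - y)) \<partial>lborel)"

lemma G_meas [measurable]: "G \<in> borel_measurable borel"
  unfolding G_def by measurable

lemma energy_G: "gagliardo_energy s p u = (\<integral>\<^sup>+ x. G x \<partial>lborel)"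
  by (simp add: gagliardo_energy_lborel G_def k_def)

text \<open>The commutator with \<open>y\<close> fixed: after Tonelli, the weight that multiplies
  \<open>|u (y + a)|^p\<close>.\<close>

definition H :: "real ^ 'n \<Rightarrow> ennreal" where
  "H y = (\<integral>\<^sup>+ x. ennreal (\<bar>cutoff R x - cutoff R y\<bar> powr p * k (x - y)) \<partial>lborel)"

lemma H_meas [measurable]: "H \<in> borel_measurable borel"
  unfolding H_def by measurable

definition K :: ennreal where
  "K = (\<integral>\<^sup>+ z. ennreal (cutoff_kernel s p R (z :: real ^ 'n)) \<partial>lborel)"

definition P :: ennreal where
  "P = (\<integral>\<^sup>+ x. ennreal (\<bar>u x\<bar> powr p) \<partial>lborel)"

definition loc :: "real ^ 'n \<Rightarrow> real ^ 'n \<Rightarrow> real" where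
  "loc a x = cutoff R x * u (x + a)"

lemma loc_meas [measurable]: "loc a \<in> borel_measurable borel"
  unfolding loc_def[abs_def] by measurable

lemma cutoff_le_kernel: "\<bar>cutoff R x - cutoff R y\<bar> powr p * k (x - y) \<le> cutoff_kernel s p R (x - y)"
proof -
  have "\<bar>cutoff R x - cutoff R y\<bar> powr p \<le> min 1 (norm (x - y) / R) powr p"
    using cutoff_diff_le[OF R, of x y] p by (intro powr_mono2) auto
  then show ?thesis unfolding cutoff_kernel_def k_def by (simp add: divide_right_mono)
qed

lemma kernel_shift:
  fixes x y :: "real ^ 'n"
  shows
  "(\<integral>\<^sup>+ x. ennreal (cutoff_kernel s p R (x - y)) \<partial>lborel) = K"
  "(\<integral>\<^sup>+ y. ennreal (cutoff_kernel s p R (x - y)) \<partial>lborel) = K"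
  unfolding K_def
  using nn_integral_lborel_shift[of "\<lambda>z. ennreal (cutoff_kernel s p R z)" "- y"]
    nn_integral_lborel_reflect[of "\<lambda>z. ennreal (cutoff_kernel s p R z)" x] by auto

lemma H_le: "H y \<le> K"
proof -
  have "H y \<le> (\<integral>\<^sup>+ x. ennreal (cutoff_kernel s p R (x - y)) \<partial>lborel)"
    unfolding H_def by (intro nn_integral_mono ennreal_leI cutoff_le_kernel)
  then show ?thesis by (simp add: kernel_shift)
qed

text \<open>The commutator vanishes unless one of its two points lies in the ball of radius
  \<open>2 * R\<close>. With that point fixed, the kernel has mass \<open>K\<close> in the other;
  the factor 2 counts the two cases.\<close>

lemma integral_H_le: "(\<integral>\<^sup>+ y. H y \<partial>lborel) \<le> 2 * emeasure lborel (ball (0 :: real ^ 'n) (2 * R)) * K"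
proof -
  let ?b = "ball (0 :: real ^ 'n) (2 * R)"
  let ?c = "\<lambda>x y. ennreal (cutoff_kernel s p R (x - y))"
  have "(\<integral>\<^sup>+ y. H y \<partial>lborel) \<le> (\<integral>\<^sup>+ y. \<integral>\<^sup>+ x. ?c x y * indicator ?b x + ?c x y * indicator ?b y \<partial>lborel \<partial>lborel)"
    unfolding H_def
  proof (intro nn_integral_mono)
    fix x y
    show "ennreal (\<bar>cutoff R x - cutoff R y\<bar> powr p * k (x - y)) \<le> ?c x y * indicator ?b x + ?c x y * indicator ?b y"
    proof (cases "x \<in> ?b \<or> y \<in> ?b")
      case True
      have "ennreal (\<bar>cutoff R x - cutoff R y\<bar> powr p * k (x - y)) \<le> ?c x y"
        by (intro ennreal_leI cutoff_le_kernel)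
      with True show ?thesis by (auto simp: indicator_def intro: order_trans)
    next
      case False
      then have "cutoff R x = 0" "cutoff R y = 0" using cutoff_eq_0[OF R, of x] cutoff_eq_0[OF R, of y] by auto
      then show ?thesis by simp
    qed
  qed
  also have "\<dots> = (\<integral>\<^sup>+ y. (\<integral>\<^sup>+ x. ?c x y * indicator ?b x \<partial>lborel) + (\<integral>\<^sup>+ x. ?c x y * indicator ?b y \<partial>lborel) \<partial>lborel)"
    by (intro nn_integral_cong nn_integral_add) measurable
  also have "\<dots> = (\<integral>\<^sup>+ y. \<integral>\<^sup>+ x. ?c x y * indicator ?b x \<partial>lborel \<partial>lborel) + (\<integral>\<^sup>+ y. \<integral>\<^sup>+ x. ?c x y * indicator ?b y \<partial>lborel \<partial>lborel)"
    by (intro nn_integral_add) measurable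
  also have "(\<integral>\<^sup>+ y. \<integral>\<^sup>+ x. ?c x y * indicator ?b x \<partial>lborel \<partial>lborel) = (\<integral>\<^sup>+ x. \<integral>\<^sup>+ y. ?c x y * indicator ?b x \<partial>lborel \<partial>lborel)"
    by (rule lborel_pair.Fubini') measurable
  also have "\<dots> = (\<integral>\<^sup>+ x. K * indicator ?b x \<partial>lborel)"
    by (intro nn_integral_cong) (simp add: nn_integral_multc kernel_shift)
  also have "\<dots> = K * emeasure lborel ?b" by (rule nn_integral_cmult_indicator) simp
  also have "(\<integral>\<^sup>+ y. \<integral>\<^sup>+ x. ?c x y * indicator ?b y \<partial>lborel \<partial>lborel) = (\<integral>\<^sup>+ y. K * indicator ?b y \<partial>lborel)"
    by (intro nn_integral_cong) (simp add: nn_integral_multc kernel_shift)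
  also have "\<dots> = K * emeasure lborel ?b" by (rule nn_integral_cmult_indicator) simp
  finally show ?thesis by (simp only: mult_2 distrib_right distrib_left mult_ac)
qed

text \<open>The product increment is split as the cutoff at \<open>x\<close> times the increment of
  \<open>u\<close>, plus \<open>u\<close> at \<open>y\<close> times the increment of the cutoff.
  Evaluating at different points lets the first part integrate in \<open>y\<close> to
  \<open>G\<close> and the second in \<open>x\<close> to \<open>H\<close>.\<close>

lemma energy_loc_le:
  "gagliardo_energy s p (loc a) \<le> ennreal A * (\<integral>\<^sup>+ x. ennreal (cutoff R x powr p) * G (x + a) \<partial>lborel)
     + ennreal B * (\<integral>\<^sup>+ y. ennreal (\<bar>u (y + a)\<bar> powr p) * H y \<partial>lborel)"
proof -
  let ?f = "\<lambda>x y. ennreal A * (ennreal (cutoff R x powr p) * ennreal (\<bar>u (x + a) - u (y + a)\<bar> powr p * k (x - y)))"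
  let ?g = "\<lambda>x y. ennreal B * (ennreal (\<bar>u (y + a)\<bar> powr p) * ennreal (\<bar>cutoff R x - cutoff R y\<bar> powr p * k (x - y)))"
  have "gagliardo_energy s p (loc a) \<le> (\<integral>\<^sup>+ x. \<integral>\<^sup>+ y. ?f x y + ?g x y \<partial>lborel \<partial>lborel)"
    unfolding gagliardo_energy_lborel
  proof (intro nn_integral_mono)
    fix x y
    have "loc a x - loc a y = cutoff R x * (u (x + a) - u (y + a)) + u (y + a) * (cutoff R x - cutoff R y)"
      by (simp add: loc_def algebra_simps)
    then have "\<bar>loc a x - loc a y\<bar> \<le> cutoff R x * \<bar>u (x + a) - u (y + a)\<bar> + \<bar>u (y + a)\<bar> * \<bar>cutoff R x - cutoff R y\<bar>"
      using abs_triangle_ineq[of "cutoff R x * (u (x + a) - u (y + a))" "u (y + a) * (cutoff R x - cutoff R y)"] cutoff_range(1)[of R x]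
      by (simp add: abs_mult)
    then have "\<bar>loc a x - loc a y\<bar> powr p \<le> (cutoff R x * \<bar>u (x + a) - u (y + a)\<bar> + \<bar>u (y + a)\<bar> * \<bar>cutoff R x - cutoff R y\<bar>) powr p"
      using p by (intro powr_mono2) auto
    also have "\<dots> \<le> A * (cutoff R x * \<bar>u (x + a) - u (y + a)\<bar>) powr p + B * (\<bar>u (y + a)\<bar> * \<bar>cutoff R x - cutoff R y\<bar>) powr p"
      unfolding A_def B_def using cutoff_range(1)[of R x] p l by (intro powr_add_le) (auto intro!: mult_nonneg_nonneg)
    finally have "\<bar>loc a x - loc a y\<bar> powr p * k (x - y) \<le>
        (A * (cutoff R x * \<bar>u (x + a) - u (y + a)\<bar>) powr p + B * (\<bar>u (y + a)\<bar> * \<bar>cutoff R x - cutoff R y\<bar>) powr p) * k (x - y)"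
      using k_nonneg by (intro mult_right_mono)
    also have "\<dots> = A * (cutoff R x powr p * (\<bar>u (x + a) - u (y + a)\<bar> powr p * k (x - y)))
        + B * (\<bar>u (y + a)\<bar> powr p * (\<bar>cutoff R x - cutoff R y\<bar> powr p * k (x - y)))"
      using cutoff_range by (simp add: powr_mult algebra_simps)
    finally have "ennreal (\<bar>loc a x - loc a y\<bar> powr p * k (x - y)) \<le> \<dots>" by (rule ennreal_leI)
    also have "\<dots> = ?f x y + ?g x y"
      using AB k_nonneg by (simp add: ennreal_mult)
    finally show "ennreal (\<bar>loc a x - loc a y\<bar> powr p / norm (x - y) powr (real CARD('n) + s * p)) \<le> ?f x y + ?g x y"
      by (simp add: k_def)
  qed
  also have "\<dots> = (\<integral>\<^sup>+ x. (\<integral>\<^sup>+ y. ?f x y \<partial>lborel) + (\<integral>\<^sup>+ y. ?g x y \<partial>lborel) \<partial>lborel)"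
    by (intro nn_integral_cong nn_integral_add) measurable
  also have "\<dots> = (\<integral>\<^sup>+ x. \<integral>\<^sup>+ y. ?f x y \<partial>lborel \<partial>lborel) + (\<integral>\<^sup>+ x. \<integral>\<^sup>+ y. ?g x y \<partial>lborel \<partial>lborel)"
    by (intro nn_integral_add) measurable
  also have "(\<integral>\<^sup>+ x. \<integral>\<^sup>+ y. ?f x y \<partial>lborel \<partial>lborel) = ennreal A * (\<integral>\<^sup>+ x. ennreal (cutoff R x powr p) * G (x + a) \<partial>lborel)"
  proof -
    have "(\<integral>\<^sup>+ y. ennreal (\<bar>u (x + a) - u (y + a)\<bar> powr p * k (x - y)) \<partial>lborel) = G (x + a)" for x
      using nn_integral_lborel_shift[of "\<lambda>y. ennreal (\<bar>u (x + a) - u y\<bar> powr p * k (x + a - y))" a]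
      by (simp add: G_def algebra_simps)
    then show ?thesis by (simp add: nn_integral_cmult)
  qed
  also have "(\<integral>\<^sup>+ x. \<integral>\<^sup>+ y. ?g x y \<partial>lborel \<partial>lborel) = (\<integral>\<^sup>+ y. \<integral>\<^sup>+ x. ?g x y \<partial>lborel \<partial>lborel)"
    by (rule lborel_pair.Fubini'[symmetric]) measurable
  also have "\<dots> = ennreal B * (\<integral>\<^sup>+ y. ennreal (\<bar>u (y + a)\<bar> powr p) * H y \<partial>lborel)"
    by (simp add: nn_integral_cmult H_def)
  finally show ?thesis .
qed

text \<open>The cutoff is at most 1 and \<open>H\<close> at most \<open>K\<close>, after which the
  translation drops out. Being uniform in \<open>a\<close>, this keeps every localised function
  below the critical level at once.\<close>

lemma energy_loc_bound:
  "gagliardo_energy s p (loc a) \<le> ennreal A * gagliardo_energy s p u + ennreal B * (K * P)"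
proof -
  have "(\<integral>\<^sup>+ x. ennreal (cutoff R x powr p) * G (x + a) \<partial>lborel) \<le> (\<integral>\<^sup>+ x. 1 * G (x + a) \<partial>lborel)"
    using p by (intro nn_integral_mono mult_right_mono) (auto intro!: cutoff_powr_le_1)
  also have "\<dots> = gagliardo_energy s p u"
    using nn_integral_lborel_shift[of G a] by (simp add: energy_G)
  finally have 1: "(\<integral>\<^sup>+ x. ennreal (cutoff R x powr p) * G (x + a) \<partial>lborel) \<le> gagliardo_energy s p u" .
  have "(\<integral>\<^sup>+ y. ennreal (\<bar>u (y + a)\<bar> powr p) * H y \<partial>lborel) \<le> (\<integral>\<^sup>+ y. ennreal (\<bar>u (y + a)\<bar> powr p) * K \<partial>lborel)"
    by (intro nn_integral_mono mult_left_mono H_le) auto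
  also have "\<dots> = K * P"
    using nn_integral_lborel_shift[of "\<lambda>y. ennreal (\<bar>u y\<bar> powr p)" a]
    by (simp add: nn_integral_multc P_def) (simp add: mult.commute)
  finally have 2: "(\<integral>\<^sup>+ y. ennreal (\<bar>u (y + a)\<bar> powr p) * H y \<partial>lborel) \<le> K * P" .
  show ?thesis
    by (rule order_trans[OF energy_loc_le]) (intro add_mono mult_left_mono 1 2; simp)
qed

text \<open>Integrating in \<open>a\<close> first turns \<open>G (x + a)\<close> into the full
  energy and \<open>|u (y + a)|^p\<close> into \<open>P\<close>; what remains are the integrals of
  the cutoff power and of \<open>H\<close>, finite because the cutoff has bounded support.\<close>

lemma energy_loc_average:
  "(\<integral>\<^sup>+ a. gagliardo_energy s p (loc a) \<partial>lborel) \<le>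
     ennreal A * (emeasure lborel (ball (0 :: real ^ 'n) (2 * R)) * gagliardo_energy s p u)
     + ennreal B * (2 * emeasure lborel (ball (0 :: real ^ 'n) (2 * R)) * K * P)"
proof -
  have "(\<integral>\<^sup>+ a. gagliardo_energy s p (loc a) \<partial>lborel) \<le>
      (\<integral>\<^sup>+ a. ennreal A * (\<integral>\<^sup>+ x. ennreal (cutoff R x powr p) * G (x + a) \<partial>lborel)
     + ennreal B * (\<integral>\<^sup>+ y. ennreal (\<bar>u (y + a)\<bar> powr p) * H y \<partial>lborel) \<partial>lborel)"
    by (intro nn_integral_mono energy_loc_le)
  also have "\<dots> = ennreal A * (\<integral>\<^sup>+ a. \<integral>\<^sup>+ x. ennreal (cutoff R x powr p) * G (x + a) \<partial>lborel \<partial>lborel)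
     + ennreal B * (\<integral>\<^sup>+ a. \<integral>\<^sup>+ y. ennreal (\<bar>u (y + a)\<bar> powr p) * H y \<partial>lborel \<partial>lborel)"
    by (simp add: nn_integral_add nn_integral_cmult)
  also have "(\<integral>\<^sup>+ a. \<integral>\<^sup>+ x. ennreal (cutoff R x powr p) * G (x + a) \<partial>lborel \<partial>lborel)
      = (\<integral>\<^sup>+ x. \<integral>\<^sup>+ a. ennreal (cutoff R x powr p) * G (x + a) \<partial>lborel \<partial>lborel)"
    by (rule lborel_pair.Fubini') measurable
  also have "\<dots> = (\<integral>\<^sup>+ x. ennreal (cutoff R (x :: real ^ 'n) powr p) * gagliardo_energy s p u \<partial>lborel)"
  proof (intro nn_integral_cong)
    fix x
    show "(\<integral>\<^sup>+ a. ennreal (cutoff R x powr p) * G (x + a) \<partial>lborel) = ennreal (cutoff R x powr p) * gagliardo_energy s p u"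
      using nn_integral_lborel_shift[of G x] by (simp add: nn_integral_cmult energy_G add.commute)
  qed
  also have "(\<integral>\<^sup>+ a. \<integral>\<^sup>+ y. ennreal (\<bar>u (y + a)\<bar> powr p) * H y \<partial>lborel \<partial>lborel)
      = (\<integral>\<^sup>+ y. \<integral>\<^sup>+ a. ennreal (\<bar>u (y + a)\<bar> powr p) * H y \<partial>lborel \<partial>lborel)"
    by (rule lborel_pair.Fubini') measurable
  also have "\<dots> = (\<integral>\<^sup>+ y. P * H y \<partial>lborel)"
  proof (intro nn_integral_cong)
    fix y
    show "(\<integral>\<^sup>+ a. ennreal (\<bar>u (y + a)\<bar> powr p) * H y \<partial>lborel) = P * H y"
      using nn_integral_lborel_shift[of "\<lambda>a. ennreal (\<bar>u a\<bar> powr p)" y]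
      by (simp add: nn_integral_multc P_def add.commute)
  qed
  also have "\<dots> = P * (\<integral>\<^sup>+ y. H y \<partial>lborel)" by (rule nn_integral_cmult) simp
  also have "(\<integral>\<^sup>+ x. ennreal (cutoff R (x :: real ^ 'n) powr p) * gagliardo_energy s p u \<partial>lborel)
      = (\<integral>\<^sup>+ x. ennreal (cutoff R (x :: real ^ 'n) powr p) \<partial>lborel) * gagliardo_energy s p u"
    by (rule nn_integral_multc) measurable
  also have "ennreal A * ((\<integral>\<^sup>+ x. ennreal (cutoff R (x :: real ^ 'n) powr p) \<partial>lborel) * gagliardo_energy s p u) + ennreal B * (P * (\<integral>\<^sup>+ y. H y \<partial>lborel))
     \<le> ennreal A * (emeasure lborel (ball (0 :: real ^ 'n) (2 * R)) * gagliardo_energy s p u)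
     + ennreal B * (P * (2 * emeasure lborel (ball (0 :: real ^ 'n) (2 * R)) * K))"
  proof (intro add_mono mult_left_mono mult_right_mono integral_H_le)
    have "(\<integral>\<^sup>+ x. ennreal (cutoff R (x :: real ^ 'n) powr p) \<partial>lborel) \<le> (\<integral>\<^sup>+ x. indicator (ball (0 :: real ^ 'n) (2 * R)) x \<partial>lborel)"
    proof (intro nn_integral_mono)
      fix x :: "real ^ 'n"
      show "ennreal (cutoff R x powr p) \<le> indicator (ball 0 (2 * R)) x"
        using cutoff_range[of R x] cutoff_eq_0[OF R, of x] p by (cases "norm x < 2 * R") (auto intro!: cutoff_powr_le_1)
    qed
    then show "(\<integral>\<^sup>+ x. ennreal (cutoff R (x :: real ^ 'n) powr p) \<partial>lborel) \<le> emeasure lborel (ball (0 :: real ^ 'n) (2 * R))"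
      by simp
  qed auto
  finally show ?thesis by (simp only: mult_ac)
qed

lemma energy_loc_meas [measurable]: "(\<lambda>a. gagliardo_energy s p (loc a)) \<in> borel_measurable borel"
  unfolding gagliardo_energy_lborel loc_def by measurable

lemma loc_supp: "2 * R < norm x \<Longrightarrow> loc a x = 0"
  using cutoff_eq_0[OF R, of x] by (simp add: loc_def)

lemma loc_integrable:
  assumes "P < \<infinity>"
  shows "integrable lborel (loc a)"
proof (rule integrable_of_bounded_support[OF _ loc_supp])
  have "(\<integral>\<^sup>+ x. ennreal (\<bar>loc a x\<bar> powr p) \<partial>lborel) \<le> (\<integral>\<^sup>+ x. ennreal (\<bar>u (x + a)\<bar> powr p) \<partial>lborel)"
  proof (intro nn_integral_mono ennreal_leI powr_mono2)
    show "\<bar>loc a x\<bar> \<le> \<bar>u (x + a)\<bar>" for x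
      using cutoff_range[of R x] by (simp add: loc_def abs_mult mult_left_le_one_le)
  qed (use p in auto)
  also have "\<dots> = P"
    using nn_integral_lborel_shift[of "\<lambda>a. ennreal (\<bar>u a\<bar> powr p)" a] by (simp add: P_def)
  finally show "(\<integral>\<^sup>+ x. ennreal (\<bar>loc a x\<bar> powr p) \<partial>lborel) < \<infinity>" using assms by auto
qed (use p in auto)

end

section \<open>Uniform bounds\<close>

text \<open>The weighted case uses the two conclusions at different exponents: \<open>Phi\<close> on
  the whole space, and the full exponential on the unit ball, to which Young's inequality
  applies.\<close>

lemma unweighted_bound:
  fixes s p \<alpha> \<alpha>' \<tau> :: real
  defines "g \<equiv> real CARD('n::finite) / (real CARD('n) - s)"
  assumes MT: "\<And>b \<alpha>. 0 < b \<Longrightarrow> 0 \<le> \<alpha> \<Longrightarrow> \<alpha> < \<alpha>' \<Longrightarrow> \<exists>C<\<infinity>. \<forall>f :: real ^ 'n \<Rightarrow> real.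
        f \<in> test_functions (ball 0 b) \<inter> frac_sobolev s p \<longrightarrow> f \<in> borel_measurable borel \<longrightarrow>
        gagliardo_energy s p f \<le> 1 \<longrightarrow> (\<integral>\<^sup>+ x\<in>ball 0 b. ennreal (exp (\<alpha> * \<bar>f x\<bar> powr g)) \<partial>lborel) \<le> C"
    and s: "0 < s" "s < 1" and p: "1 < p" "p = real CARD('n) / s"
    and \<alpha>: "0 < \<alpha>" "\<alpha> < \<alpha>'" and \<tau>: "0 < \<tau>"
  shows "\<exists>C<\<infinity>. \<forall>u :: real ^ 'n \<Rightarrow> real. u \<in> borel_measurable borel \<longrightarrow>
      gagliardo_energy s p u + ennreal \<tau> * (\<integral>\<^sup>+ x. ennreal (\<bar>u x\<bar> powr p) \<partial>lborel) \<le> 1 \<longrightarrow>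
      (\<integral>\<^sup>+ x. ennreal (Phi CARD('n) s \<alpha> (u x)) \<partial>lborel) \<le> C \<and>
      (\<integral>\<^sup>+ x\<in>ball 0 1. ennreal (exp (\<alpha> * \<bar>u x\<bar> powr g)) \<partial>lborel) \<le> C"
proof -
  have sN: "s < real CARD('n)" using p s by (simp add: less_divide_eq)
  have g: "0 < g" using sN by (simp add: g_def)
  \<comment> \<open>\<open>t\<close> is a subcritical exponent above \<alpha>, and \<open>M\<close>
    is the energy for which scaling down to energy 1 turns \<alpha> into exactly
    \<open>t\<close>.\<close>
  define t where "t = (\<alpha> + \<alpha>') / 2"
  define M where "M = (t / \<alpha>) powr (p / g)"
  have t: "\<alpha> < t" "t < \<alpha>'" using \<alpha> by (auto simp: t_def)
  have M: "1 < M" unfolding M_def using t \<alpha> p(1) g by (intro gr_one_powr) auto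
  have Mt: "\<alpha> * M powr (g / p) = t"
    using t \<alpha> p(1) g by (simp add: M_def powr_powr)
  \<comment> \<open>Solves \<open>A = (1 + M) / 2\<close>, which spends half of the excess of
    \<open>M\<close> over 1.\<close>
  define l where "l = ((1 + M) / 2) powr (1 / (1 - p))"
  have l: "0 < l" "l < 1" "l powr (1 - p) = (1 + M) / 2"
    using M p by (auto simp: l_def powr_powr powr_less_one divide_neg_pos)
  define B where "B = (1 - l) powr (1 - p)"
  have B: "0 < B" using l by (simp add: B_def)
  \<comment> \<open>The kernel mass at which the commutator costs
    \<open>B * \<delta> / \<tau> = (M - 1) / 2\<close>, the other half, as the integral of
    \<open>|u|^p\<close> is at most \<open>1 / \<tau>\<close>.\<close>
  define \<delta> where "\<delta> = (M - 1) / 2 * \<tau> / B"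
  have \<delta>: "0 < \<delta>" using M \<tau> B by (simp add: \<delta>_def)
  have "\<forall>\<^sub>F n in sequentially. (\<integral>\<^sup>+ z. ennreal (cutoff_kernel s p (real (Suc n)) (z :: real ^ 'n)) \<partial>lborel) < ennreal \<delta>"
    using s p \<delta> by (intro order_tendstoD(2)[OF cutoff_kernel_tendsto_0]) auto
  then obtain n where n: "(\<integral>\<^sup>+ z. ennreal (cutoff_kernel s p (real (Suc n)) (z :: real ^ 'n)) \<partial>lborel) < ennreal \<delta>"
    by (auto simp: eventually_sequentially)
  define R where "R = real (Suc n)"
  have R: "1 \<le> R" by (simp add: R_def)
  \<comment> \<open>Localised functions live in the ball of radius \<open>2 * R\<close>; the radius
    \<open>3 * R\<close> leaves room for mollifying them.\<close>
  obtain C' where C': "C' < \<infinity>" "\<And>f :: real ^ 'n \<Rightarrow> real.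
        f \<in> test_functions (ball 0 (3 * R)) \<inter> frac_sobolev s p \<Longrightarrow> f \<in> borel_measurable borel \<Longrightarrow>
        gagliardo_energy s p f \<le> 1 \<Longrightarrow> (\<integral>\<^sup>+ x\<in>ball 0 (3 * R). ennreal (exp (t * \<bar>f x\<bar> powr g)) \<partial>lborel) \<le> C'"
    using MT[of "3 * R" t] R t \<alpha> by auto
  define C where "C = enn2real C'"
  have C: "C' = ennreal C" "0 \<le> C" using C'(1) by (auto simp: C_def)
  let ?V = "\<lambda>r. emeasure lborel (ball (0 :: real ^ 'n) r)"
  define D where "D = ennreal (C / M) * (ennreal ((1 + M) / 2) * ?V (2 * R) + ennreal B * (2 * ?V (2 * R) * ennreal \<delta> * ennreal (1 / \<tau>)))"
  have V: "?V r < \<infinity>" for r by (intro emeasure_bounded_finite) auto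
  have D: "D < \<infinity>" unfolding D_def using V by (simp add: ennreal_mult_less_top)
  have V0: "?V R \<noteq> 0" using R unit_ball_vol_pos[of "real CARD('n)"] by (simp add: emeasure_ball less_imp_neq[symmetric] del: unit_ball_vol_pos)
  define Ctot where "Ctot = max (D / ?V R) C'"
  have "Ctot < \<infinity>" using D V0 C'(1) unfolding Ctot_def max_def
    by (auto simp: ennreal_divide_eq_top_iff less_top[symmetric])
  moreover have "(\<integral>\<^sup>+ x. ennreal (Phi CARD('n) s \<alpha> (u x)) \<partial>lborel) \<le> Ctot \<and>
      (\<integral>\<^sup>+ x\<in>ball 0 1. ennreal (exp (\<alpha> * \<bar>u x\<bar> powr g)) \<partial>lborel) \<le> Ctot"
    if u [measurable]: "u \<in> borel_measurable borel" and
     norm: "gagliardo_energy s p u + ennreal \<tau> * (\<integral>\<^sup>+ x. ennreal (\<bar>u x\<bar> powr p) \<partial>lborel) \<le> 1"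
    for u :: "real ^ 'n \<Rightarrow> real"
  proof -
    interpret L: localization u s p R l
      by unfold_locales (use s p R l in auto)
    have E1: "gagliardo_energy s p u \<le> 1" using norm by (rule order_trans[rotated]) simp
    have "ennreal \<tau> * L.P \<le> 1" using norm unfolding L.P_def by (rule order_trans[rotated]) simp
    then have "ennreal (1 / \<tau>) * (ennreal \<tau> * L.P) \<le> ennreal (1 / \<tau>) * 1" by (rule mult_left_mono) simp
    then have P: "L.P \<le> ennreal (1 / \<tau>)"
      using \<tau> by (simp add: mult.assoc[symmetric] ennreal_mult[symmetric])
    have K: "L.K \<le> ennreal \<delta>" using n unfolding R_def[symmetric] L.K_def by simp
    have AB: "L.A = (1 + M) / 2" "L.B = B" using l by (auto simp: L.A_def L.B_def B_def)
    have energy: "gagliardo_energy s p (L.loc a) \<le> ennreal M" for a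
    proof -
      have "gagliardo_energy s p (L.loc a) \<le> ennreal ((1 + M) / 2) * 1 + ennreal B * (ennreal \<delta> * ennreal (1 / \<tau>))"
        using L.energy_loc_bound[of a] unfolding AB
        by (rule order_trans) (intro add_mono mult_mono E1 P K; simp)
      also have "\<dots> = ennreal ((1 + M) / 2 + B * (\<delta> * (1 / \<tau>)))"
        using B \<delta> \<tau> M by (simp add: ennreal_mult[symmetric] flip: ennreal_plus)
      also have "(1 + M) / 2 + B * (\<delta> * (1 / \<tau>)) = M"
        using B \<tau> by (simp add: \<delta>_def field_simps)
      finally show ?thesis .
    qed
    have MT': "(\<integral>\<^sup>+ x\<in>ball 0 (3 * R). ennreal (exp (\<alpha> * M powr (g / p) * \<bar>f x\<bar> powr g)) \<partial>lborel) \<le> ennreal C"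
      if "f \<in> test_functions (ball 0 (3 * R)) \<inter> frac_sobolev s p" "f \<in> borel_measurable borel" "gagliardo_energy s p f \<le> 1"
      for f :: "real ^ 'n \<Rightarrow> real"
      using C'(2)[OF that] unfolding Mt C(1) .
    have int: "integrable lborel (L.loc a)" for a
      using P by (intro L.loc_integrable) (auto intro: le_less_trans)
    have RR: "0 \<le> 2 * R" "2 * R < 3 * R" "0 < M" using R M by auto
    have bounds: "(\<integral>\<^sup>+ x\<in>ball 0 (3 * R). ennreal (exp (\<alpha> * \<bar>L.loc a x\<bar> powr g)) \<partial>lborel) \<le> ennreal C"
      "(\<integral>\<^sup>+ x\<in>ball 0 (3 * R). ennreal (Phi CARD('n) s \<alpha> (L.loc a x)) \<partial>lborel) \<le> ennreal (C / M) * gagliardo_energy s p (L.loc a)" for a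
      unfolding g_def
      by (rule nn_integral_Phi_le_energy[where a = "2 * R" and M = M and p = p];
        (rule MT'[unfolded g_def] int L.loc_supp RR s(1) sN p less_imp_le[OF \<alpha>(1)] energy C(2) | assumption)+)+
    \<comment> \<open>As \<open>R \<ge> 1\<close>, the cutoff equals 1 on the unit ball and
      \<open>u\<close> coincides there with its untranslated localisation.\<close>
    have "(\<integral>\<^sup>+ x\<in>ball 0 1. ennreal (exp (\<alpha> * \<bar>u x\<bar> powr g)) \<partial>lborel)
       \<le> (\<integral>\<^sup>+ x\<in>ball 0 (3 * R). ennreal (exp (\<alpha> * \<bar>L.loc 0 x\<bar> powr g)) \<partial>lborel)"
    proof (intro nn_integral_mono)
      fix x :: "real ^ 'n"
      show "ennreal (exp (\<alpha> * \<bar>u x\<bar> powr g)) * indicator (ball 0 1) x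
        \<le> ennreal (exp (\<alpha> * \<bar>L.loc 0 x\<bar> powr g)) * indicator (ball 0 (3 * R)) x"
        using cutoff_eq_1[of R x] R by (cases "norm x < 1") (auto simp: L.loc_def)
    qed
    also have "\<dots> \<le> C'" unfolding C(1) by (rule bounds(1))
    finally have 1: "(\<integral>\<^sup>+ x\<in>ball 0 1. ennreal (exp (\<alpha> * \<bar>u x\<bar> powr g)) \<partial>lborel) \<le> C'" .
    let ?I = "\<integral>\<^sup>+ x. ennreal (Phi CARD('n) s \<alpha> (u x)) \<partial>lborel"
    \<comment> \<open>Multiplying by the volume of a ball of radius \<open>R\<close> rewrites the
      integral as one over all translates of local integrals, to each of which the linear bound
      applies.\<close>
    have "?I * ?V R = (\<integral>\<^sup>+ x. ?I * indicator (ball (0 :: real ^ 'n) R) x \<partial>lborel)"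
      by (rule nn_integral_cmult_indicator[symmetric]) simp
    also have "\<dots> = (\<integral>\<^sup>+ x. \<integral>\<^sup>+ a. ennreal (Phi CARD('n) s \<alpha> (u (x + a))) * indicator (ball (0 :: real ^ 'n) R) x \<partial>lborel \<partial>lborel)"
    proof (rule nn_integral_cong)
      fix x :: "real ^ 'n"
      show "?I * indicator (ball 0 R) x = (\<integral>\<^sup>+ a. ennreal (Phi CARD('n) s \<alpha> (u (x + a))) * indicator (ball 0 R) x \<partial>lborel)"
        using nn_integral_lborel_shift[of "\<lambda>a. ennreal (Phi CARD('n) s \<alpha> (u a))" x]
        by (simp add: nn_integral_multc add.commute)
    qed
    also have "\<dots> = (\<integral>\<^sup>+ a. \<integral>\<^sup>+ x. ennreal (Phi CARD('n) s \<alpha> (u (x + a))) * indicator (ball (0 :: real ^ 'n) R) x \<partial>lborel \<partial>lborel)"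
      by (rule lborel_pair.Fubini'[symmetric]) measurable
    also have "\<dots> \<le> (\<integral>\<^sup>+ a. ennreal (C / M) * gagliardo_energy s p (L.loc a) \<partial>lborel)"
    proof (rule nn_integral_mono)
      fix a
      have "(\<integral>\<^sup>+ x. ennreal (Phi CARD('n) s \<alpha> (u (x + a))) * indicator (ball (0 :: real ^ 'n) R) x \<partial>lborel)
        \<le> (\<integral>\<^sup>+ x\<in>ball 0 (3 * R). ennreal (Phi CARD('n) s \<alpha> (L.loc a x)) \<partial>lborel)"
      proof (intro nn_integral_mono)
        fix x :: "real ^ 'n"
        show "ennreal (Phi CARD('n) s \<alpha> (u (x + a))) * indicator (ball 0 R) x
          \<le> ennreal (Phi CARD('n) s \<alpha> (L.loc a x)) * indicator (ball 0 (3 * R)) x"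
          using cutoff_eq_1[of R x] R by (cases "norm x < R") (auto simp: L.loc_def)
      qed
      also have "\<dots> \<le> ennreal (C / M) * gagliardo_energy s p (L.loc a)" by (rule bounds(2))
      finally show "(\<integral>\<^sup>+ x. ennreal (Phi CARD('n) s \<alpha> (u (x + a))) * indicator (ball (0 :: real ^ 'n) R) x \<partial>lborel)
        \<le> ennreal (C / M) * gagliardo_energy s p (L.loc a)" .
    qed
    also have "\<dots> = ennreal (C / M) * (\<integral>\<^sup>+ a. gagliardo_energy s p (L.loc a) \<partial>lborel)"
      by (rule nn_integral_cmult) simp
    also have "\<dots> \<le> ennreal (C / M) * (ennreal ((1 + M) / 2) * (?V (2 * R) * 1) + ennreal B * (2 * ?V (2 * R) * ennreal \<delta> * ennreal (1 / \<tau>)))"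
      using L.energy_loc_average unfolding AB
      by (intro mult_left_mono order_trans[OF L.energy_loc_average] add_mono mult_mono E1 P K; simp add: AB)
    also have "\<dots> = D" by (simp add: D_def)
    finally have "?I * ?V R \<le> D" .
    then have "?I * ?V R / ?V R \<le> D / ?V R" by (rule divide_right_mono_ennreal)
    then have "?I \<le> D / ?V R" using V0 V[of R] by (simp add: ennreal_mult_divide_eq)
    with 1 show ?thesis by (auto simp: Ctot_def max.coboundedI1 max.coboundedI2)
  qed
  ultimately show ?thesis by blast
qed

text \<open>Outside the unit ball the weight is at most 1. Inside, \<open>Phi\<close> is at most the
  exponential, and Young's inequality separates it from the weight at the cost of raising \<alpha>
  to \<open>q * \<alpha>\<close> and \<beta> to \<open>\<beta> * q'\<close>.\<close>

lemma weighted_bound: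
  fixes s p \<alpha> \<alpha>' \<beta> \<tau> :: real
  defines "g \<equiv> real CARD('n::finite) / (real CARD('n) - s)"
  assumes MT: "\<And>b \<alpha>. 0 < b \<Longrightarrow> 0 \<le> \<alpha> \<Longrightarrow> \<alpha> < \<alpha>' \<Longrightarrow> \<exists>C<\<infinity>. \<forall>f :: real ^ 'n \<Rightarrow> real.
        f \<in> test_functions (ball 0 b) \<inter> frac_sobolev s p \<longrightarrow> f \<in> borel_measurable borel \<longrightarrow>
        gagliardo_energy s p f \<le> 1 \<longrightarrow> (\<integral>\<^sup>+ x\<in>ball 0 b. ennreal (exp (\<alpha> * \<bar>f x\<bar> powr g)) \<partial>lborel) \<le> C"
    and s: "0 < s" "s < 1" and p: "1 < p" "p = real CARD('n) / s"
    and \<beta>: "0 \<le> \<beta>" "\<beta> < real CARD('n)"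
    and \<alpha>: "0 < \<alpha>" "\<alpha> < (1 - \<beta> / real CARD('n)) * \<alpha>'" and \<tau>: "0 < \<tau>"
  shows "\<exists>C<\<infinity>. \<forall>u :: real ^ 'n \<Rightarrow> real. u \<in> borel_measurable borel \<longrightarrow>
      gagliardo_energy s p u + ennreal \<tau> * (\<integral>\<^sup>+ x. ennreal (\<bar>u x\<bar> powr p) \<partial>lborel) \<le> 1 \<longrightarrow>
      (\<integral>\<^sup>+ x. ennreal (Phi CARD('n) s \<alpha> (u x) / norm x powr \<beta>) \<partial>lborel) \<le> C"
proof -
  let ?N = "real CARD('n)"
  have N: "0 < ?N" by simp
  define c where "c = 1 - \<beta> / ?N"
  have c: "0 < c" "c \<le> 1" using \<beta> N by (auto simp: c_def field_simps)
  have \<alpha>': "\<alpha> < c * \<alpha>'" "0 < \<alpha>'"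
  proof -
    show "\<alpha> < c * \<alpha>'" using \<alpha> by (simp add: c_def)
    then show "0 < \<alpha>'" using \<alpha>(1) c by (smt (verit) mult_nonneg_nonpos)
  qed
  \<comment> \<open>The reciprocal of \<open>q\<close>, as a midpoint: lying above
    \<open>\<alpha> / \<alpha>'\<close> gives \<open>q * \<alpha> < \<alpha>'\<close>, lying below
    \<open>c\<close> gives \<open>\<beta> * q' < N\<close>. The assumption on \<alpha> leaves room
    between the two.\<close>
  define r where "r = (\<alpha> / \<alpha>' + c) / 2"
  have r: "\<alpha> / \<alpha>' < r" "r < c" using \<alpha>' by (auto simp: r_def field_simps)
  have r0: "0 < r" using r \<alpha> \<alpha>' by (smt (verit) divide_pos_pos)
  define q where "q = 1 / r"
  define q' where "q' = 1 / (1 - r)"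
  have q: "1 < q" "1 < q'" "1 / q + 1 / q' = 1" using r r0 c by (auto simp: q_def q'_def)
  have qa: "0 < q * \<alpha>" "q * \<alpha> < \<alpha>'" using r r0 \<alpha> \<alpha>' by (auto simp: q_def field_simps)
  have \<alpha>lt: "\<alpha> < \<alpha>'" using qa q \<alpha> by (smt (verit) mult_less_cancel_right1)
  have bq: "\<beta> * q' < ?N"
  proof -
    have "\<beta> / ?N < 1 - r" using r by (simp add: c_def)
    then show ?thesis using r c N by (simp add: q'_def field_simps)
  qed
  obtain C1 where C1: "C1 < \<infinity>" "\<And>u :: real ^ 'n \<Rightarrow> real. u \<in> borel_measurable borel \<Longrightarrow>
      gagliardo_energy s p u + ennreal \<tau> * (\<integral>\<^sup>+ x. ennreal (\<bar>u x\<bar> powr p) \<partial>lborel) \<le> 1 \<Longrightarrow>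
      (\<integral>\<^sup>+ x. ennreal (Phi CARD('n) s \<alpha> (u x)) \<partial>lborel) \<le> C1"
    using unweighted_bound[OF MT[unfolded g_def] s p \<alpha>(1) \<alpha>lt \<tau>] by blast
  obtain C2 where C2: "C2 < \<infinity>" "\<And>u :: real ^ 'n \<Rightarrow> real. u \<in> borel_measurable borel \<Longrightarrow>
      gagliardo_energy s p u + ennreal \<tau> * (\<integral>\<^sup>+ x. ennreal (\<bar>u x\<bar> powr p) \<partial>lborel) \<le> 1 \<Longrightarrow>
      (\<integral>\<^sup>+ x\<in>ball 0 1. ennreal (exp (q * \<alpha> * \<bar>u x\<bar> powr g)) \<partial>lborel) \<le> C2"
    using unweighted_bound[OF MT[unfolded g_def] s p qa \<tau>] unfolding g_def by blast
  define W where "W = (\<integral>\<^sup>+ x\<in>ball (0 :: real ^ 'n) 1. ennreal (norm x powr - (\<beta> * q')) \<partial>lborel)"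
  have W: "W < \<infinity>" unfolding W_def using bq by (intro nn_integral_norm_powr_ball) simp
  have "(\<integral>\<^sup>+ x. ennreal (Phi CARD('n) s \<alpha> (u x) / norm x powr \<beta>) \<partial>lborel) \<le> C1 + C2 + W"
    if u [measurable]: "u \<in> borel_measurable borel" and
     norm: "gagliardo_energy s p u + ennreal \<tau> * (\<integral>\<^sup>+ x. ennreal (\<bar>u x\<bar> powr p) \<partial>lborel) \<le> 1"
    for u :: "real ^ 'n \<Rightarrow> real"
  proof -
    let ?e = "\<lambda>x. ennreal (exp (q * \<alpha> * \<bar>u x\<bar> powr g)) * indicator (ball 0 1) x"
    let ?w = "\<lambda>x :: real ^ 'n. ennreal (norm x powr - (\<beta> * q')) * indicator (ball 0 1) x"
    have "ennreal (Phi CARD('n) s \<alpha> (u x) / norm x powr \<beta>) \<le> ennreal (Phi CARD('n) s \<alpha> (u x)) + ?e x + ?w x" for x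
    proof (cases "norm x < 1")
      case False
      then have "1 \<le> norm x powr \<beta>" using \<beta> by (intro ge_one_powr_ge_zero) auto
      then have "Phi CARD('n) s \<alpha> (u x) / norm x powr \<beta> \<le> Phi CARD('n) s \<alpha> (u x) / 1"
        using Phi_nonneg[of \<alpha>] \<alpha> by (intro divide_left_mono) auto
      then show ?thesis using False by (simp add: ennreal_leI)
    next
      case True
      have "Phi CARD('n) s \<alpha> (u x) / norm x powr \<beta> \<le> exp (\<alpha> * \<bar>u x\<bar> powr g) / norm x powr \<beta>"
        unfolding g_def using \<alpha> by (intro divide_right_mono Phi_le_exp) auto
      also have "\<dots> = exp (\<alpha> * \<bar>u x\<bar> powr g) * norm x powr - \<beta>" by (simp add: powr_minus divide_inverse)
      also have "\<dots> \<le> exp (\<alpha> * \<bar>u x\<bar> powr g) powr q / q + (norm x powr - \<beta>) powr q' / q'"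
        using q by (intro Youngs_inequality) auto
      also have "\<dots> \<le> exp (\<alpha> * \<bar>u x\<bar> powr g) powr q + (norm x powr - \<beta>) powr q'"
        using q by (intro add_mono) (auto simp: divide_le_eq mult_le_cancel_left1)
      also have "\<dots> = exp (q * \<alpha> * \<bar>u x\<bar> powr g) + norm x powr - (\<beta> * q')"
        by (simp add: powr_def[of "exp _"] powr_powr mult_ac)
      finally have "ennreal (Phi CARD('n) s \<alpha> (u x) / norm x powr \<beta>) \<le> ?e x + ?w x"
        using True by (simp add: ennreal_leI flip: ennreal_plus)
      also have "\<dots> \<le> ennreal (Phi CARD('n) s \<alpha> (u x)) + ?e x + ?w x" by (simp add: add.assoc)
      finally show ?thesis .
    qed
    then have "(\<integral>\<^sup>+ x. ennreal (Phi CARD('n) s \<alpha> (u x) / norm x powr \<beta>) \<partial>lborel)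
      \<le> (\<integral>\<^sup>+ x. ennreal (Phi CARD('n) s \<alpha> (u x)) + ?e x + ?w x \<partial>lborel)"
      by (intro nn_integral_mono)
    also have "\<dots> = (\<integral>\<^sup>+ x. ennreal (Phi CARD('n) s \<alpha> (u x)) + ?e x \<partial>lborel) + (\<integral>\<^sup>+ x. ?w x \<partial>lborel)"
      by (intro nn_integral_add) measurable
    also have "(\<integral>\<^sup>+ x. ennreal (Phi CARD('n) s \<alpha> (u x)) + ?e x \<partial>lborel) = (\<integral>\<^sup>+ x. ennreal (Phi CARD('n) s \<alpha> (u x)) \<partial>lborel) + (\<integral>\<^sup>+ x. ?e x \<partial>lborel)"
      by (intro nn_integral_add) measurable
    also have "(\<integral>\<^sup>+ x. ennreal (Phi CARD('n) s \<alpha> (u x)) \<partial>lborel) + (\<integral>\<^sup>+ x. ?e x \<partial>lborel) + (\<integral>\<^sup>+ x. ?w x \<partial>lborel) \<le> C1 + C2 + W"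
      unfolding W_def by (intro add_mono C1(2) C2(2) u norm order_refl)
    finally show ?thesis .
  qed
  moreover have "C1 + C2 + W < \<infinity>" using C1(1) C2(1) W by simp
  ultimately show ?thesis by blast
qed

section \<open>Finiteness for every exponent\<close>

text \<open>Tonelli and translation in the estimates ask for Borel functions. Changing
  \<open>u\<close> on a null set alters no integral involved; in the double integral, first almost
  every \<open>x\<close> and then almost every \<open>y\<close> is unaffected.\<close>

lemma sobolev_borel_representative:
  fixes u :: "real ^ 'n \<Rightarrow> real"
  assumes u: "u \<in> frac_sobolev s p"
  obtains u' :: "real ^ 'n \<Rightarrow> real" where "u' \<in> borel_measurable borel"
    "gagliardo_energy s p u' = gagliardo_energy s p u"
    "(\<integral>\<^sup>+ x. ennreal (\<bar>u' x\<bar> powr p) \<partial>lborel) = ennreal (\<integral>x. \<bar>u x\<bar> powr p \<partial>lebesgue)"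
    "\<forall>\<alpha> \<beta>. weighted_Phi_integral s \<alpha> \<beta> u = (\<integral>\<^sup>+ x. ennreal (Phi CARD('n) s \<alpha> (u' x) / norm x powr \<beta>) \<partial>lborel)"
proof -
  obtain u' :: "real ^ 'n \<Rightarrow> real" where [measurable]: "u' \<in> borel_measurable borel" and ae: "AE x in lborel. u x = u' x"
    using u completion_ex_borel_measurable_real[of u lborel] unfolding frac_sobolev_def by auto
  have "gagliardo_energy s p u' = gagliardo_energy s p u"
    unfolding gagliardo_energy_lborel
  proof (rule nn_integral_cong_AE)
    show "AE x in lborel. (\<integral>\<^sup>+ y. ennreal (\<bar>u' x - u' y\<bar> powr p / norm (x - y) powr (real CARD('n) + s * p)) \<partial>lborel)
      = (\<integral>\<^sup>+ y. ennreal (\<bar>u x - u y\<bar> powr p / norm (x - y) powr (real CARD('n) + s * p)) \<partial>lborel)"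
      using ae
    proof eventually_elim
      case (elim x)
      show ?case
        by (rule nn_integral_cong_AE) (use ae in eventually_elim, simp add: elim)
    qed
  qed
  moreover have "(\<integral>\<^sup>+ x. ennreal (\<bar>u' x\<bar> powr p) \<partial>lborel) = ennreal (\<integral>x. \<bar>u x\<bar> powr p \<partial>lebesgue)"
  proof -
    have "(\<integral>\<^sup>+ x. ennreal (\<bar>u' x\<bar> powr p) \<partial>lborel) = (\<integral>\<^sup>+ x. ennreal (\<bar>u x\<bar> powr p) \<partial>lborel)"
      by (rule nn_integral_cong_AE) (use ae in eventually_elim, simp)
    also have "\<dots> = (\<integral>\<^sup>+ x. ennreal (\<bar>u x\<bar> powr p) \<partial>lebesgue)" by (simp add: nn_integral_completion)
    also have "\<dots> = ennreal (\<integral>x. \<bar>u x\<bar> powr p \<partial>lebesgue)"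
      using u unfolding frac_sobolev_def by (intro nn_integral_eq_integral) auto
    finally show ?thesis .
  qed
  moreover have "weighted_Phi_integral s \<alpha> \<beta> u = (\<integral>\<^sup>+ x. ennreal (Phi CARD('n) s \<alpha> (u' x) / norm x powr \<beta>) \<partial>lborel)" for \<alpha> \<beta>
    unfolding weighted_Phi_integral_def nn_integral_completion
    by (rule nn_integral_cong_AE) (use ae in eventually_elim, simp)
  ultimately show ?thesis using that[of u'] by simp
qed

text \<open>The constant sequence approximates; its distance is 0 because
  \<open>0 powr a = 0\<close>.\<close>

lemma test_function_frac_sobolev_zero:
  assumes "f \<in> test_functions \<Omega> \<inter> frac_sobolev s p"
  shows "f \<in> frac_sobolev_zero s p \<Omega>"
proof -
  have "frac_sobolev_norm s p (\<lambda>x. f x - f x) = 0"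
    by (simp add: frac_sobolev_norm_def Lp_norm_def gagliardo_seminorm_def gagliardo_energy_def)
  then have "(\<lambda>k::nat. frac_sobolev_norm s p (\<lambda>x. f x - f x)) \<longlonglongrightarrow> 0" by simp
  then show ?thesis
    using assms unfolding frac_sobolev_zero_def by (intro CollectI conjI exI[of _ "\<lambda>_. f"]) auto
qed

section \<open>The part of a function above a level\<close>

text \<open>For \<open>m \<ge> 0\<close> this is soft thresholding,
  \<open>sgn t * max 0 (|t| - m)\<close>. Unlike cutting off by an indicator it is 1-Lipschitz, so
  the Gagliardo integrand does not grow.\<close>

definition excess :: "real \<Rightarrow> real \<Rightarrow> real" where
  "excess m t = t - max (- m) (min m t)"

lemma borel_measurable_excess [measurable]: "excess m \<in> borel_measurable borel"
  unfolding excess_def[abs_def] by measurable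

lemma excess_diff_le: "0 \<le> m \<Longrightarrow> \<bar>excess m a - excess m b\<bar> \<le> \<bar>a - b\<bar>"
  unfolding excess_def by linarith

lemma excess_le: "0 \<le> m \<Longrightarrow> \<bar>excess m a\<bar> \<le> \<bar>a\<bar>"
  unfolding excess_def by linarith

text \<open>Here \<open>|excess m a| = |a| - m \<ge> |a| / 2\<close>. The factor 2 is paid for by
  the choice of \<open>\<delta>\<close> in \<open>weighted_Phi_finite\<close>.\<close>

lemma excess_ge: "0 \<le> m \<Longrightarrow> 2 * m \<le> \<bar>a\<bar> \<Longrightarrow> \<bar>a\<bar> \<le> \<bar>2 * excess m a\<bar>"
  by (auto simp: excess_def max_def min_def abs_if)

lemma excess_tendsto_0: "(\<lambda>n. excess (real n) a) \<longlonglongrightarrow> 0"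
proof (rule tendsto_eventually)
  obtain n0 :: nat where "\<bar>a\<bar> \<le> real n0" using real_arch_simple by blast
  then have "excess (real n) a = 0" if "n0 \<le> n" for n
    using that unfolding excess_def by simp
  then show "\<forall>\<^sub>F n in sequentially. excess (real n) a = 0"
    by (auto simp: eventually_sequentially)
qed

lemma tendsto_abs_powr_0:
  fixes f :: "nat \<Rightarrow> real"
  assumes "f \<longlonglongrightarrow> 0" "0 < p"
  shows "(\<lambda>n. \<bar>f n\<bar> powr p) \<longlonglongrightarrow> 0"
proof -
  have "(\<lambda>n. \<bar>f n\<bar> powr p) \<longlonglongrightarrow> \<bar>0\<bar> powr p"
    using assms by (intro tendsto_powr' tendsto_rabs) auto
  then show ?thesis by simp
qed

text \<open>At a fixed point the excess is eventually 0, and it is dominated by \<open>u\<close>.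
  For the energy dominated convergence is used twice, the inner time at those \<open>x\<close> where
  the inner Gagliardo integral of \<open>u\<close> is finite.\<close>

lemma excess_norm_tendsto_0:
  fixes u :: "real ^ 'n \<Rightarrow> real"
  assumes [measurable]: "u \<in> borel_measurable borel" and p: "0 < p"
    and E: "gagliardo_energy s p u < \<infinity>" and P: "(\<integral>\<^sup>+ x. ennreal (\<bar>u x\<bar> powr p) \<partial>lborel) < \<infinity>"
  shows "(\<lambda>n. gagliardo_energy s p (\<lambda>x. excess (real n) (u x)) + (\<integral>\<^sup>+ x. ennreal (\<bar>excess (real n) (u x)\<bar> powr p) \<partial>lborel)) \<longlonglongrightarrow> 0"
proof -
  let ?e = "real CARD('n) + s * p"
  define F where "F n x y = ennreal (\<bar>excess (real n) (u x) - excess (real n) (u y)\<bar> powr p / norm (x - y) powr ?e)" for n and x y :: "real ^ 'n"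
  define F' where "F' x y = ennreal (\<bar>u x - u y\<bar> powr p / norm (x - y) powr ?e)" for x y
  have [measurable]: "(\<lambda>(x, y). F n x y) \<in> borel_measurable (borel \<Otimes>\<^sub>M borel)" for n
    unfolding F_def by measurable
  have [measurable]: "(\<lambda>(x, y). F' x y) \<in> borel_measurable (borel \<Otimes>\<^sub>M borel)"
    unfolding F'_def by measurable
  have le: "F n x y \<le> F' x y" for n x y
    unfolding F_def F'_def using p
    by (intro ennreal_leI divide_right_mono powr_mono2 excess_diff_le) auto
  have fin: "(\<integral>\<^sup>+ x. \<integral>\<^sup>+ y. F' x y \<partial>lborel \<partial>lborel) < \<infinity>"
    using E by (simp add: gagliardo_energy_lborel F'_def)
  have lim: "(\<lambda>n. F n x y) \<longlonglongrightarrow> 0" for x y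
  proof -
    have "(\<lambda>n. excess (real n) (u x) - excess (real n) (u y)) \<longlonglongrightarrow> 0 - 0"
      by (intro tendsto_diff excess_tendsto_0)
    then have "(\<lambda>n. \<bar>excess (real n) (u x) - excess (real n) (u y)\<bar> powr p) \<longlonglongrightarrow> 0"
      using p by (intro tendsto_abs_powr_0) auto
    then have "(\<lambda>n. \<bar>excess (real n) (u x) - excess (real n) (u y)\<bar> powr p * (1 / norm (x - y) powr ?e)) \<longlonglongrightarrow> 0"
      by (rule tendsto_mult_left_zero)
    then have "(\<lambda>n. ennreal (\<bar>excess (real n) (u x) - excess (real n) (u y)\<bar> powr p * (1 / norm (x - y) powr ?e))) \<longlonglongrightarrow> ennreal 0"
      by (rule tendsto_ennrealI)
    then show ?thesis by (simp add: F_def)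
  qed
  have "AE x in lborel. (\<integral>\<^sup>+ y. F' x y \<partial>lborel) \<noteq> \<infinity>"
    using fin by (intro nn_integral_noteq_infinite) auto
  then have "AE x in lborel. (\<lambda>n. \<integral>\<^sup>+ y. F n x y \<partial>lborel) \<longlonglongrightarrow> 0"
  proof eventually_elim
    case (elim x)
    have "(\<lambda>n. \<integral>\<^sup>+ y. F n x y \<partial>lborel) \<longlonglongrightarrow> (\<integral>\<^sup>+ y. 0 \<partial>(lborel :: (real ^ 'n) measure))"
      by (rule nn_integral_dominated_convergence[where w = "F' x"])
        (use elim le lim in \<open>auto simp: less_top[symmetric]\<close>)
    then show ?case by simp
  qed
  then have "(\<lambda>n. \<integral>\<^sup>+ x. \<integral>\<^sup>+ y. F n x y \<partial>lborel \<partial>lborel) \<longlonglongrightarrow> (\<integral>\<^sup>+ x. 0 \<partial>(lborel :: (real ^ 'n) measure))"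
    by (intro nn_integral_dominated_convergence[where w = "\<lambda>x. \<integral>\<^sup>+ y. F' x y \<partial>lborel"])
      (use fin le in \<open>auto intro!: nn_integral_mono\<close>)
  then have 1: "(\<lambda>n. gagliardo_energy s p (\<lambda>x. excess (real n) (u x))) \<longlonglongrightarrow> 0"
    by (simp add: gagliardo_energy_lborel F_def)
  have "(\<lambda>n. \<integral>\<^sup>+ x. ennreal (\<bar>excess (real n) (u x)\<bar> powr p) \<partial>lborel) \<longlonglongrightarrow> (\<integral>\<^sup>+ x. 0 \<partial>(lborel :: (real ^ 'n) measure))"
  proof (rule nn_integral_dominated_convergence[where w = "\<lambda>x. ennreal (\<bar>u x\<bar> powr p)"])
    show "AE x in lborel. (\<lambda>n. ennreal (\<bar>excess (real n) (u x)\<bar> powr p)) \<longlonglongrightarrow> 0"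
      using tendsto_ennrealI[OF tendsto_abs_powr_0[OF excess_tendsto_0 p]] by simp
    show "AE x in lborel. ennreal (\<bar>excess (real n) (u x)\<bar> powr p) \<le> ennreal (\<bar>u x\<bar> powr p)" for n
      using p by (intro AE_I2 ennreal_leI powr_mono2 excess_le) auto
  qed (use P in auto)
  then have 2: "(\<lambda>n. \<integral>\<^sup>+ x. ennreal (\<bar>excess (real n) (u x)\<bar> powr p) \<partial>lborel) \<longlonglongrightarrow> 0" by simp
  show ?thesis using tendsto_add[OF 1 2] by simp
qed

text \<open>Raising the level makes the excess as small as desired, so that after division by
  \<open>\<delta>\<close> it is admissible in \<open>bound\<close>; a small norm thereby replaces a
  small exponent.\<close>

lemma weighted_Phi_finite:
  fixes u :: "real ^ 'n \<Rightarrow> real" and s p \<alpha> \<alpha>\<^sub>0 \<beta> :: real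
  assumes bound: "\<And>w :: real ^ 'n \<Rightarrow> real. w \<in> borel_measurable borel \<Longrightarrow>
      gagliardo_energy s p w + (\<integral>\<^sup>+ x. ennreal (\<bar>w x\<bar> powr p) \<partial>lborel) \<le> 1 \<Longrightarrow>
      (\<integral>\<^sup>+ x. ennreal (Phi CARD('n) s \<alpha>\<^sub>0 (w x) / norm x powr \<beta>) \<partial>lborel) < \<infinity>"
    and u [measurable]: "u \<in> borel_measurable borel"
    and s: "0 < s" "s < real CARD('n)" and p: "0 < p" "p = real CARD('n) / s"
    and \<beta>: "0 \<le> \<beta>" "\<beta> < real CARD('n)" and \<alpha>: "0 < \<alpha>\<^sub>0" "0 < \<alpha>"
    and E: "gagliardo_energy s p u < \<infinity>" and P: "(\<integral>\<^sup>+ x. ennreal (\<bar>u x\<bar> powr p) \<partial>lborel) < \<infinity>"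
  shows "(\<integral>\<^sup>+ x. ennreal (Phi CARD('n) s \<alpha> (u x) / norm x powr \<beta>) \<partial>lborel) < \<infinity>"
proof -
  let ?N = "real CARD('n)"
  define g where "g = ?N / (?N - s)"
  have g: "0 < g" using s by (simp add: g_def)
  \<comment> \<open>Solves \<open>\<alpha> * (2 * \<delta>)^g = \<alpha>\<^sub>0\<close>, so that
    \<open>Phi\<close> with \<alpha> at \<open>2 * \<delta> * w\<close> is \<open>Phi\<close> with
    \<open>\<alpha>\<^sub>0\<close> at \<open>w\<close>.\<close>
  define \<delta> where "\<delta> = (\<alpha>\<^sub>0 / \<alpha>) powr (1 / g) / 2"
  have \<delta>: "0 < \<delta>" using \<alpha> by (simp add: \<delta>_def)
  have \<delta>\<alpha>: "\<alpha> * \<bar>2 * \<delta>\<bar> powr g = \<alpha>\<^sub>0" using \<alpha> g by (simp add: \<delta>_def powr_powr)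
  have "\<forall>\<^sub>F n in sequentially. gagliardo_energy s p (\<lambda>x. excess (real n) (u x)) + (\<integral>\<^sup>+ x. ennreal (\<bar>excess (real n) (u x)\<bar> powr p) \<partial>lborel) < ennreal (\<delta> powr p)"
    using \<delta> by (intro order_tendstoD(2)[OF excess_norm_tendsto_0[OF u p(1) E P]]) auto
  moreover have "\<forall>\<^sub>F n :: nat in sequentially. 1 \<le> n" by (rule eventually_ge_at_top)
  ultimately have "\<forall>\<^sub>F n in sequentially. gagliardo_energy s p (\<lambda>x. excess (real n) (u x)) + (\<integral>\<^sup>+ x. ennreal (\<bar>excess (real n) (u x)\<bar> powr p) \<partial>lborel) < ennreal (\<delta> powr p) \<and> 1 \<le> n"
    by eventually_elim simp
  then obtain n where n: "gagliardo_energy s p (\<lambda>x. excess (real n) (u x)) + (\<integral>\<^sup>+ x. ennreal (\<bar>excess (real n) (u x)\<bar> powr p) \<partial>lborel) < ennreal (\<delta> powr p)"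
      "1 \<le> n" by (auto simp: eventually_sequentially)
  define m where "m = real n"
  have m: "1 \<le> m" using n by (simp add: m_def)
  define w where "w x = (1 / \<delta>) * excess m (u x)" for x
  have [measurable]: "w \<in> borel_measurable borel" unfolding w_def by measurable
  have "gagliardo_energy s p w + (\<integral>\<^sup>+ x. ennreal (\<bar>w x\<bar> powr p) \<partial>lborel) =
     ennreal ((1 / \<delta>) powr p) * (gagliardo_energy s p (\<lambda>x. excess m (u x)) + (\<integral>\<^sup>+ x. ennreal (\<bar>excess m (u x)\<bar> powr p) \<partial>lborel))"
  proof -
    have "gagliardo_energy s p w = ennreal ((1 / \<delta>) powr p) * gagliardo_energy s p (\<lambda>x. excess m (u x))"
      unfolding w_def using \<delta> by (subst gagliardo_energy_mult) simp_all
    moreover have "(\<integral>\<^sup>+ x. ennreal (\<bar>w x\<bar> powr p) \<partial>lborel) = (\<integral>\<^sup>+ x. ennreal ((1 / \<delta>) powr p) * ennreal (\<bar>excess m (u x)\<bar> powr p) \<partial>lborel)"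
      unfolding w_def abs_mult powr_mult using \<delta> by (intro nn_integral_cong) (simp add: ennreal_mult)
    ultimately show ?thesis by (simp add: nn_integral_cmult distrib_left)
  qed
  also have "\<dots> \<le> ennreal ((1 / \<delta>) powr p) * ennreal (\<delta> powr p)"
    using n(1) by (intro mult_left_mono) (auto simp: m_def)
  also have "\<dots> = 1" using \<delta> by (simp add: ennreal_mult[symmetric] powr_divide)
  finally have W: "(\<integral>\<^sup>+ x. ennreal (Phi CARD('n) s \<alpha>\<^sub>0 (w x) / norm x powr \<beta>) \<partial>lborel) < \<infinity>"
    by (intro bound) auto
  define c where "c = Phi CARD('n) s \<alpha> (2 * m) / (2 * m) powr p"
  have c: "0 \<le> c" using Phi_nonneg[of \<alpha>] \<alpha> by (simp add: c_def)
  \<comment> \<open>Two majorants for the points where \<open>|u| \<le> 2 * m\<close>: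
    \<open>?P\<close> serves outside the unit ball, where the weight is at most 1, and
    \<open>?B\<close> inside, where \<open>Phi\<close> is bounded and the weight integrable.\<close>
  let ?P = "\<lambda>x. ennreal c * ennreal (\<bar>u x\<bar> powr p)"
  let ?B = "\<lambda>x :: real ^ 'n. ennreal (c * (2 * m) powr p) * (ennreal (norm x powr - \<beta>) * indicator (ball 0 1) x)"
  have "ennreal (Phi CARD('n) s \<alpha> (u x) / norm x powr \<beta>)
     \<le> ?P x + ?B x + ennreal (Phi CARD('n) s \<alpha>\<^sub>0 (w x) / norm x powr \<beta>)" for x
  proof (cases "\<bar>u x\<bar> \<le> 2 * m")
    case True
    have Phi: "Phi CARD('n) s \<alpha> (u x) \<le> c * \<bar>u x\<bar> powr p"
      unfolding c_def p(2) using True \<alpha> s m by (intro Phi_le_powr) auto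
    have "ennreal (Phi CARD('n) s \<alpha> (u x) / norm x powr \<beta>) \<le> ?P x + ?B x"
    proof (cases "norm x < 1")
      case False
      then have "1 \<le> norm x powr \<beta>" using \<beta> by (intro ge_one_powr_ge_zero) auto
      then have "Phi CARD('n) s \<alpha> (u x) / norm x powr \<beta> \<le> Phi CARD('n) s \<alpha> (u x) / 1"
        using Phi_nonneg[of \<alpha>] \<alpha> by (intro divide_left_mono) auto
      then have "Phi CARD('n) s \<alpha> (u x) / norm x powr \<beta> \<le> c * \<bar>u x\<bar> powr p" using Phi by simp
      then have "ennreal (Phi CARD('n) s \<alpha> (u x) / norm x powr \<beta>) \<le> ?P x"
        using c by (simp add: ennreal_mult[symmetric] ennreal_leI)
      then show ?thesis by (rule order_trans) simp
    next
      case True1: True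
      have "Phi CARD('n) s \<alpha> (u x) \<le> c * (2 * m) powr p"
        using Phi True p c by (elim order_trans) (intro mult_left_mono powr_mono2; simp)
      then have "Phi CARD('n) s \<alpha> (u x) / norm x powr \<beta> \<le> c * (2 * m) powr p / norm x powr \<beta>"
        by (rule divide_right_mono) simp
      also have "\<dots> = c * (2 * m) powr p * norm x powr - \<beta>" by (simp add: powr_minus divide_inverse)
      finally have "ennreal (Phi CARD('n) s \<alpha> (u x) / norm x powr \<beta>) \<le> ennreal (c * (2 * m) powr p * norm x powr - \<beta>)"
        by (rule ennreal_leI)
      also have "\<dots> = ?B x" using True1 c by (simp add: ennreal_mult)
      also have "\<dots> \<le> ?P x + ?B x" by simp
      finally show ?thesis .
    qed
    then show ?thesis by (rule order_trans) simp
  next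
    case False
    have "Phi CARD('n) s \<alpha> (u x) \<le> Phi CARD('n) s \<alpha> (2 * excess m (u x))"
      using \<alpha> s excess_ge[of m "u x"] False m by (intro Phi_mono) auto
    also have "2 * excess m (u x) = (2 * \<delta>) * w x" using \<delta> by (simp add: w_def)
    also have "Phi CARD('n) s \<alpha> ((2 * \<delta>) * w x) = Phi CARD('n) s \<alpha>\<^sub>0 (w x)"
      by (simp only: Phi_mult g_def[symmetric] \<delta>\<alpha>)
    finally have "ennreal (Phi CARD('n) s \<alpha> (u x) / norm x powr \<beta>) \<le> ennreal (Phi CARD('n) s \<alpha>\<^sub>0 (w x) / norm x powr \<beta>)"
      by (intro ennreal_leI divide_right_mono) auto
    then show ?thesis by (rule order_trans) simp
  qed
  then have "(\<integral>\<^sup>+ x. ennreal (Phi CARD('n) s \<alpha> (u x) / norm x powr \<beta>) \<partial>lborel)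
    \<le> (\<integral>\<^sup>+ x. ?P x + ?B x + ennreal (Phi CARD('n) s \<alpha>\<^sub>0 (w x) / norm x powr \<beta>) \<partial>lborel)"
    by (intro nn_integral_mono)
  also have "\<dots> = (\<integral>\<^sup>+ x. ?P x + ?B x \<partial>lborel) + (\<integral>\<^sup>+ x. ennreal (Phi CARD('n) s \<alpha>\<^sub>0 (w x) / norm x powr \<beta>) \<partial>lborel)"
    by (rule nn_integral_add) measurable
  also have "(\<integral>\<^sup>+ x. ?P x + ?B x \<partial>lborel) = (\<integral>\<^sup>+ x. ?P x \<partial>lborel) + (\<integral>\<^sup>+ x. ?B x \<partial>lborel)"
    by (rule nn_integral_add) measurable
  also have "(\<integral>\<^sup>+ x. ?P x \<partial>lborel) = ennreal c * (\<integral>\<^sup>+ x. ennreal (\<bar>u x\<bar> powr p) \<partial>lborel)"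
    by (rule nn_integral_cmult) measurable
  also have "(\<integral>\<^sup>+ x. ?B x \<partial>lborel) = ennreal (c * (2 * m) powr p) * (\<integral>\<^sup>+ x\<in>ball (0 :: real ^ 'n) 1. ennreal (norm x powr - \<beta>) \<partial>lborel)"
    by (rule nn_integral_cmult) measurable
  also have "ennreal c * (\<integral>\<^sup>+ x. ennreal (\<bar>u x\<bar> powr p) \<partial>lborel)
      + ennreal (c * (2 * m) powr p) * (\<integral>\<^sup>+ x\<in>ball (0 :: real ^ 'n) 1. ennreal (norm x powr - \<beta>) \<partial>lborel)
      + (\<integral>\<^sup>+ x. ennreal (Phi CARD('n) s \<alpha>\<^sub>0 (w x) / norm x powr \<beta>) \<partial>lborel) < \<infinity>"
    using P W nn_integral_norm_powr_ball[where a = \<beta> and 'a = "real ^ 'n"] \<beta>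
    by (simp add: ennreal_mult_less_top)
  finally show ?thesis .
qed

theorem theorem3p1:
  fixes s p \<alpha>\<^sub>N\<^sub>s :: real
  assumes "CARD('n::finite) \<ge> 2"
    and "0 < s" and "s < 1"
    and "p = real CARD('n) / s"
    and "\<alpha>\<^sub>N\<^sub>s > 0"
    and moser_trudinger:
      "\<And>(\<Omega> :: (real ^ 'n) set) \<alpha>. bounded_lipschitz_domain \<Omega> \<Longrightarrow> 0 \<le> \<alpha> \<Longrightarrow> \<alpha> < \<alpha>\<^sub>N\<^sub>s \<Longrightarrow>
        (SUP u \<in> {u \<in> frac_sobolev_zero s p \<Omega>. gagliardo_seminorm s p u \<le> 1}.
           \<integral>\<^sup>+ x\<in>\<Omega>. ennreal (exp (\<alpha> * \<bar>u x\<bar> powr (real CARD('n) / (real CARD('n) - s)))) \<partial>lebesgue) < \<infinity>"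
  shows "(\<forall>\<alpha> > 0. \<forall>\<beta> \<in> {0 ..< real CARD('n)}. \<forall>u \<in> (frac_sobolev s p :: (real ^ 'n \<Rightarrow> real) set).
            weighted_Phi_integral s \<alpha> \<beta> u < \<infinity>) \<and>
         (\<forall>\<beta> \<in> {0 ..< real CARD('n)}. \<forall>\<alpha> \<tau>.
            0 < \<alpha> \<and> \<alpha> < (1 - \<beta> / real CARD('n)) * \<alpha>\<^sub>N\<^sub>s \<and> \<tau> > 0 \<longrightarrow>
            (SUP u \<in> {u \<in> (frac_sobolev s p :: (real ^ 'n \<Rightarrow> real) set). frac_sobolev_norm_tau s p \<tau> u \<le> 1}.
               weighted_Phi_integral s \<alpha> \<beta> u) < \<infinity>)"
proof -
  let ?N = "real CARD('n)"
  let ?g = "?N / (?N - s)"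
  note s = assms(2,3)
  have N2: "2 \<le> ?N" using assms(1) by simp
  have sN: "s < ?N" using s N2 by linarith
  have p1: "1 < p" using assms(4) s sN by (simp add: less_divide_eq)
  have MT: "\<exists>C<\<infinity>. \<forall>f :: real ^ 'n \<Rightarrow> real.
        f \<in> test_functions (ball 0 b) \<inter> frac_sobolev s p \<longrightarrow> f \<in> borel_measurable borel \<longrightarrow>
        gagliardo_energy s p f \<le> 1 \<longrightarrow> (\<integral>\<^sup>+ x\<in>ball 0 b. ennreal (exp (\<alpha> * \<bar>f x\<bar> powr ?g)) \<partial>lborel) \<le> C"
    if "0 < b" "0 \<le> \<alpha>" "\<alpha> < \<alpha>\<^sub>N\<^sub>s" for b \<alpha>
  proof -
    define C where "C = (SUP u \<in> {u \<in> frac_sobolev_zero s p (ball (0 :: real ^ 'n) b). gagliardo_seminorm s p u \<le> 1}.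
           \<integral>\<^sup>+ x\<in>ball 0 b. ennreal (exp (\<alpha> * \<bar>u x\<bar> powr ?g)) \<partial>lebesgue)"
    have "C < \<infinity>" unfolding C_def
      by (rule moser_trudinger[OF bounded_lipschitz_domain_ball[OF that(1)] that(2,3)])
    moreover have "(\<integral>\<^sup>+ x\<in>ball 0 b. ennreal (exp (\<alpha> * \<bar>f x\<bar> powr ?g)) \<partial>lborel) \<le> C"
      if f: "f \<in> test_functions (ball 0 b) \<inter> frac_sobolev s p" and e: "gagliardo_energy s p f \<le> 1" for f :: "real ^ 'n \<Rightarrow> real"
    proof -
      \<comment> \<open>The energy is finite here, so \<open>enn2real\<close> returns its true value
        and no default.\<close>
      have "enn2real (gagliardo_energy s p f) \<le> 1" using e by (intro enn2real_leI) auto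
      then have "gagliardo_seminorm s p f \<le> 1"
        unfolding gagliardo_seminorm_def using p1 by (intro powr_le1) auto
      then have "(\<integral>\<^sup>+ x\<in>ball 0 b. ennreal (exp (\<alpha> * \<bar>f x\<bar> powr ?g)) \<partial>lebesgue) \<le> C"
        unfolding C_def using test_function_frac_sobolev_zero[OF f] by (intro SUP_upper) auto
      then show ?thesis by (simp add: nn_integral_completion)
    qed
    ultimately show ?thesis by blast
  qed
  show ?thesis
  proof (intro conjI allI impI ballI)
    fix \<alpha> \<beta> :: real and u :: "real ^ 'n \<Rightarrow> real"
    assume \<alpha>: "0 < \<alpha>" and \<beta>: "\<beta> \<in> {0..<?N}" and u: "u \<in> frac_sobolev s p"
    \<comment> \<open>Half the threshold, a convenient admissible exponent;
      \<open>weighted_Phi_finite\<close> passes from it to an arbitrary \<alpha>.\<close>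
    define \<alpha>\<^sub>0 where "\<alpha>\<^sub>0 = (1 - \<beta> / ?N) * \<alpha>\<^sub>N\<^sub>s / 2"
    have "0 < (1 - \<beta> / ?N) * \<alpha>\<^sub>N\<^sub>s"
      using \<beta> assms(5) N2 by (intro mult_pos_pos) auto
    then have \<alpha>\<^sub>0: "0 < \<alpha>\<^sub>0" "\<alpha>\<^sub>0 < (1 - \<beta> / ?N) * \<alpha>\<^sub>N\<^sub>s" by (simp_all add: \<alpha>\<^sub>0_def mult.commute)
    obtain u' :: "real ^ 'n \<Rightarrow> real" where u': "u' \<in> borel_measurable borel"
      "gagliardo_energy s p u' = gagliardo_energy s p u"
      "(\<integral>\<^sup>+ x. ennreal (\<bar>u' x\<bar> powr p) \<partial>lborel) = ennreal (\<integral>x. \<bar>u x\<bar> powr p \<partial>lebesgue)"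
      "\<forall>\<alpha> \<beta>. weighted_Phi_integral s \<alpha> \<beta> u = (\<integral>\<^sup>+ x. ennreal (Phi CARD('n) s \<alpha> (u' x) / norm x powr \<beta>) \<partial>lborel)"
      using sobolev_borel_representative[OF u] by blast
    have \<beta>': "0 \<le> \<beta>" "\<beta> < ?N" using \<beta> by auto
    obtain C where C: "C < \<infinity>" "\<And>w :: real ^ 'n \<Rightarrow> real. w \<in> borel_measurable borel \<Longrightarrow>
      gagliardo_energy s p w + ennreal 1 * (\<integral>\<^sup>+ x. ennreal (\<bar>w x\<bar> powr p) \<partial>lborel) \<le> 1 \<Longrightarrow>
      (\<integral>\<^sup>+ x. ennreal (Phi CARD('n) s \<alpha>\<^sub>0 (w x) / norm x powr \<beta>) \<partial>lborel) \<le> C"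
      using weighted_bound[OF MT s p1 assms(4) \<beta>' \<alpha>\<^sub>0 zero_less_one] by blast
    show "weighted_Phi_integral s \<alpha> \<beta> u < \<infinity>"
      unfolding u'(4)[rule_format]
    proof (rule weighted_Phi_finite[OF le_less_trans[OF C(2)[unfolded ennreal_1 mult_1] C(1)] u'(1) s(1) sN _ assms(4) _ _ \<alpha>\<^sub>0(1) \<alpha>])
      show "gagliardo_energy s p u' < \<infinity>" using u unfolding u'(2) frac_sobolev_def by simp
    qed (use p1 \<beta> u'(3) in auto)
  next
    fix \<alpha> \<beta> \<tau> :: real
    assume \<beta>: "\<beta> \<in> {0..<?N}" and *: "0 < \<alpha> \<and> \<alpha> < (1 - \<beta> / ?N) * \<alpha>\<^sub>N\<^sub>s \<and> \<tau> > 0"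
    then have \<alpha>: "0 < \<alpha>" "\<alpha> < (1 - \<beta> / ?N) * \<alpha>\<^sub>N\<^sub>s" and \<tau>: "0 < \<tau>" by auto
    have \<beta>': "0 \<le> \<beta>" "\<beta> < ?N" using \<beta> by auto
    obtain C where C: "C < \<infinity>" "\<And>w :: real ^ 'n \<Rightarrow> real. w \<in> borel_measurable borel \<Longrightarrow>
      gagliardo_energy s p w + ennreal \<tau> * (\<integral>\<^sup>+ x. ennreal (\<bar>w x\<bar> powr p) \<partial>lborel) \<le> 1 \<Longrightarrow>
      (\<integral>\<^sup>+ x. ennreal (Phi CARD('n) s \<alpha> (w x) / norm x powr \<beta>) \<partial>lborel) \<le> C"
      using weighted_bound[OF MT s p1 assms(4) \<beta>' \<alpha> \<tau>] by blast
    have "weighted_Phi_integral s \<alpha> \<beta> u \<le> C"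
      if u: "u \<in> frac_sobolev s p" and n: "frac_sobolev_norm_tau s p \<tau> u \<le> 1" for u :: "real ^ 'n \<Rightarrow> real"
    proof -
      obtain u' :: "real ^ 'n \<Rightarrow> real" where u': "u' \<in> borel_measurable borel"
        "gagliardo_energy s p u' = gagliardo_energy s p u"
        "(\<integral>\<^sup>+ x. ennreal (\<bar>u' x\<bar> powr p) \<partial>lborel) = ennreal (\<integral>x. \<bar>u x\<bar> powr p \<partial>lebesgue)"
        "\<forall>\<alpha> \<beta>. weighted_Phi_integral s \<alpha> \<beta> u = (\<integral>\<^sup>+ x. ennreal (Phi CARD('n) s \<alpha> (u' x) / norm x powr \<beta>) \<partial>lborel)"
        using sobolev_borel_representative[OF u] by blast
      define E where "E = enn2real (gagliardo_energy s p u)"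
      define I where "I = (\<integral>x. \<bar>u x\<bar> powr p \<partial>lebesgue)"
      have I: "0 \<le> I" unfolding I_def by (intro Bochner_Integration.integral_nonneg) auto
      have E: "gagliardo_energy s p u = ennreal E" "0 \<le> E"
        using u unfolding E_def frac_sobolev_def by (auto simp: ennreal_enn2real_if)
      have "(E + \<tau> * I) powr (1 / p) \<le> 1"
        using n p1 E(2) unfolding frac_sobolev_norm_tau_def gagliardo_seminorm_def E_def[symmetric] I_def[symmetric]
        by (simp add: powr_powr)
      then have "E + \<tau> * I \<le> 1"
        \<comment> \<open>The root is removed by contraposition: a number above 1 has a positive
          power above 1.\<close>
        using gr_one_powr[of "E + \<tau> * I" "1 / p"] p1 by (meson not_le divide_pos_pos less_trans zero_less_one)
      then have "gagliardo_energy s p u' + ennreal \<tau> * (\<integral>\<^sup>+ x. ennreal (\<bar>u' x\<bar> powr p) \<partial>lborel) \<le> 1"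
        using E I \<tau> unfolding u'(2,3) I_def[symmetric]
        by (simp add: ennreal_mult[symmetric] flip: ennreal_plus ennreal_1)
      then show ?thesis unfolding u'(4)[rule_format] by (rule C(2)[OF u'(1)])
    qed
    then have "(SUP u \<in> {u \<in> (frac_sobolev s p :: (real ^ 'n \<Rightarrow> real) set). frac_sobolev_norm_tau s p \<tau> u \<le> 1}.
               weighted_Phi_integral s \<alpha> \<beta> u) \<le> C"
      by (intro SUP_least) auto
    then show "(SUP u \<in> {u \<in> (frac_sobolev s p :: (real ^ 'n \<Rightarrow> real) set). frac_sobolev_norm_tau s p \<tau> u \<le> 1}.
               weighted_Phi_integral s \<alpha> \<beta> u) < \<infinity>"
      using C(1) by (rule le_less_trans)
  qed
qed

end
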